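(* Helices correspond to $L^2(\mathbb{R})$ linearly stable stationary solutions of $$\tau_t = D_s\big(\tau^{-1/2}-\tau^{3/2}+D_s^2(\tau^{-1/2})\big).$$ That is, every stationary solution $\tau\equiv\tau_0$ with $\tau_0>0$ a constant is $L^2(\mathbb{R})$ linearly stable.
   Context: $D_s$ denotes the derivative with respect to $s\in\mathbb{R}$, and $\tau=\tau(s,t)>0$. The equation is the evolution of torsion for curves of constant curvature $1$ in $\mathbb{R}^3$ moving by $X_t=\tau^{-1/2}\mathbf{B}$ ($\mathbf{B}$ the unit binormal); helices are the curves with constant curvature and constant torsion, and they correspond to the constant stationary solutions $\tau\equiv\tau_0>0$. The linearization at a stationary solution $\tau_0$ is the linear PDE $w_t=\frac{d}{d\epsilon}\big|_{\epsilon=0}F(\tau_0+\epsilon w)$ for $w=w(s,t)$, where $F(\tau)=D_s\big(\tau^{-1/2}-\tau^{3/2}+D_s^2(\tau^{-1/2})\big)$. A stationary solution is called $L^2(\mathbb{R})$ linearly stable when $w=0$ is a stable solution of the corresponding linearized PDE with respect to the $L^2(\mathbb{R})$ norm for initial data in $L^2(\mathbb{R})$: for every $\epsilon>0$ there exists $\delta>0$ such that if $w_0\in L^2(\mathbb{R})$ and $\|w_0\|_2<\delta$, then the solution $w(t)$ of the linearized PDE with initial data $w_0$ satisfies $\|w(t)\|_2<\epsilon$ for all $t\ge0$. Solutions are understood in the weak sense, via the Fourier transform in $s$: $w(t)$ is a tempered distribution on $\mathbb{R}$ for each $t\geq 0$, satisfies the linearized PDE in the distributional sense, and $w(t)\to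 w_0$ in $\mathcal{S}'(\mathbb{R})$ as $t\to0$. *)

theory Defs
  imports "HOL-Analysis.Analysis"
begin

section \<open>The torsion equation and its linearization at a constant\<close>

definition smooth :: "(real \<Rightarrow> real) \<Rightarrow> bool" where
  "smooth f \<longleftrightarrow> (\<forall>k s. (deriv ^^ k) f differentiable (at s))"

definition torsion_rhs :: "(real \<Rightarrow> real) \<Rightarrow> real \<Rightarrow> real" where
  "torsion_rhs \<tau> =
     deriv (\<lambda>s. \<tau> s powr (-1/2) - \<tau> s powr (3/2)
              + (deriv ^^ 2) (\<lambda>x. \<tau> x powr (-1/2)) s)"

definition stationary_solution :: "(real \<Rightarrow> real) \<Rightarrow> bool" where
  "stationary_solution \<tau> \<longleftrightarrow> smooth \<tau> \<and> (\<forall>s. \<tau> s > 0) \<and> (\<forall>s. torsion_rhs \<tau> s = 0)"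

text \<open>
  The derivative is taken at each point \<open>s\<close>. It is used below only for Schwartz functions \<open>u\<close>;
  these are bounded, so that for \<open>\<tau>\<^sub>0 > 0\<close> the function \<open>\<tau>\<^sub>0 + \<epsilon> u\<close> is positive for small \<open>\<epsilon>\<close>.
\<close>

definition linearization :: "real \<Rightarrow> (real \<Rightarrow> real) \<Rightarrow> real \<Rightarrow> real" where
  "linearization \<tau>\<^sub>0 u s = deriv (\<lambda>\<epsilon>. torsion_rhs (\<lambda>x. \<tau>\<^sub>0 + \<epsilon> * u x) s) 0"


section \<open>Tempered distributions\<close>

text \<open>
  Torsion and its perturbations are real, so test functions and distributions are real-valued.
  Distributions are represented by functionals on all functions \<open>real \<Rightarrow> real\<close>, of which only the
  values on Schwartz functions matter.
\<close>

definition schwartz :: "(real \<Rightarrow> real) \<Rightarrow> bool" where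
  "schwartz \<phi> \<longleftrightarrow> smooth \<phi> \<and> (\<forall>j k. bounded (range (\<lambda>s. s ^ j * (deriv ^^ k) \<phi> s)))"

definition schwartz_seminorm :: "nat \<Rightarrow> nat \<Rightarrow> (real \<Rightarrow> real) \<Rightarrow> real" where
  "schwartz_seminorm j k \<phi> = (SUP s. \<bar>s ^ j * (deriv ^^ k) \<phi> s\<bar>)"

definition schwartz_converges :: "(nat \<Rightarrow> real \<Rightarrow> real) \<Rightarrow> (real \<Rightarrow> real) \<Rightarrow> bool" where
  "schwartz_converges \<Phi> \<phi> \<longleftrightarrow>
     (\<forall>j k. (\<lambda>n. schwartz_seminorm j k (\<lambda>s. \<Phi> n s - \<phi> s)) \<longlonglongrightarrow> 0)"

text \<open>
  The Schwartz topology is given by countably many seminorms, so sequential continuity of a linear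
  functional is continuity.
\<close>

definition tempered_distribution :: "((real \<Rightarrow> real) \<Rightarrow> real) \<Rightarrow> bool" where
  "tempered_distribution T \<longleftrightarrow>
     (\<forall>\<phi> \<psi> a b. schwartz \<phi> \<longrightarrow> schwartz \<psi> \<longrightarrow>
        T (\<lambda>s. a * \<phi> s + b * \<psi> s) = a * T \<phi> + b * T \<psi>) \<and>
     (\<forall>\<Phi> \<phi>. (\<forall>n. schwartz (\<Phi> n)) \<longrightarrow> schwartz \<phi> \<longrightarrow> schwartz_converges \<Phi> \<phi> \<longrightarrow>
        (\<lambda>n. T (\<Phi> n)) \<longlonglongrightarrow> T \<phi>)"

definition L2 :: "(real \<Rightarrow> real) set" where
  "L2 = {f. f \<in> borel_measurable lborel \<and> integrable lborel (\<lambda>s. (f s)\<^sup>2)}"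

definition L2_norm :: "(real \<Rightarrow> real) \<Rightarrow> real" where
  "L2_norm f = sqrt (LINT s|lborel. (f s)\<^sup>2)"

definition represents :: "(real \<Rightarrow> real) \<Rightarrow> ((real \<Rightarrow> real) \<Rightarrow> real) \<Rightarrow> bool" where
  "represents f T \<longleftrightarrow> (\<forall>\<phi>. schwartz \<phi> \<longrightarrow> T \<phi> = (LINT s|lborel. f s * \<phi> s))"


section \<open>Weak solutions of the linearized equation and linear stability\<close>

text \<open>
  The operator \<open>A\<close> acts on a distribution \<open>T\<close> by duality, \<open>\<langle>A T, \<phi>\<rangle> = \<langle>T, \<psi>\<rangle>\<close> where \<open>\<psi>\<close> is the
  image of \<open>\<phi>\<close> under the formal transpose of \<open>A\<close>, i.e. \<open>\<integral> (A u) \<phi> = \<integral> u \<psi>\<close> for all Schwartz \<open>u\<close>.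
\<close>

definition transposed_test ::
  "((real \<Rightarrow> real) \<Rightarrow> real \<Rightarrow> real) \<Rightarrow> (real \<Rightarrow> real) \<Rightarrow> (real \<Rightarrow> real) \<Rightarrow> bool" where
  "transposed_test A \<phi> \<psi> \<longleftrightarrow> schwartz \<psi> \<and>
     (\<forall>u. schwartz u \<longrightarrow>
        (LINT s|lborel. A u s * \<phi> s) = (LINT s|lborel. u s * \<psi> s))"

text \<open>
  The equation \<open>w\<^sub>t = A w\<close> holds in the space of tempered distributions on the line, for \<open>t > 0\<close>;
  limits and derivatives in \<open>t\<close> are those of the weak topology, i.e. taken after pairing
  with a test function. The convergence to the initial datum as \<open>t \<rightarrow> 0\<close> includes the value at
  \<open>t = 0\<close>. Values \<open>w t\<close> for \<open>t < 0\<close> are irrelevant.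
\<close>

definition weak_solution ::
  "real \<Rightarrow> (real \<Rightarrow> real) \<Rightarrow> (real \<Rightarrow> (real \<Rightarrow> real) \<Rightarrow> real) \<Rightarrow> bool" where
  "weak_solution \<tau>\<^sub>0 w\<^sub>0 w \<longleftrightarrow>
     (\<forall>t\<ge>0. tempered_distribution (w t)) \<and>
     (\<forall>t>0. \<forall>\<phi>. schwartz \<phi> \<longrightarrow>
        (\<exists>\<psi>. transposed_test (linearization \<tau>\<^sub>0) \<phi> \<psi> \<and>
             ((\<lambda>r. w r \<phi>) has_real_derivative w t \<psi>) (at t))) \<and>
     represents w\<^sub>0 (w 0) \<and>
     (\<forall>\<phi>. schwartz \<phi> \<longrightarrow> ((\<lambda>t. w t \<phi>) \<longlongrightarrow> (LINT s|lborel. w\<^sub>0 s * \<phi> s)) (at_right 0))"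

text \<open>
  ``The solution'' with given initial data is rendered as existence of a solution together with the
  bound for every solution. Uniqueness then follows: by linearity the difference of two solutions
  is a solution with initial data \<open>0\<close>, hence smaller than every \<open>\<epsilon>\<close>.
\<close>

definition L2_linearly_stable :: "real \<Rightarrow> bool" where
  "L2_linearly_stable \<tau>\<^sub>0 \<longleftrightarrow>
     (\<forall>\<epsilon>>0. \<exists>\<delta>>0. \<forall>w\<^sub>0\<in>L2. L2_norm w\<^sub>0 < \<delta> \<longrightarrow>
        (\<exists>w. weak_solution \<tau>\<^sub>0 w\<^sub>0 w) \<and>
        (\<forall>w. weak_solution \<tau>\<^sub>0 w\<^sub>0 w \<longrightarrow>
           (\<forall>t\<ge>0. \<exists>f\<in>L2. represents f (w t) \<and> L2_norm f < \<epsilon>)))"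

end

theory Submission
  imports Defs "HOL-Probability.Probability"
begin

text \<open>
  At \<open>\<tau>\<^sub>0\<close> the linearization is the Airy-type operator \<open>u \<mapsto> - (a D\<^sup>3 u + b D u)\<close> with
  \<open>a = \<tau>\<^sub>0\<^sup>-\<^sup>3\<^sup>/\<^sup>2/2\<close> and \<open>b = a + 3 \<tau>\<^sub>0\<^sup>1\<^sup>/\<^sup>2/2\<close>, whose transpose is \<open>B = a D\<^sup>3 + b D\<close>. The group
  \<open>U\<^sub>t = exp (t B)\<close> is a Fourier multiplier of modulus one: it preserves the Schwartz space, and it is
  an isometry in \<open>L\<^sup>2\<close> because \<open>B\<close> is skew. Existence is by duality, \<open>w(t) \<phi> = \<integral> w\<^sub>0 U\<^sub>t \<phi>\<close>. Conversely, along
  a weak solution \<open>r \<mapsto> w(r) (U\<^sub>t\<^sub>-\<^sub>r \<phi>)\<close> has derivative zero, which needs that \<open>w(r)\<close> is equicontinuous for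
  bounded \<open>r\<close> (uniform boundedness on the Schwartz space, by a gliding hump). Hence
  \<open>|w(t) \<phi>| \<le> \<parallel>w\<^sub>0\<parallel> \<parallel>\<phi>\<parallel>\<close>, and the Riesz representation theorem gives \<open>\<parallel>w(t)\<parallel> \<le> \<parallel>w\<^sub>0\<parallel>\<close>, so that \<open>\<delta> = \<epsilon>\<close> works.
\<close>

section \<open>Schwartz functions\<close>

text \<open>Test functions and distributions are real-valued, so the Fourier transform is carried as
  a pair of cosine and sine transforms, and the multiplier becomes a shift of the phase by t
  p(\<xi>), where p is the symbol of the flow. That U_t preserves the Schwartz space is not visible
  from modulus one: the \<xi>-derivatives of the multiplier grow polynomially. Decay in s is rescued
  by the commutation rule s U_t f = U_t (s f) - t U_t (b f + 3 a f''), which trades one weight for a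
  factor t and at most two derivatives. It also bounds every seminorm of U_t f for bounded t. The
  obstacle to uniqueness is that a weak solution is differentiable only against fixed test
  functions, whereas in w(r) (U_{t-r} \<phi>) both arguments move. Expanding the test function to
  second order in time leaves an error with w(q) (U_s B B \<phi>) times (q - r)^2. Boundedness in q
  for each single test function does not control it; a bound over the whole orbit of test functions
  does.\<close>

text \<open>
  Plain boundedness suffices: the weights and derivatives in the seminorms are absorbed by the two
  closure conditions.
\<close>

lemma schwartz_coinduct:
  assumes "f \<in> X"
    and deriv: "\<And>g. g \<in> X \<Longrightarrow> \<exists>g'\<in>X. \<forall>s. (g has_real_derivative g' s) (at s)"
    and mult: "\<And>g. g \<in> X \<Longrightarrow> (\<lambda>s. s * g s) \<in> X"
    and bounded: "\<And>g. g \<in> X \<Longrightarrow> bounded (range g)"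
  shows "schwartz f"
proof -
  have D: "deriv g \<in> X \<and> (\<forall>s. g differentiable (at s))" if gX: "g \<in> X" for g
  proof -
    obtain g' where g': "g' \<in> X" "\<And>s. (g has_real_derivative g' s) (at s)"
      using deriv[OF gX] by blast
    have "deriv g = g'" using g'(2) by (auto intro: DERIV_imp_deriv)
    then show ?thesis using g' real_differentiable_def by blast
  qed
  have Dk: "(deriv ^^ k) f \<in> X" for k
    by (induction k) (use assms(1) D in auto)
  have M: "(\<lambda>s. s ^ j * g s) \<in> X" if "g \<in> X" for j g
  proof (induction j)
    case 0
    then show ?case using that by simp
  next
    case (Suc j)
    then show ?case using mult[OF Suc] by (simp add: mult.assoc)
  qed
  show ?thesis
    unfolding schwartz_def smooth_def using Dk D M bounded by blast
qed

lemma deriv_eqI: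
  assumes "\<And>s. (f has_real_derivative f' s) (at s)"
  shows "deriv f = f'"
  using assms by (auto intro: DERIV_imp_deriv)

lemma schwartz_has_deriv_funpow:
  assumes "schwartz f"
  shows "((deriv ^^ k) f has_real_derivative (deriv ^^ Suc k) f s) (at s)"
  using assms unfolding schwartz_def smooth_def
  by (auto simp: DERIV_deriv_iff_real_differentiable)

lemma schwartz_has_deriv:
  assumes "schwartz f"
  shows "(f has_real_derivative deriv f s) (at s)"
  using schwartz_has_deriv_funpow[OF assms, of 0] by simp

lemma schwartz_deriv:
  assumes "schwartz f"
  shows "schwartz (deriv f)"
proof -
  have "(deriv ^^ k) (deriv f) = (deriv ^^ Suc k) f" for k
    by (simp add: funpow_swap1)
  then show ?thesis using assms unfolding schwartz_def smooth_def by metis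
qed

lemma schwartz_bound:
  assumes "schwartz f"
  obtains K where "K \<ge> 0" "\<And>s. \<bar>s ^ j * (deriv ^^ k) f s\<bar> \<le> K"
proof -
  have "bounded (range (\<lambda>s. s ^ j * (deriv ^^ k) f s))"
    using assms by (simp add: schwartz_def)
  then obtain K where "\<And>s. \<bar>s ^ j * (deriv ^^ k) f s\<bar> \<le> K"
    unfolding bounded_iff by auto
  moreover from this[of 0] have "K \<ge> 0" by (meson abs_ge_zero order_trans)
  ultimately show ?thesis using that by blast
qed

text \<open>Leibniz's rule with one linear factor, so only two terms survive. At
  \<open>k = 0\<close> the truncated index \<open>k - 1\<close> is harmless because its coefficient
  is 0.\<close>

lemma funpow_deriv_mult_id:
  assumes "schwartz f"
  shows "(deriv ^^ k) (\<lambda>s. s * f s) =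
    (\<lambda>s. s * (deriv ^^ k) f s + real k * (deriv ^^ (k - 1)) f s)"
proof (induction k)
  case 0
  then show ?case by simp
next
  case (Suc k)
  have "((\<lambda>s. s * (deriv ^^ k) f s + real k * (deriv ^^ (k - 1)) f s) has_real_derivative
      s * (deriv ^^ Suc k) f s + real (Suc k) * (deriv ^^ k) f s) (at s)" for s
  proof (cases k)
    case 0
    then show ?thesis
      using schwartz_has_deriv_funpow[OF assms, of 0 s] by (auto intro!: derivative_eq_intros)
  next
    case (Suc m)
    show ?thesis
      using schwartz_has_deriv_funpow[OF assms, of k s] schwartz_has_deriv_funpow[OF assms, of m s]
      unfolding Suc by (auto intro!: derivative_eq_intros simp: algebra_simps)
  qed
  from deriv_eqI[OF this] Suc show ?case by simp
qed

lemma bounded_range_lincomb: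
  fixes f g :: "'a \<Rightarrow> real"
  assumes "bounded (range f)" "bounded (range g)"
  shows "bounded (range (\<lambda>s. a * f s + b * g s))"
proof -
  obtain K L where "\<And>s. \<bar>f s\<bar> \<le> K" "\<And>s. \<bar>g s\<bar> \<le> L"
    using assms unfolding bounded_iff by auto
  then have "norm (a * f s + b * g s) \<le> \<bar>a\<bar> * K + \<bar>b\<bar> * L" for s
    unfolding real_norm_def
    by (intro order_trans[OF abs_triangle_ineq] add_mono) (auto simp: abs_mult intro: mult_left_mono)
  then show ?thesis unfolding bounded_iff by blast
qed

lemma schwartz_mult_id:
  assumes "schwartz f"
  shows "schwartz (\<lambda>s. s * f s)"
  unfolding schwartz_def
proof (intro conjI allI)
  have "((deriv ^^ k) (\<lambda>s. s * f s) has_real_derivative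
      s * (deriv ^^ Suc k) f s + (deriv ^^ k) f s + real k * (deriv ^^ Suc (k - 1)) f s) (at s)" for k s
    unfolding funpow_deriv_mult_id[OF assms]
    using schwartz_has_deriv_funpow[OF assms, of k s]
      schwartz_has_deriv_funpow[OF assms, of "k - 1" s]
    by (auto intro!: derivative_eq_intros)
  then show "smooth (\<lambda>s. s * f s)"
    unfolding smooth_def using real_differentiable_def by blast
next
  fix j k
  have "bounded (range (\<lambda>s. 1 * (s ^ Suc j * (deriv ^^ k) f s)
      + real k * (s ^ j * (deriv ^^ (k - 1)) f s)))"
    using assms unfolding schwartz_def by (intro bounded_range_lincomb) blast+
  then show "bounded (range (\<lambda>s. s ^ j * (deriv ^^ k) (\<lambda>s. s * f s) s))"
    unfolding funpow_deriv_mult_id[OF assms] by (simp add: algebra_simps)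
qed

lemma lincomb_has_deriv:
  assumes "schwartz f" "schwartz g"
  shows "((\<lambda>s. a * f s + b * g s) has_real_derivative a * deriv f s + b * deriv g s) (at s)"
  using schwartz_has_deriv[OF assms(1), of s] schwartz_has_deriv[OF assms(2), of s]
  by (auto intro!: derivative_eq_intros)

lemma bounded_range_schwartz: "schwartz f \<Longrightarrow> bounded (range f)"
  unfolding schwartz_def by (drule conjunct2, drule spec[of _ 0], drule spec[of _ 0]) simp

lemma schwartz_lincomb:
  assumes "schwartz f" "schwartz g"
  shows "schwartz (\<lambda>s. a * f s + b * g s)"
\<comment> \<open>All combinations with the given coefficients are taken at once: differentiation
  and multiplication by s change \<open>f\<close> and \<open>g\<close> but keep \<open>a\<close> and
  \<open>b\<close>.\<close>
proof (rule schwartz_coinduct[where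
      X = "{h. \<exists>f g. schwartz f \<and> schwartz g \<and> h = (\<lambda>s. a * f s + b * g s)}"], goal_cases)
  case 1
  show ?case using assms by blast
next
  case (2 h)
  then obtain f g where fg: "schwartz f" "schwartz g" "h = (\<lambda>s. a * f s + b * g s)" by blast
  show ?case
    unfolding fg(3)
    by (rule bexI[where x = "\<lambda>s. a * deriv f s + b * deriv g s"])
      (use lincomb_has_deriv[OF fg(1,2)] schwartz_deriv[OF fg(1)] schwartz_deriv[OF fg(2)] in blast)+
next
  case (3 h)
  then obtain f g where "schwartz f" "schwartz g" "h = (\<lambda>s. a * f s + b * g s)" by blast
  then have "schwartz (\<lambda>s. s * f s)" "schwartz (\<lambda>s. s * g s)"
    "(\<lambda>s. s * h s) = (\<lambda>s. a * (s * f s) + b * (s * g s))"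
    by (auto simp: schwartz_mult_id algebra_simps)
  then show ?case by blast
next
  case (4 h)
  then obtain f g where fg: "schwartz f" "schwartz g" "h = (\<lambda>s. a * f s + b * g s)" by blast
  show ?case
    unfolding fg(3) by (intro bounded_range_lincomb bounded_range_schwartz fg)
qed

lemma deriv_lincomb:
  assumes "schwartz f" "schwartz g"
  shows "deriv (\<lambda>s. a * f s + b * g s) = (\<lambda>s. a * deriv f s + b * deriv g s)"
  using lincomb_has_deriv[OF assms] by (rule deriv_eqI)

lemma schwartz_funpow_deriv: "schwartz f \<Longrightarrow> schwartz ((deriv ^^ k) f)"
  by (induction k) (auto simp: schwartz_deriv)

lemma funpow_deriv_lincomb:
  assumes "schwartz f" "schwartz g"
  shows "(deriv ^^ k) (\<lambda>s. a * f s + b * g s) = (\<lambda>s. a * (deriv ^^ k) f s + b * (deriv ^^ k) g s)"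
  by (induction k) (simp_all add: deriv_lincomb schwartz_funpow_deriv assms)

lemma schwartz_scale: "schwartz f \<Longrightarrow> schwartz (\<lambda>s. c * f s)"
  using schwartz_lincomb[of f f c 0] by simp

lemma schwartz_diff: "schwartz f \<Longrightarrow> schwartz g \<Longrightarrow> schwartz (\<lambda>s. f s - g s)"
  using schwartz_lincomb[of f g 1 "-1"] by simp

lemma schwartz_zero: "schwartz (\<lambda>s. 0)"
  by (rule schwartz_coinduct[where X = "{\<lambda>s. 0}"]) auto

lemma schwartz_sum:
  fixes f :: "nat \<Rightarrow> real \<Rightarrow> real"
  assumes "\<And>i. schwartz (f i)"
  shows "schwartz (\<lambda>s. \<Sum>i<n. f i s)"
proof (induction n)
  case 0
  then show ?case by (simp add: schwartz_zero)
next
  case (Suc n)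
  then show ?case using schwartz_lincomb[OF Suc assms, of 1 1] by simp
qed

lemma schwartz_isCont: "schwartz f \<Longrightarrow> isCont f s"
  using schwartz_has_deriv by (rule DERIV_isCont)

lemma schwartz_measurable:
  "schwartz f \<Longrightarrow> f \<in> borel_measurable borel"
  by (intro borel_measurable_continuous_onI continuous_at_imp_continuous_on) (simp add: schwartz_isCont)


section \<open>Integrals of rapidly decreasing functions\<close>

lemma integrable_one_over_one_plus_square: "integrable lborel (\<lambda>x::real. 1 / (1 + x\<^sup>2))"
  using integrable_inverse_1_plus_square by (simp add: set_integrable_def einterval_def divide_inverse)

text \<open>The weights of order 0 and 2 add up to 1 + s^2, whose reciprocal is the integrable
  majorant for the estimates to come.\<close>

lemma schwartz_decay:
  assumes "schwartz f"
  obtains K where "K \<ge> 0" "\<And>s. \<bar>f s\<bar> \<le> K / (1 + s\<^sup>2)"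
proof -
  obtain K0 where K0: "K0 \<ge> 0" "\<And>s. \<bar>s ^ 0 * (deriv ^^ 0) f s\<bar> \<le> K0"
    using schwartz_bound[OF assms] by blast
  obtain K2 where K2: "K2 \<ge> 0" "\<And>s. \<bar>s ^ 2 * (deriv ^^ 0) f s\<bar> \<le> K2"
    using schwartz_bound[OF assms] by blast
  have "\<bar>f s\<bar> \<le> (K0 + K2) / (1 + s\<^sup>2)" for s
  proof -
    have "\<bar>f s\<bar> * (1 + s\<^sup>2) \<le> K0 + K2"
      using K0(2)[of s] K2(2)[of s] by (simp add: abs_mult algebra_simps)
    moreover have "1 + s\<^sup>2 > 0" by (simp add: add_pos_nonneg)
    ultimately show ?thesis by (simp add: pos_le_divide_eq)
  qed
  then show ?thesis using that[of "K0 + K2"] K0(1) K2(1) by simp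
qed

lemma integrable_lorentz_bound:
  fixes f :: "real \<Rightarrow> real"
  assumes "f \<in> borel_measurable borel" "\<And>s. \<bar>f s\<bar> \<le> K / (1 + s\<^sup>2)"
  shows "integrable lborel f"
proof (rule Bochner_Integration.integrable_bound)
  show "integrable lborel (\<lambda>s::real. K * (1 / (1 + s\<^sup>2)))"
    using integrable_one_over_one_plus_square by (rule integrable_mult_right)
  show "AE s in lborel. norm (f s) \<le> norm (K * (1 / (1 + s\<^sup>2)))"
    using order_trans[OF assms(2) abs_ge_self] by (intro AE_I2) simp
qed (use assms in simp)

lemma schwartz_integrable:
  assumes "schwartz f"
  shows "integrable lborel f"
proof -
  obtain K where "\<And>s. \<bar>f s\<bar> \<le> K / (1 + s\<^sup>2)" using schwartz_decay[OF assms] by blast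
  then show ?thesis using assms by (intro integrable_lorentz_bound schwartz_measurable)
qed

lemma integrable_times_bounded:
  fixes f g :: "'a \<Rightarrow> real"
  assumes "integrable M f" "g \<in> borel_measurable M" "\<And>s. \<bar>g s\<bar> \<le> K"
  shows "integrable M (\<lambda>s. f s * g s)"
proof (rule Bochner_Integration.integrable_bound)
  show "integrable M (\<lambda>s. K * f s)" using assms(1) by simp
  show "AE s in M. norm (f s * g s) \<le> norm (K * f s)"
    using assms(3) by (auto intro!: AE_I2 mult_left_mono intro: order_trans abs_ge_self
        simp: abs_mult mult.commute[of "\<bar>K\<bar>"])
qed (use assms in measurable)

lemma schwartz_integrable_times_bounded:
  fixes g :: "real \<Rightarrow> real"
  assumes "schwartz f" "g \<in> borel_measurable borel" "\<And>s. \<bar>g s\<bar> \<le> K"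
  shows "integrable lborel (\<lambda>s. f s * g s)"
  using assms by (intro integrable_times_bounded schwartz_integrable) auto

lemma schwartz_bounded:
  assumes "schwartz f"
  obtains K where "K \<ge> 0" "\<And>s. \<bar>f s\<bar> \<le> K"
  using schwartz_bound[OF assms, of 0 0] by auto

lemma schwartz_integrable_mult:
  assumes "schwartz f" "schwartz g"
  shows "integrable lborel (\<lambda>s. f s * g s)"
proof -
  obtain K where "\<And>s. \<bar>g s\<bar> \<le> K" using schwartz_bounded[OF assms(2)] by blast
  then show ?thesis using assms by (intro schwartz_integrable_times_bounded schwartz_measurable)
qed

text \<open>Dominated convergence for difference quotients; the mean value inequality transfers the
  bound on \<open>f'\<close> to them. The bound is asked only near \<open>t0\<close>, since the
  decay of the flow will be uniform for bounded times only.\<close>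

lemma has_real_derivative_integral:
  fixes f f' :: "real \<Rightarrow> 'a \<Rightarrow> real"
  assumes int: "\<And>t. integrable M (f t)"
    and deriv: "\<And>t x. ((\<lambda>t. f t x) has_real_derivative f' t x) (at t)"
    and bound: "\<And>t x. \<bar>t - t0\<bar> < e \<Longrightarrow> \<bar>f' t x\<bar> \<le> g x"
    and "e > 0" and g: "integrable M g"
  shows "((\<lambda>t. integral\<^sup>L M (f t)) has_real_derivative integral\<^sup>L M (f' t0)) (at t0)"
proof -
  have meas: "(\<lambda>x. (f t x - f t0 x) / (t - t0)) \<in> borel_measurable M" for t
    using int[of t] int[of t0] by measurable
  have quot: "\<bar>(f t x - f t0 x) / (t - t0)\<bar> \<le> g x" if "\<bar>t - t0\<bar> < e" "t \<noteq> t0" for t x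
  proof -
    have "norm (f t x - f t0 x) \<le> g x * norm (t - t0)"
    proof (rule field_differentiable_bound[of "ball t0 e"])
      show "convex (ball t0 e)" by simp
      show "t \<in> ball t0 e" "t0 \<in> ball t0 e"
        using that \<open>e > 0\<close> by (auto simp: dist_real_def)
      show "((\<lambda>t. f t x) has_field_derivative f' z x) (at z within ball t0 e)" for z
        using deriv by (rule has_field_derivative_at_within)
      show "norm (f' z x) \<le> g x" if "z \<in> ball t0 e" for z
        using bound that by (auto simp: dist_real_def abs_minus_commute)
    qed
    then show ?thesis using that by (simp add: abs_divide pos_divide_le_eq)
  qed
  have lim: "((\<lambda>t. (f t x - f t0 x) / (t - t0)) \<longlongrightarrow> f' t0 x) (at t0)" for x
    using deriv[of x t0] by (simp add: has_field_derivative_iff)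
  have "((\<lambda>t. (integral\<^sup>L M (f t) - integral\<^sup>L M (f t0)) / (t - t0)) \<longlongrightarrow> integral\<^sup>L M (f' t0)) (at t0)"
    unfolding tendsto_at_iff_sequentially comp_def
  proof (intro allI impI)
    fix X :: "nat \<Rightarrow> real"
    assume X: "\<forall>i. X i \<in> UNIV - {t0}" "X \<longlonglongrightarrow> t0"
    \<comment> \<open>The quotients are dominated only within distance \<open>e\<close> of
      \<open>t0\<close>, so an initial segment of the sequence is dropped.\<close>
    from X(2) \<open>e > 0\<close> obtain N where N: "\<And>n. n \<ge> N \<Longrightarrow> \<bar>X n - t0\<bar> < e"
      by (auto simp: LIMSEQ_def dist_real_def)
    have limX: "(\<lambda>n. (f (X (n + N)) x - f t0 x) / (X (n + N) - t0)) \<longlonglongrightarrow> f' t0 x" for x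
      using LIMSEQ_ignore_initial_segment[OF X(2), of N] X(1)
      by (intro filterlim_compose[OF lim]) (simp add: filterlim_at)
    have "(\<lambda>n. integral\<^sup>L M (\<lambda>x. (f (X (n + N)) x - f t0 x) / (X (n + N) - t0)))
        \<longlonglongrightarrow> integral\<^sup>L M (f' t0)"
    proof (rule integral_dominated_convergence[where w = g])
      show "f' t0 \<in> borel_measurable M"
        using meas limX by (rule borel_measurable_LIMSEQ_real[rotated])
      show "AE x in M. (\<lambda>n. (f (X (n + N)) x - f t0 x) / (X (n + N) - t0)) \<longlonglongrightarrow> f' t0 x"
        using limX by simp
      show "AE x in M. norm ((f (X (n + N)) x - f t0 x) / (X (n + N) - t0)) \<le> g x" for n
        using quot N[of "n + N"] X(1) by simp
    qed (use g meas in auto)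
    then have "(\<lambda>n. (integral\<^sup>L M (f (X (n + N))) - integral\<^sup>L M (f t0)) / (X (n + N) - t0))
        \<longlonglongrightarrow> integral\<^sup>L M (f' t0)"
      using int by simp
    then show "(\<lambda>n. (integral\<^sup>L M (f (X n)) - integral\<^sup>L M (f t0)) / (X n - t0))
        \<longlonglongrightarrow> integral\<^sup>L M (f' t0)"
      by (rule LIMSEQ_offset)
  qed
  then show ?thesis by (simp add: has_field_derivative_iff)
qed

lemma tendsto_lorentz_zero:
  fixes F :: "real \<Rightarrow> real"
  assumes "\<And>x. \<bar>F x\<bar> \<le> K / (1 + x\<^sup>2)"
  shows "(F \<longlongrightarrow> 0) at_top" "(F \<longlongrightarrow> 0) at_bot"
proof -
  have lim: "((\<lambda>x::real. K / (1 + x\<^sup>2)) \<longlongrightarrow> 0) at_top" "((\<lambda>x::real. K / (1 + x\<^sup>2)) \<longlongrightarrow> 0) at_bot"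
    by real_asymp+
  show "(F \<longlongrightarrow> 0) at_top"
    by (rule Lim_null_comparison[OF _ lim(1)]) (simp add: assms)
  show "(F \<longlongrightarrow> 0) at_bot"
    by (rule Lim_null_comparison[OF _ lim(2)]) (simp add: assms)
qed

section \<open>Integration by parts on the whole line\<close>

lemma integral_derivative_eq_0:
  fixes F f :: "real \<Rightarrow> real"
  assumes deriv: "\<And>x. (F has_real_derivative f x) (at x)"
    and cont: "\<And>x. isCont f x" and int: "integrable lborel f"
    and bound: "\<And>x. \<bar>F x\<bar> \<le> K / (1 + x\<^sup>2)"
  shows "(LINT x|lborel. f x) = 0"
proof -
  have "(LBINT x=-\<infinity>..\<infinity>. f x) = 0 - 0"
  proof (rule interval_integral_FTC_integrable)
    show "(F has_vector_derivative f x) (at x)" for x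
      using deriv by (simp add: has_real_derivative_iff_has_vector_derivative)
    show "set_integrable lborel (einterval (-\<infinity>) \<infinity>) f"
      using int by (simp add: set_integrable_def einterval_def)
    show "((F \<circ> real_of_ereal) \<longlongrightarrow> 0) (at_right (-\<infinity>))"
      "((F \<circ> real_of_ereal) \<longlongrightarrow> 0) (at_left \<infinity>)"
      using tendsto_lorentz_zero[OF bound] by (auto simp: ereal_tendsto_simps)
  qed (use cont in auto)
  then show ?thesis
    by (simp add: interval_lebesgue_integral_def set_lebesgue_integral_def einterval_def)
qed

lemma lorentz_bound_mult:
  fixes f g :: "real \<Rightarrow> real"
  assumes "\<And>s. \<bar>f s\<bar> \<le> K / (1 + s\<^sup>2)" "\<And>s. \<bar>g s\<bar> \<le> L"
  shows "\<bar>f s * g s\<bar> \<le> (K * L) / (1 + s\<^sup>2)"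
  using mult_mono[OF assms(1)[of s] assms(2)[of s]] order_trans[OF abs_ge_zero assms(1)[of s]]
  by (simp add: abs_mult mult.commute)

lemma schwartz_integral_by_parts:
  assumes "schwartz u" "schwartz v"
  shows "(LINT s|lborel. deriv u s * v s) = - (LINT s|lborel. u s * deriv v s)"
proof -
  note int = schwartz_integrable_mult[OF schwartz_deriv[OF assms(1)] assms(2)]
    schwartz_integrable_mult[OF assms(1) schwartz_deriv[OF assms(2)]]
  obtain K where K: "\<And>s. \<bar>u s\<bar> \<le> K / (1 + s\<^sup>2)" using schwartz_decay[OF assms(1)] by blast
  obtain L where L: "\<And>s. \<bar>v s\<bar> \<le> L" using schwartz_bounded[OF assms(2)] by blast
  have "(LINT s|lborel. deriv u s * v s + u s * deriv v s) = 0"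
  proof (rule integral_derivative_eq_0)
    show "((\<lambda>s. u s * v s) has_real_derivative deriv u s * v s + u s * deriv v s) (at s)" for s
      using schwartz_has_deriv[OF assms(1), of s] schwartz_has_deriv[OF assms(2), of s]
      by (auto intro!: derivative_eq_intros)
    show "isCont (\<lambda>s. deriv u s * v s + u s * deriv v s) s" for s
      using assms by (intro continuous_intros schwartz_isCont schwartz_deriv)
    show "\<bar>u s * v s\<bar> \<le> (K * L) / (1 + s\<^sup>2)" for s
      using K L by (rule lorentz_bound_mult)
  qed (use int in simp)
  then show ?thesis using int by simp
qed


section \<open>Cosine and sine transforms\<close>

text \<open>The phase is affine in r with slope \<open>q\<close>. The slope q(x) = x differentiates
  the transforms in frequency and, with \<alpha> = t p, the flow in space; the slope q = p
  differentiates the flow in time.\<close>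

lemma has_real_derivative_oscillatory_integral:
  fixes f g q \<alpha> :: "real \<Rightarrow> real"
  assumes int: "integrable lborel f" "integrable lborel g"
      "integrable lborel (\<lambda>x. q x * f x)" "integrable lborel (\<lambda>x. q x * g x)"
    and meas: "q \<in> borel_measurable borel" "\<alpha> \<in> borel_measurable borel"
  shows "((\<lambda>r. LINT x|lborel. f x * cos (\<alpha> x + r * q x) + g x * sin (\<alpha> x + r * q x))
    has_real_derivative
      (LINT x|lborel. q x * g x * cos (\<alpha> x + r * q x) - q x * f x * sin (\<alpha> x + r * q x))) (at r)"
proof (rule has_real_derivative_integral[where e = 1
      and g = "\<lambda>x. \<bar>q x * g x\<bar> + \<bar>q x * f x\<bar>"])
  show "integrable lborel (\<lambda>x. f x * cos (\<alpha> x + t * q x) + g x * sin (\<alpha> x + t * q x))" for t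
    using meas by (intro Bochner_Integration.integrable_add integrable_times_bounded[where K = 1] int) auto
  show "((\<lambda>t. f x * cos (\<alpha> x + t * q x) + g x * sin (\<alpha> x + t * q x)) has_real_derivative
      q x * g x * cos (\<alpha> x + t * q x) - q x * f x * sin (\<alpha> x + t * q x)) (at t)" for t x
    by (auto intro!: derivative_eq_intros simp: algebra_simps)
  show "\<bar>q x * g x * cos (\<alpha> x + t * q x) - q x * f x * sin (\<alpha> x + t * q x)\<bar>
      \<le> \<bar>q x * g x\<bar> + \<bar>q x * f x\<bar>" for t x
  proof -
    have le: "\<bar>u * cos z\<bar> \<le> \<bar>u\<bar>" "\<bar>u * sin z\<bar> \<le> \<bar>u\<bar>" for u z :: real
      by (simp_all add: abs_mult mult_left_le)
    show ?thesis
      by (rule order_trans[OF abs_triangle_ineq4]) (intro add_mono le)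
  qed
qed (use int in auto)

text \<open>The products of \<open>f\<close> with the sine and cosine of the phase have derivatives
  of integral zero. A linear phase yields the transform of a derivative; the phase of the flow
  yields the rule for the weight s. The hypothesis on \<theta>' f absorbs the growth of \<theta>',
  which is quadratic for the flow.\<close>

lemma oscillatory_integral_by_parts:
  fixes \<theta> \<theta>' :: "real \<Rightarrow> real"
  assumes f: "schwartz f" and f\<theta>: "schwartz (\<lambda>x. \<theta>' x * f x)"
    and deriv: "\<And>x. (\<theta> has_real_derivative \<theta>' x) (at x)"
  shows "(LINT x|lborel. \<theta>' x * f x * cos (\<theta> x)) = - (LINT x|lborel. deriv f x * sin (\<theta> x))"
    and "(LINT x|lborel. \<theta>' x * f x * sin (\<theta> x)) = (LINT x|lborel. deriv f x * cos (\<theta> x))"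
proof -
  have cont: "isCont \<theta> x" for x using deriv by (rule DERIV_isCont)
  have meas: "\<theta> \<in> borel_measurable borel"
    by (intro borel_measurable_continuous_onI continuous_at_imp_continuous_on) (simp add: cont)
  have int: "integrable lborel (\<lambda>x. h x * cos (\<theta> x))" "integrable lborel (\<lambda>x. h x * sin (\<theta> x))"
    if "schwartz h" for h
    using meas by (auto intro!: schwartz_integrable_times_bounded[OF that, where K = 1])
  obtain K where K: "\<And>s. \<bar>f s\<bar> \<le> K / (1 + s\<^sup>2)" using schwartz_decay[OF f] by blast
  have bound: "\<bar>f x * g x\<bar> \<le> (K * 1) / (1 + x\<^sup>2)" if "\<And>x. \<bar>g x\<bar> \<le> 1" for g x
    using K that by (rule lorentz_bound_mult)
  have "(LINT x|lborel. deriv f x * sin (\<theta> x) + \<theta>' x * f x * cos (\<theta> x)) = 0"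
  proof (rule integral_derivative_eq_0)
    show "((\<lambda>x. f x * sin (\<theta> x)) has_real_derivative
        deriv f x * sin (\<theta> x) + \<theta>' x * f x * cos (\<theta> x)) (at x)" for x
      using schwartz_has_deriv[OF f, of x] deriv[of x] by (auto intro!: derivative_eq_intros)
    show "isCont (\<lambda>x. deriv f x * sin (\<theta> x) + \<theta>' x * f x * cos (\<theta> x)) x" for x
      by (intro continuous_intros cont schwartz_isCont schwartz_deriv f f\<theta>)
    show "\<bar>f x * sin (\<theta> x)\<bar> \<le> (K * 1) / (1 + x\<^sup>2)" for x by (intro bound) simp
    show "integrable lborel (\<lambda>x. deriv f x * sin (\<theta> x) + \<theta>' x * f x * cos (\<theta> x))"
      by (intro Bochner_Integration.integrable_add int schwartz_deriv f f\<theta>)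
  qed
  then show "(LINT x|lborel. \<theta>' x * f x * cos (\<theta> x)) = - (LINT x|lborel. deriv f x * sin (\<theta> x))"
    using int[OF f\<theta>] int[OF schwartz_deriv[OF f]] by simp
  have "(LINT x|lborel. deriv f x * cos (\<theta> x) - \<theta>' x * f x * sin (\<theta> x)) = 0"
  proof (rule integral_derivative_eq_0)
    show "((\<lambda>x. f x * cos (\<theta> x)) has_real_derivative
        deriv f x * cos (\<theta> x) - \<theta>' x * f x * sin (\<theta> x)) (at x)" for x
      using schwartz_has_deriv[OF f, of x] deriv[of x] by (auto intro!: derivative_eq_intros)
    show "isCont (\<lambda>x. deriv f x * cos (\<theta> x) - \<theta>' x * f x * sin (\<theta> x)) x" for x
      by (intro continuous_intros cont schwartz_isCont schwartz_deriv f f\<theta>)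
    show "\<bar>f x * cos (\<theta> x)\<bar> \<le> (K * 1) / (1 + x\<^sup>2)" for x by (intro bound) simp
    show "integrable lborel (\<lambda>x. deriv f x * cos (\<theta> x) - \<theta>' x * f x * sin (\<theta> x))"
      by (intro Bochner_Integration.integrable_diff int schwartz_deriv f f\<theta>)
  qed
  then show "(LINT x|lborel. \<theta>' x * f x * sin (\<theta> x)) = (LINT x|lborel. deriv f x * cos (\<theta> x))"
    using int[OF f\<theta>] int[OF schwartz_deriv[OF f]] by simp
qed

definition cos_transform :: "(real \<Rightarrow> real) \<Rightarrow> real \<Rightarrow> real" where
  "cos_transform f \<xi> = (LINT y|lborel. f y * cos (y * \<xi>))"

definition sin_transform :: "(real \<Rightarrow> real) \<Rightarrow> real \<Rightarrow> real" where
  "sin_transform f \<xi> = (LINT y|lborel. f y * sin (y * \<xi>))"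

lemma schwartz_integrable_trig:
  assumes "schwartz f"
  shows "integrable lborel (\<lambda>y. f y * cos (y * \<xi>))" "integrable lborel (\<lambda>y. f y * sin (y * \<xi>))"
  by (auto intro!: schwartz_integrable_times_bounded[OF assms, where K = 1])

lemma transform_lincomb:
  assumes "schwartz f" "schwartz g"
  shows "cos_transform (\<lambda>s. a * f s + b * g s) \<xi> = a * cos_transform f \<xi> + b * cos_transform g \<xi>"
    and "sin_transform (\<lambda>s. a * f s + b * g s) \<xi> = a * sin_transform f \<xi> + b * sin_transform g \<xi>"
  unfolding cos_transform_def sin_transform_def
  using schwartz_integrable_trig[OF assms(1), of \<xi>] schwartz_integrable_trig[OF assms(2), of \<xi>]
  by (simp_all add: distrib_right mult.assoc)

lemma transform_deriv:
  assumes "schwartz f"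
  shows "cos_transform (deriv f) \<xi> = \<xi> * sin_transform f \<xi>"
    and "sin_transform (deriv f) \<xi> = - \<xi> * cos_transform f \<xi>"
proof -
  have "((\<lambda>y. y * \<xi>) has_real_derivative \<xi>) (at y)" for y
    by (auto intro!: derivative_eq_intros)
  note parts = oscillatory_integral_by_parts[OF assms schwartz_scale[OF assms, of \<xi>] this]
  show "cos_transform (deriv f) \<xi> = \<xi> * sin_transform f \<xi>"
    using parts(2) by (simp add: cos_transform_def sin_transform_def mult.assoc)
  show "sin_transform (deriv f) \<xi> = - \<xi> * cos_transform f \<xi>"
    using parts(1) by (simp add: cos_transform_def sin_transform_def mult.assoc)
qed

lemma transform_has_deriv:
  assumes "schwartz f"
  shows "(cos_transform f has_real_derivative - sin_transform (\<lambda>y. y * f y) \<xi>) (at \<xi>)"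
    and "(sin_transform f has_real_derivative cos_transform (\<lambda>y. y * f y) \<xi>) (at \<xi>)"
proof -
  note int = schwartz_integrable[OF assms] schwartz_integrable[OF schwartz_mult_id[OF assms]]
  show "(cos_transform f has_real_derivative - sin_transform (\<lambda>y. y * f y) \<xi>) (at \<xi>)"
    using has_real_derivative_oscillatory_integral[where f = f and g = "\<lambda>_. 0" and \<alpha> = "\<lambda>_. 0"
        and q = "\<lambda>y. y" and r = \<xi>] int
    by (simp add: cos_transform_def[abs_def] sin_transform_def mult.commute)
  show "(sin_transform f has_real_derivative cos_transform (\<lambda>y. y * f y) \<xi>) (at \<xi>)"
    using has_real_derivative_oscillatory_integral[where f = "\<lambda>_. 0" and g = f and \<alpha> = "\<lambda>_. 0"
        and q = "\<lambda>y. y" and r = \<xi>] int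
    by (simp add: cos_transform_def sin_transform_def[abs_def] mult.commute)
qed

lemma bounded_range_transform:
  assumes "schwartz f"
  shows "bounded (range (cos_transform f))" "bounded (range (sin_transform f))"
proof -
  have bound: "norm (LINT y|lborel. f y * g y) \<le> (LINT y|lborel. \<bar>f y\<bar>)"
    if "\<And>y. \<bar>g y\<bar> \<le> 1" "g \<in> borel_measurable borel" for g
  proof -
    have int: "integrable lborel (\<lambda>y. f y * g y)"
      using that by (intro schwartz_integrable_times_bounded[OF assms, where K = 1])
    have "norm (LINT y|lborel. f y * g y) \<le> (LINT y|lborel. norm (f y * g y))"
      by (rule integral_norm_bound)
    also have "\<dots> \<le> (LINT y|lborel. \<bar>f y\<bar>)"
      using that(1) int schwartz_integrable[OF assms]
      by (intro integral_mono integrable_norm) (auto simp: abs_mult intro: mult_left_le)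
    finally show ?thesis .
  qed
  have "norm (cos_transform f \<xi>) \<le> (LINT y|lborel. \<bar>f y\<bar>)"
    "norm (sin_transform f \<xi>) \<le> (LINT y|lborel. \<bar>f y\<bar>)" for \<xi>
    unfolding cos_transform_def sin_transform_def by (auto intro!: bound simp del: real_norm_def)
  then show "bounded (range (cos_transform f))" "bounded (range (sin_transform f))"
    unfolding bounded_iff by blast+
qed

text \<open>Differentiation in \<xi> and multiplication by \<xi> each exchange cosine and sine
  transforms up to sign. Hence the coinduction runs over both kinds together, with signs absorbed
  into the transformed function.\<close>

lemma schwartz_transform_aux:
  assumes "h \<in> {h. \<exists>f. schwartz f \<and> (h = cos_transform f \<or> h = sin_transform f)}" (is "h \<in> ?X")
  shows "schwartz h"
proof -
  have neg: "(\<lambda>\<xi>. - cos_transform f \<xi>) = cos_transform (\<lambda>s. - f s)"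
    "(\<lambda>\<xi>. - sin_transform f \<xi>) = sin_transform (\<lambda>s. - f s)" for f
    by (auto simp: cos_transform_def sin_transform_def)
  have sneg: "schwartz (\<lambda>s. - f s)" if "schwartz f" for f
    using schwartz_scale[OF that, of "-1"] by simp
  show ?thesis using assms
  proof (rule schwartz_coinduct, goal_cases)
    case (1 h)
    then obtain f where f: "schwartz f" and "h = cos_transform f \<or> h = sin_transform f" by blast
    from this(2) show ?case
    proof
      assume h: "h = cos_transform f"
      show ?case unfolding h
        by (rule bexI[where x = "\<lambda>\<xi>. - sin_transform (\<lambda>y. y * f y) \<xi>"])
          (use transform_has_deriv[OF f] sneg schwartz_mult_id[OF f] neg in blast)+
    next
      assume h: "h = sin_transform f"
      show ?case unfolding h
        by (rule bexI[where x = "cos_transform (\<lambda>y. y * f y)"])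
          (use transform_has_deriv[OF f] schwartz_mult_id[OF f] in blast)+
    qed
  next
    case (2 h)
    then obtain f where f: "schwartz f" and "h = cos_transform f \<or> h = sin_transform f" by blast
    from this(2) show ?case
    proof
      assume "h = cos_transform f"
      then have "(\<lambda>s. s * h s) = sin_transform (\<lambda>s. - deriv f s)"
        using transform_deriv[OF f] by (simp add: neg(2)[symmetric] fun_eq_iff)
      then show ?case using sneg[OF schwartz_deriv[OF f]] by blast
    next
      assume "h = sin_transform f"
      then have "(\<lambda>s. s * h s) = cos_transform (deriv f)"
        using transform_deriv[OF f] by (simp add: fun_eq_iff)
      then show ?case using schwartz_deriv[OF f] by blast
    qed
  next
    case (3 h)
    then show ?case using bounded_range_transform by blast
  qed
qed

lemma schwartz_transform:
  assumes "schwartz f"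
  shows "schwartz (cos_transform f)" "schwartz (sin_transform f)"
  using assms by (auto intro!: schwartz_transform_aux)


section \<open>Gaussian summation and Fourier inversion\<close>

text \<open>The real part of the characteristic function exp (-t^2/2) of the standard normal law,
  written so that the density reproduces itself.\<close>

lemma integral_std_normal_density_cos:
  "(LINT x|lborel. std_normal_density x * cos (t * x)) = sqrt (2 * pi) * std_normal_density t"
proof -
  interpret real_distribution std_normal_distribution by (rule real_dist_normal_dist)
  have "Re (char std_normal_distribution t) = (LINT x|std_normal_distribution. Re (iexp (t * x)))"
    unfolding char_def by (intro integral_Re[symmetric] integrable_iexp) auto
  also have "\<dots> = (LINT x|std_normal_distribution. cos (t * x))"
    by (simp add: Re_exp)
  also have "\<dots> = (LINT x|lborel. std_normal_density x * cos (t * x))"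
    by (subst integral_density) auto
  finally have "(LINT x|lborel. std_normal_density x * cos (t * x)) = exp (- (t\<^sup>2) / 2)"
    unfolding char_std_normal_distribution Re_complex_of_real by (rule sym)
  then show ?thesis by (simp only:) (simp add: std_normal_density_def)
qed

lemma integrable_std_normal_density: "integrable lborel std_normal_density"
  by simp

lemma integral_scaled_density_cos:
  assumes "\<epsilon> > 0"
  shows "(LINT \<xi>|lborel. std_normal_density (\<epsilon> * \<xi>) * cos (z * \<xi>))
    = sqrt (2 * pi) * (std_normal_density (z / \<epsilon>) / \<epsilon>)"
proof -
  have "(LINT \<xi>|lborel. std_normal_density (\<epsilon> * \<xi>) * cos (z * \<xi>))
      = \<bar>1 / \<epsilon>\<bar> * (LINT x|lborel. std_normal_density (\<epsilon> * (0 + 1 / \<epsilon> * x)) * cos (z * (0 + 1 / \<epsilon> * x)))"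
    using assms lborel_integral_real_affine[of "1 / \<epsilon>" "\<lambda>\<xi>. std_normal_density (\<epsilon> * \<xi>) * cos (z * \<xi>)" 0]
    by simp
  also have "\<dots> = 1 / \<epsilon> * (LINT x|lborel. std_normal_density x * cos (z / \<epsilon> * x))"
    using assms by simp
  finally show ?thesis
    unfolding integral_std_normal_density_cos by simp
qed

text \<open>The substitution y = s - \<epsilon> u fixes the Gaussian weight, so only the argument of
  \<open>f\<close> moves and boundedness of \<open>f\<close> gives the majorant.\<close>

lemma tendsto_gaussian_average:
  assumes "schwartz f" and \<epsilon>: "\<And>n. \<epsilon> n > 0" "\<epsilon> \<longlonglongrightarrow> 0"
  shows "(\<lambda>n. LINT y|lborel. f y * (std_normal_density ((s - y) / \<epsilon> n) / \<epsilon> n)) \<longlonglongrightarrow> f s"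
proof -
  have eq: "(LINT y|lborel. f y * (std_normal_density ((s - y) / \<epsilon> n) / \<epsilon> n))
      = (LINT u|lborel. f (s - \<epsilon> n * u) * std_normal_density u)" for n
    using \<epsilon>(1)[of n] lborel_integral_real_affine[of "- \<epsilon> n"
        "\<lambda>y. f y * (std_normal_density ((s - y) / \<epsilon> n) / \<epsilon> n)" s]
    by simp
  obtain K where K: "\<And>x. \<bar>f x\<bar> \<le> K" using schwartz_bounded[OF assms(1)] by blast
  have [measurable]: "f \<in> borel_measurable borel" using assms(1) by (rule schwartz_measurable)
  have "(\<lambda>n. LINT u|lborel. f (s - \<epsilon> n * u) * std_normal_density u)
      \<longlonglongrightarrow> (LINT u|lborel. f s * std_normal_density u)"
  proof (rule integral_dominated_convergence[where w = "\<lambda>u. K * std_normal_density u"])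
    show "AE u in lborel. (\<lambda>n. f (s - \<epsilon> n * u) * std_normal_density u) \<longlonglongrightarrow> f s * std_normal_density u"
    proof (intro AE_I2 tendsto_mult tendsto_const)
      fix u
      have "(\<lambda>n. s - \<epsilon> n * u) \<longlonglongrightarrow> s - 0 * u" by (intro tendsto_intros \<epsilon>)
      then show "(\<lambda>n. f (s - \<epsilon> n * u)) \<longlonglongrightarrow> f s"
        using isCont_tendsto_compose[OF schwartz_isCont[OF assms(1)]] by simp
    qed
    show "AE u in lborel. norm (f (s - \<epsilon> n * u) * std_normal_density u) \<le> K * std_normal_density u" for n
      using K by (auto simp: abs_mult intro!: mult_right_mono)
  qed (use integrable_std_normal_density in \<open>auto simp del: integrable_normal_density\<close>)
  then show ?thesis unfolding eq by simp
qed

text \<open>A Gaussian cutoff at frequency scale 1/\<epsilon> turns the inverse integral into an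
  average of \<open>f\<close> at scale \<epsilon>. The constant 2 pi is a product of two factors
  sqrt (2 pi): one from the density at 0, one from the transform of the Gaussian.\<close>

lemma fourier_inversion:
  assumes "schwartz f"
  shows "(LINT \<xi>|lborel. cos_transform f \<xi> * cos (s * \<xi>) + sin_transform f \<xi> * sin (s * \<xi>)) = 2 * pi * f s"
    (is "integral\<^sup>L lborel ?h = _")
proof -
  define \<epsilon> where "\<epsilon> n = 1 / real (Suc n)" for n
  have \<epsilon>: "\<epsilon> n > 0" for n by (simp add: \<epsilon>_def)
  have \<epsilon>0: "\<epsilon> \<longlonglongrightarrow> 0" unfolding \<epsilon>_def by (rule lim_const_over_n[THEN LIMSEQ_Suc])
  have h: "integrable lborel ?h"
    by (intro Bochner_Integration.integrable_add schwartz_integrable_times_bounded[where K = 1]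
        schwartz_transform assms) auto
  have [measurable]: "f \<in> borel_measurable borel" using assms by (rule schwartz_measurable)
  have le: "std_normal_density x \<le> std_normal_density 0" for x
    by (simp add: std_normal_density_def divide_right_mono)
  have "(\<lambda>n. LINT \<xi>|lborel. ?h \<xi> * std_normal_density (\<epsilon> n * \<xi>))
      \<longlonglongrightarrow> (LINT \<xi>|lborel. ?h \<xi> * std_normal_density 0)"
  proof (rule integral_dominated_convergence[where w = "\<lambda>\<xi>. \<bar>?h \<xi>\<bar> * std_normal_density 0"])
    show "AE \<xi> in lborel. (\<lambda>n. ?h \<xi> * std_normal_density (\<epsilon> n * \<xi>)) \<longlonglongrightarrow> ?h \<xi> * std_normal_density 0"
    proof (intro AE_I2 tendsto_mult tendsto_const)
      fix \<xi>
      have "(\<lambda>n. std_normal_density (\<epsilon> n * \<xi>)) \<longlonglongrightarrow> 1 / sqrt (2 * pi) * exp (- (0 * \<xi>)\<^sup>2 / 2)"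
        unfolding std_normal_density_def by (intro tendsto_intros \<epsilon>0) auto
      then show "(\<lambda>n. std_normal_density (\<epsilon> n * \<xi>)) \<longlonglongrightarrow> std_normal_density 0"
        by (simp add: std_normal_density_def)
    qed
    show "AE \<xi> in lborel. norm (?h \<xi> * std_normal_density (\<epsilon> n * \<xi>)) \<le> \<bar>?h \<xi>\<bar> * std_normal_density 0" for n
      using le by (auto simp: abs_mult intro!: mult_left_mono)
  qed (use h in auto)
  then have lim1: "(\<lambda>n. LINT \<xi>|lborel. ?h \<xi> * std_normal_density (\<epsilon> n * \<xi>))
      \<longlonglongrightarrow> integral\<^sup>L lborel ?h / sqrt (2 * pi)"
    by (simp add: std_normal_density_def)
  have swap: "(LINT \<xi>|lborel. ?h \<xi> * std_normal_density (\<epsilon> n * \<xi>))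
      = sqrt (2 * pi) * (LINT y|lborel. f y * (std_normal_density ((s - y) / \<epsilon> n) / \<epsilon> n))" for n
  proof -
    \<comment> \<open>By the addition theorem the transforms combine with the outer cosine and sine
      into cos ((s - y) \<xi>). The cutoff makes this kernel integrable in both variables jointly,
      so that Fubini applies.\<close>
    let ?k = "\<lambda>y \<xi>. f y * (std_normal_density (\<epsilon> n * \<xi>) * cos ((s - y) * \<xi>))"
    have dens: "integrable lborel (\<lambda>\<xi>. std_normal_density (\<epsilon> n * \<xi>))"
      using \<epsilon>[of n] lborel_integrable_real_affine[OF integrable_std_normal_density, of "\<epsilon> n" 0] by simp
    have int2: "integrable lborel (?k y)" for y
      using dens by (intro integrable_mult_right integrable_times_bounded[where K = 1]) auto
    have "integrable (lborel \<Otimes>\<^sub>M lborel) (case_prod ?k)"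
    proof (rule lborel_pair.Fubini_integrable)
      show "integrable lborel (\<lambda>y. LINT \<xi>|lborel. norm (case_prod ?k (y, \<xi>)))"
      proof (rule Bochner_Integration.integrable_bound)
        show "integrable lborel (\<lambda>y. \<bar>f y\<bar> * (LINT \<xi>|lborel. std_normal_density (\<epsilon> n * \<xi>)))"
          using schwartz_integrable[OF assms] by simp
        show "AE y in lborel. norm (LINT \<xi>|lborel. norm (case_prod ?k (y, \<xi>)))
            \<le> norm (\<bar>f y\<bar> * (LINT \<xi>|lborel. std_normal_density (\<epsilon> n * \<xi>)))"
        proof (rule AE_I2)
          fix y
          have "(LINT \<xi>|lborel. norm (?k y \<xi>)) \<le> (LINT \<xi>|lborel. \<bar>f y\<bar> * std_normal_density (\<epsilon> n * \<xi>))"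
          proof (rule integral_mono)
            show "integrable lborel (\<lambda>\<xi>. norm (?k y \<xi>))" using int2 by (rule integrable_norm)
            show "integrable lborel (\<lambda>\<xi>. \<bar>f y\<bar> * std_normal_density (\<epsilon> n * \<xi>))" using dens by simp
            show "norm (?k y \<xi>) \<le> \<bar>f y\<bar> * std_normal_density (\<epsilon> n * \<xi>)" for \<xi>
              by (auto simp: abs_mult intro!: mult_left_mono mult_left_le)
          qed
          then show "norm (LINT \<xi>|lborel. norm (case_prod ?k (y, \<xi>)))
              \<le> norm (\<bar>f y\<bar> * (LINT \<xi>|lborel. std_normal_density (\<epsilon> n * \<xi>)))"
            by simp
        qed
      qed measurable
      show "AE y in lborel. integrable lborel (\<lambda>\<xi>. case_prod ?k (y, \<xi>))" using int2 by simp
    qed measurable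
    then have "(LINT \<xi>|lborel. LINT y|lborel. ?k y \<xi>) = (LINT y|lborel. LINT \<xi>|lborel. ?k y \<xi>)"
      by (rule lborel_pair.Fubini_integral)
    moreover have "(LINT y|lborel. ?k y \<xi>) = ?h \<xi> * std_normal_density (\<epsilon> n * \<xi>)" for \<xi>
    proof -
      have "?k y \<xi> = std_normal_density (\<epsilon> n * \<xi>) * (cos (s * \<xi>) * (f y * cos (y * \<xi>)))
          + std_normal_density (\<epsilon> n * \<xi>) * (sin (s * \<xi>) * (f y * sin (y * \<xi>)))" for y
        by (simp add: left_diff_distrib cos_diff algebra_simps)
      then have "(LINT y|lborel. ?k y \<xi>)
          = (LINT y|lborel. std_normal_density (\<epsilon> n * \<xi>) * (cos (s * \<xi>) * (f y * cos (y * \<xi>)))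
          + std_normal_density (\<epsilon> n * \<xi>) * (sin (s * \<xi>) * (f y * sin (y * \<xi>))))"
        by (intro Bochner_Integration.integral_cong refl)
      also have "\<dots> = std_normal_density (\<epsilon> n * \<xi>) * (cos (s * \<xi>) * cos_transform f \<xi>)
          + std_normal_density (\<epsilon> n * \<xi>) * (sin (s * \<xi>) * sin_transform f \<xi>)"
        using schwartz_integrable_trig[OF assms, of \<xi>]
        by (simp add: cos_transform_def sin_transform_def)
      finally show ?thesis by (simp add: algebra_simps)
    qed
    moreover have "(LINT \<xi>|lborel. ?k y \<xi>) = sqrt (2 * pi) * (f y * (std_normal_density ((s - y) / \<epsilon> n) / \<epsilon> n))" for y
      using integral_scaled_density_cos[OF \<epsilon>[of n], of "s - y"] by simp
    ultimately show ?thesis by simp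
  qed
  have "(\<lambda>n. LINT \<xi>|lborel. ?h \<xi> * std_normal_density (\<epsilon> n * \<xi>)) \<longlonglongrightarrow> sqrt (2 * pi) * f s"
    unfolding swap by (intro tendsto_mult tendsto_const tendsto_gaussian_average assms \<epsilon> \<epsilon>0)
  with lim1 have "integral\<^sup>L lborel ?h / sqrt (2 * pi) = sqrt (2 * pi) * f s"
    by (rule LIMSEQ_unique)
  then show ?thesis by (simp add: field_simps)
qed


section \<open>The Airy flow on Schwartz functions\<close>

definition airy_op :: "real \<Rightarrow> real \<Rightarrow> (real \<Rightarrow> real) \<Rightarrow> real \<Rightarrow> real" where
  "airy_op a b f s = a * (deriv ^^ 3) f s + b * deriv f s"

definition airy_symbol :: "real \<Rightarrow> real \<Rightarrow> real \<Rightarrow> real" where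
  "airy_symbol a b \<xi> = b * \<xi> - a * \<xi> ^ 3"

text \<open>
  The real form of \<open>(2\<pi>)\<^sup>-\<^sup>1 \<integral> exp (\<i> (s \<xi> + t p(\<xi>))) F(\<xi>) d\<xi>\<close> where \<open>F = C - \<i> S\<close> is the Fourier transform
  of \<open>f\<close>, \<open>C\<close> and \<open>S\<close> are its cosine and sine transforms, and \<open>\<i> p(\<xi>)\<close> is the symbol of \<open>a D\<^sup>3 + b D\<close>.
\<close>

definition airy_flow :: "real \<Rightarrow> real \<Rightarrow> real \<Rightarrow> (real \<Rightarrow> real) \<Rightarrow> real \<Rightarrow> real" where
  "airy_flow a b t f s =
    (LINT \<xi>|lborel. cos_transform f \<xi> * cos (s * \<xi> + t * airy_symbol a b \<xi>)
      + sin_transform f \<xi> * sin (s * \<xi> + t * airy_symbol a b \<xi>)) / (2 * pi)"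

lemma schwartz_airy_op: "schwartz f \<Longrightarrow> schwartz (airy_op a b f)"
  unfolding airy_op_def[abs_def] by (intro schwartz_lincomb schwartz_funpow_deriv schwartz_deriv)

text \<open>Both orders of differentiation are odd, so moving all derivatives across leaves one
  minus sign.\<close>

lemma airy_op_skew:
  assumes "schwartz u" "schwartz v"
  shows "(LINT s|lborel. airy_op a b u s * v s) = - (LINT s|lborel. u s * airy_op a b v s)"
proof -
  have s: "schwartz ((deriv ^^ k) u)" "schwartz ((deriv ^^ k) v)" for k
    using assms by (auto intro: schwartz_funpow_deriv)
  have step: "(LINT s|lborel. (deriv ^^ Suc j) u s * (deriv ^^ k) v s)
      = - (LINT s|lborel. (deriv ^^ j) u s * (deriv ^^ Suc k) v s)" for j k
    using schwartz_integral_by_parts[OF s(1)[of j] s(2)[of k]] by simp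
  have "(LINT s|lborel. (deriv ^^ 3) u s * v s) = - (LINT s|lborel. u s * (deriv ^^ 3) v s)"
    using step[of 2 0] step[of 1 1] step[of 0 2] by (simp add: numeral_2_eq_2 numeral_3_eq_3)
  moreover have "(LINT s|lborel. deriv u s * v s) = - (LINT s|lborel. u s * deriv v s)"
    using assms by (rule schwartz_integral_by_parts)
  moreover have "(LINT s|lborel. airy_op a b u s * v s)
      = a * (LINT s|lborel. (deriv ^^ 3) u s * v s) + b * (LINT s|lborel. deriv u s * v s)"
    using schwartz_integrable_mult[OF s(1)[of 3] assms(2)] schwartz_integrable_mult[OF s(1)[of 1] assms(2)]
    by (simp add: airy_op_def distrib_right mult.assoc)
  moreover have "(LINT s|lborel. u s * airy_op a b v s)
      = (LINT s|lborel. a * (u s * (deriv ^^ 3) v s) + b * (u s * deriv v s))"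
    by (simp add: airy_op_def algebra_simps)
  then have "(LINT s|lborel. u s * airy_op a b v s)
      = a * (LINT s|lborel. u s * (deriv ^^ 3) v s) + b * (LINT s|lborel. u s * deriv v s)"
    using schwartz_integrable_mult[OF assms(1) s(2)[of 3]] schwartz_integrable_mult[OF assms(1) s(2)[of 1]]
    by simp
  ultimately show ?thesis by simp
qed

lemma transform_airy_op:
  assumes "schwartz f"
  shows "cos_transform (airy_op a b f) \<xi> = airy_symbol a b \<xi> * sin_transform f \<xi>"
    and "sin_transform (airy_op a b f) \<xi> = - airy_symbol a b \<xi> * cos_transform f \<xi>"
proof -
  note s = schwartz_deriv[OF assms] schwartz_deriv[OF schwartz_deriv[OF assms]]
  have "schwartz ((deriv ^^ 3) f)" using assms by (rule schwartz_funpow_deriv)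
  then show "cos_transform (airy_op a b f) \<xi> = airy_symbol a b \<xi> * sin_transform f \<xi>"
    "sin_transform (airy_op a b f) \<xi> = - airy_symbol a b \<xi> * cos_transform f \<xi>"
    unfolding airy_op_def[abs_def] airy_symbol_def
    using s assms by (simp_all add: transform_lincomb transform_deriv numeral_3_eq_3 algebra_simps)
qed

text \<open>The operator b + 3 a D^2 has the symbol p'(\<xi>) and is the commutator of a D^3 + b D
  with multiplication by s. It arises when the phase of the flow is differentiated in \<xi>.\<close>

lemma transform_symbol_deriv:
  assumes "schwartz f"
  shows "cos_transform (\<lambda>s. b * f s + 3 * a * (deriv ^^ 2) f s) \<xi> = (b - 3 * a * \<xi>\<^sup>2) * cos_transform f \<xi>"
    and "sin_transform (\<lambda>s. b * f s + 3 * a * (deriv ^^ 2) f s) \<xi> = (b - 3 * a * \<xi>\<^sup>2) * sin_transform f \<xi>"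
  using assms schwartz_funpow_deriv[OF assms, of 2]
  by (simp_all add: transform_lincomb transform_deriv schwartz_deriv numeral_2_eq_2)
    (simp_all add: algebra_simps)

lemma airy_symbol_has_deriv:
  "(airy_symbol a b has_real_derivative b - 3 * a * \<xi>\<^sup>2) (at \<xi>)"
  unfolding airy_symbol_def[abs_def]
  by (auto intro!: derivative_eq_intros simp: power2_eq_square)

lemma airy_symbol_measurable [measurable]: "airy_symbol a b \<in> borel_measurable borel"
  unfolding airy_symbol_def[abs_def] by measurable

lemma airy_flow_integrable:
  assumes "schwartz f"
  shows "integrable lborel (\<lambda>\<xi>. cos_transform f \<xi> * cos (s * \<xi> + t * airy_symbol a b \<xi>))"
    and "integrable lborel (\<lambda>\<xi>. sin_transform f \<xi> * sin (s * \<xi> + t * airy_symbol a b \<xi>))"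
  using schwartz_transform[OF assms]
  by (auto intro!: schwartz_integrable_times_bounded[where K = 1])

lemma airy_flow_lincomb:
  assumes "schwartz f" "schwartz g"
  shows "airy_flow a b t (\<lambda>s. c * f s + d * g s) = (\<lambda>s. c * airy_flow a b t f s + d * airy_flow a b t g s)"
proof
  fix s
  let ?\<theta> = "\<lambda>\<xi>. s * \<xi> + t * airy_symbol a b \<xi>"
  have "(LINT \<xi>|lborel. cos_transform (\<lambda>s. c * f s + d * g s) \<xi> * cos (?\<theta> \<xi>)
      + sin_transform (\<lambda>s. c * f s + d * g s) \<xi> * sin (?\<theta> \<xi>))
    = (LINT \<xi>|lborel. c * (cos_transform f \<xi> * cos (?\<theta> \<xi>) + sin_transform f \<xi> * sin (?\<theta> \<xi>))
      + d * (cos_transform g \<xi> * cos (?\<theta> \<xi>) + sin_transform g \<xi> * sin (?\<theta> \<xi>)))"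
    by (simp add: transform_lincomb[OF assms] algebra_simps)
  also have "\<dots> = c * (LINT \<xi>|lborel. cos_transform f \<xi> * cos (?\<theta> \<xi>) + sin_transform f \<xi> * sin (?\<theta> \<xi>))
      + d * (LINT \<xi>|lborel. cos_transform g \<xi> * cos (?\<theta> \<xi>) + sin_transform g \<xi> * sin (?\<theta> \<xi>))"
    using airy_flow_integrable[OF assms(1)] airy_flow_integrable[OF assms(2)] by simp
  finally show "airy_flow a b t (\<lambda>s. c * f s + d * g s) s = c * airy_flow a b t f s + d * airy_flow a b t g s"
    by (simp add: airy_flow_def add_divide_distrib)
qed

lemma airy_flow_0: "schwartz f \<Longrightarrow> airy_flow a b 0 f = f"
  by (simp add: airy_flow_def[abs_def] fourier_inversion)

lemma airy_flow_has_deriv_space: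
  assumes "schwartz f"
  shows "(airy_flow a b t f has_real_derivative airy_flow a b t (deriv f) s) (at s)"
proof -
  have "((\<lambda>s. LINT \<xi>|lborel. cos_transform f \<xi> * cos (t * airy_symbol a b \<xi> + s * \<xi>)
      + sin_transform f \<xi> * sin (t * airy_symbol a b \<xi> + s * \<xi>)) has_real_derivative
      (LINT \<xi>|lborel. \<xi> * sin_transform f \<xi> * cos (t * airy_symbol a b \<xi> + s * \<xi>)
        - \<xi> * cos_transform f \<xi> * sin (t * airy_symbol a b \<xi> + s * \<xi>))) (at s)"
    using schwartz_transform[OF assms]
    by (intro has_real_derivative_oscillatory_integral schwartz_integrable schwartz_mult_id) auto
  from DERIV_cdivide[OF this, of "2 * pi"] show ?thesis
    by (simp add: airy_flow_def[abs_def] transform_deriv[OF assms] add.commute)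
qed

lemma airy_flow_has_deriv_time:
  assumes "schwartz f"
  shows "((\<lambda>t. airy_flow a b t f s) has_real_derivative airy_flow a b t (airy_op a b f) s) (at t)"
proof -
  \<comment> \<open>A transform multiplied by p is, up to sign, a transform of
    \<open>airy_op a b f\<close>; integrability of the products is read off from this.\<close>
  have "(\<lambda>\<xi>. airy_symbol a b \<xi> * sin_transform f \<xi>) = cos_transform (airy_op a b f)"
    "(\<lambda>\<xi>. airy_symbol a b \<xi> * cos_transform f \<xi>) = (\<lambda>\<xi>. (- 1) * sin_transform (airy_op a b f) \<xi>)"
    by (simp_all add: transform_airy_op[OF assms] fun_eq_iff)
  then have s: "schwartz (\<lambda>\<xi>. airy_symbol a b \<xi> * sin_transform f \<xi>)"
    and c: "schwartz (\<lambda>\<xi>. airy_symbol a b \<xi> * cos_transform f \<xi>)"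
    using schwartz_transform[OF schwartz_airy_op[OF assms, of a b]] schwartz_scale by metis+
  have "((\<lambda>t. LINT \<xi>|lborel. cos_transform f \<xi> * cos (s * \<xi> + t * airy_symbol a b \<xi>)
      + sin_transform f \<xi> * sin (s * \<xi> + t * airy_symbol a b \<xi>)) has_real_derivative
      (LINT \<xi>|lborel. airy_symbol a b \<xi> * sin_transform f \<xi> * cos (s * \<xi> + t * airy_symbol a b \<xi>)
        - airy_symbol a b \<xi> * cos_transform f \<xi> * sin (s * \<xi> + t * airy_symbol a b \<xi>))) (at t)"
    using schwartz_transform[OF assms] s c
    by (intro has_real_derivative_oscillatory_integral schwartz_integrable) auto
  from DERIV_cdivide[OF this, of "2 * pi"] show ?thesis
    by (simp add: airy_flow_def transform_airy_op[OF assms])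
qed

lemma schwartz_symbol_deriv_op:
  "schwartz f \<Longrightarrow> schwartz (\<lambda>s. b * f s + 3 * a * (deriv ^^ 2) f s)"
  by (intro schwartz_lincomb schwartz_funpow_deriv)

text \<open>The \<xi>-derivative of the phase is s + t p'(\<xi>). Integrating by parts in \<xi> puts
  that derivative on the transforms, which multiplies the transformed function by its variable; the
  part t p'(\<xi>) acts on f as t (b + 3 a D^2).\<close>

lemma airy_flow_mult_id:
  assumes "schwartz f"
  shows "s * airy_flow a b t f s =
    airy_flow a b t (\<lambda>s. s * f s) s - t * airy_flow a b t (\<lambda>s. b * f s + 3 * a * (deriv ^^ 2) f s) s"
proof -
  let ?\<theta> = "\<lambda>\<xi>. s * \<xi> + t * airy_symbol a b \<xi>"
  let ?\<theta>' = "\<lambda>\<xi>. s + t * (b - 3 * a * \<xi>\<^sup>2)"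
  let ?L = "\<lambda>s. b * f s + 3 * a * (deriv ^^ 2) f s"
  note L = schwartz_symbol_deriv_op[OF assms, of b a]
  have d: "(?\<theta> has_real_derivative ?\<theta>' \<xi>) (at \<xi>)" for \<xi>
    using airy_symbol_has_deriv[of a b \<xi>] by (auto intro!: derivative_eq_intros)
  have ex: "?\<theta>' \<xi> * cos_transform f \<xi> = s * cos_transform f \<xi> + t * cos_transform ?L \<xi>"
    "?\<theta>' \<xi> * sin_transform f \<xi> = s * sin_transform f \<xi> + t * sin_transform ?L \<xi>" for \<xi>
    unfolding transform_symbol_deriv[OF assms] by (simp_all add: algebra_simps)
  have sch: "schwartz (\<lambda>\<xi>. ?\<theta>' \<xi> * cos_transform f \<xi>)" "schwartz (\<lambda>\<xi>. ?\<theta>' \<xi> * sin_transform f \<xi>)"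
    unfolding ex by (intro schwartz_lincomb schwartz_transform assms L)+
  have dt: "deriv (cos_transform f) = (\<lambda>\<xi>. - sin_transform (\<lambda>y. y * f y) \<xi>)"
    "deriv (sin_transform f) = cos_transform (\<lambda>y. y * f y)"
    using transform_has_deriv[OF assms] by (auto intro!: deriv_eqI)
  note parts = oscillatory_integral_by_parts(1)[OF schwartz_transform(1)[OF assms] sch(1) d]
    oscillatory_integral_by_parts(2)[OF schwartz_transform(2)[OF assms] sch(2) d]
  note int = airy_flow_integrable[OF assms, of s t a b] airy_flow_integrable[OF L, of s t a b]
    airy_flow_integrable[OF schwartz_mult_id[OF assms], of s t a b]
  have "(LINT \<xi>|lborel. s * (cos_transform f \<xi> * cos (?\<theta> \<xi>)) + t * (cos_transform ?L \<xi> * cos (?\<theta> \<xi>)))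
      = (LINT \<xi>|lborel. sin_transform (\<lambda>y. y * f y) \<xi> * sin (?\<theta> \<xi>))"
    using parts(1) unfolding ex dt by (simp add: distrib_right mult.assoc)
  then have 1: "s * (LINT \<xi>|lborel. cos_transform f \<xi> * cos (?\<theta> \<xi>)) + t * (LINT \<xi>|lborel. cos_transform ?L \<xi> * cos (?\<theta> \<xi>))
      = (LINT \<xi>|lborel. sin_transform (\<lambda>y. y * f y) \<xi> * sin (?\<theta> \<xi>))"
    using int by simp
  have "(LINT \<xi>|lborel. s * (sin_transform f \<xi> * sin (?\<theta> \<xi>)) + t * (sin_transform ?L \<xi> * sin (?\<theta> \<xi>)))
      = (LINT \<xi>|lborel. cos_transform (\<lambda>y. y * f y) \<xi> * cos (?\<theta> \<xi>))"
    using parts(2) unfolding ex dt by (simp add: distrib_right mult.assoc)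
  then have 2: "s * (LINT \<xi>|lborel. sin_transform f \<xi> * sin (?\<theta> \<xi>)) + t * (LINT \<xi>|lborel. sin_transform ?L \<xi> * sin (?\<theta> \<xi>))
      = (LINT \<xi>|lborel. cos_transform (\<lambda>y. y * f y) \<xi> * cos (?\<theta> \<xi>))"
    using int by simp
  have split: "airy_flow a b t g s = ((LINT \<xi>|lborel. cos_transform g \<xi> * cos (?\<theta> \<xi>))
      + (LINT \<xi>|lborel. sin_transform g \<xi> * sin (?\<theta> \<xi>))) / (2 * pi)" if "schwartz g" for g
    unfolding airy_flow_def using airy_flow_integrable[OF that, of s t a b] by simp
  show ?thesis
    unfolding split[OF assms] split[OF L] split[OF schwartz_mult_id[OF assms]] 1[symmetric] 2[symmetric]
    by (simp add: field_simps)
qed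

text \<open>Time enters only through the phase, so the integrals of the absolute values of the
  transforms bound the flow for all times at once.\<close>

lemma airy_flow_bounded:
  assumes "schwartz f"
  obtains K where "\<And>t s. \<bar>airy_flow a b t f s\<bar> \<le> K"
proof
  fix t s
  have le: "\<bar>u * cos z + v * sin z\<bar> \<le> \<bar>u\<bar> + \<bar>v\<bar>" for u v z :: real
    by (rule order_trans[OF abs_triangle_ineq]) (simp add: abs_mult mult_left_le add_mono)
  have "\<bar>LINT \<xi>|lborel. cos_transform f \<xi> * cos (s * \<xi> + t * airy_symbol a b \<xi>)
      + sin_transform f \<xi> * sin (s * \<xi> + t * airy_symbol a b \<xi>)\<bar>
    \<le> (LINT \<xi>|lborel. \<bar>cos_transform f \<xi> * cos (s * \<xi> + t * airy_symbol a b \<xi>)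
      + sin_transform f \<xi> * sin (s * \<xi> + t * airy_symbol a b \<xi>)\<bar>)"
    by (rule integral_abs_bound)
  also have "\<dots> \<le> (LINT \<xi>|lborel. \<bar>cos_transform f \<xi>\<bar> + \<bar>sin_transform f \<xi>\<bar>)"
    using airy_flow_integrable[OF assms] schwartz_integrable[OF schwartz_transform(1)[OF assms]]
      schwartz_integrable[OF schwartz_transform(2)[OF assms]]
    by (intro integral_mono integrable_abs Bochner_Integration.integrable_add le) auto
  finally show "\<bar>airy_flow a b t f s\<bar> \<le> (LINT \<xi>|lborel. \<bar>cos_transform f \<xi>\<bar> + \<bar>sin_transform f \<xi>\<bar>) / (2 * pi)"
    unfolding airy_flow_def by (simp add: abs_divide divide_right_mono)
qed

lemma schwartz_airy_flow:
  assumes "schwartz f"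
  shows "schwartz (airy_flow a b t f)"
proof (rule schwartz_coinduct[where X = "{airy_flow a b t f | f. schwartz f}"], goal_cases)
  case 1
  then show ?case using assms by blast
next
  case (2 h)
  then obtain f where f: "schwartz f" and h: "h = airy_flow a b t f" by blast
  show ?case unfolding h
    by (rule bexI[where x = "airy_flow a b t (deriv f)"])
      (use airy_flow_has_deriv_space[OF f] schwartz_deriv[OF f] in blast)+
next
  case (3 h)
  then obtain f where f: "schwartz f" and h: "h = airy_flow a b t f" by blast
  have "(\<lambda>s. s * h s) = airy_flow a b t (\<lambda>s. 1 * (s * f s) + (- t) * (b * f s + 3 * a * (deriv ^^ 2) f s))"
    unfolding h airy_flow_lincomb[OF schwartz_mult_id[OF f] schwartz_symbol_deriv_op[OF f]]
    using airy_flow_mult_id[OF f] by (simp add: fun_eq_iff)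
  moreover have "schwartz (\<lambda>s. 1 * (s * f s) + (- t) * (b * f s + 3 * a * (deriv ^^ 2) f s))"
    by (intro schwartz_lincomb[OF schwartz_mult_id[OF f] schwartz_symbol_deriv_op[OF f]])
  ultimately show ?case by blast
next
  case (4 h)
  then obtain f where f: "schwartz f" and h: "h = airy_flow a b t f" by blast
  obtain K where "\<And>t s. \<bar>airy_flow a b t f s\<bar> \<le> K" using airy_flow_bounded[OF f] by blast
  then show ?case unfolding h bounded_iff by auto
qed

lemma funpow_deriv_airy_flow:
  assumes "schwartz f"
  shows "(deriv ^^ k) (airy_flow a b t f) = airy_flow a b t ((deriv ^^ k) f)"
proof (induction k)
  case (Suc k)
  then show ?case
    using deriv_eqI[OF airy_flow_has_deriv_space[OF schwartz_funpow_deriv[OF assms, of k]]] by simp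
qed simp

lemma airy_op_airy_flow:
  assumes "schwartz f"
  shows "airy_op a b (airy_flow a b t f) = airy_flow a b t (airy_op a b f)"
  unfolding airy_op_def[abs_def] funpow_deriv_airy_flow[OF assms]
    deriv_eqI[OF airy_flow_has_deriv_space[OF assms]]
    airy_flow_lincomb[OF schwartz_funpow_deriv[OF assms] schwartz_deriv[OF assms]] ..

section \<open>Bounds for the flow on bounded time intervals and its isometry in L2\<close>

text \<open>Derivatives pass through the flow freely; each power of s is removed by
  \<open>airy_flow_mult_id\<close> at the price of a factor t. The induction on \<open>j\<close> is
  over all functions because the weight is moved onto new ones.\<close>

lemma airy_flow_seminorm_bounded:
  assumes "schwartz f"
  obtains K where "K \<ge> 0" "\<And>t s. \<bar>t\<bar> \<le> R \<Longrightarrow> \<bar>s ^ j * (deriv ^^ k) (airy_flow a b t f) s\<bar> \<le> K"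
proof -
  have "\<exists>K\<ge>0. \<forall>t s. \<bar>t\<bar> \<le> R \<longrightarrow> \<bar>s ^ j * airy_flow a b t g s\<bar> \<le> K" if "schwartz g" for g
    using that
  proof (induction j arbitrary: g)
    case 0
    obtain K where K: "\<And>t s. \<bar>airy_flow a b t g s\<bar> \<le> K" using airy_flow_bounded[OF 0] by blast
    then have "K \<ge> 0" by (meson abs_ge_zero order_trans)
    then show ?case using K by auto
  next
    case (Suc j)
    obtain K1 where K1: "K1 \<ge> 0" "\<And>t s. \<bar>t\<bar> \<le> R \<Longrightarrow> \<bar>s ^ j * airy_flow a b t (\<lambda>s. s * g s) s\<bar> \<le> K1"
      using Suc.IH[OF schwartz_mult_id[OF Suc.prems]] by blast
    obtain K2 where K2: "K2 \<ge> 0" "\<And>t s. \<bar>t\<bar> \<le> R \<Longrightarrow>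
        \<bar>s ^ j * airy_flow a b t (\<lambda>s. b * g s + 3 * a * (deriv ^^ 2) g s) s\<bar> \<le> K2"
      using Suc.IH[OF schwartz_symbol_deriv_op[OF Suc.prems]] by blast
    \<comment> \<open>The absolute value keeps the constant nonnegative even for negative
      \<open>R\<close>, where no t qualifies.\<close>
    have "\<bar>s ^ Suc j * airy_flow a b t g s\<bar> \<le> K1 + \<bar>R\<bar> * K2" if "\<bar>t\<bar> \<le> R" for t s
    proof -
      have "s ^ Suc j * airy_flow a b t g s = s ^ j * (s * airy_flow a b t g s)" by simp
      also have "\<dots> = s ^ j * airy_flow a b t (\<lambda>s. s * g s) s
          - t * (s ^ j * airy_flow a b t (\<lambda>s. b * g s + 3 * a * (deriv ^^ 2) g s) s)"
        unfolding airy_flow_mult_id[OF Suc.prems] by (simp add: algebra_simps)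
      also have "\<bar>\<dots>\<bar> \<le> K1 + \<bar>R\<bar> * K2"
        using K1(2)[OF that, of s] mult_mono[OF _ K2(2)[OF that, of s], of "\<bar>t\<bar>" "\<bar>R\<bar>"] that
        by (intro order_trans[OF abs_triangle_ineq4] add_mono) (auto simp: abs_mult)
      finally show ?thesis .
    qed
    moreover have "K1 + \<bar>R\<bar> * K2 \<ge> 0" using K1(1) K2(1) by simp
    ultimately show ?case by blast
  qed
  from this[OF schwartz_funpow_deriv[OF assms, of k]] show ?thesis
    using that unfolding funpow_deriv_airy_flow[OF assms] by blast
qed

lemma airy_flow_decay:
  assumes "schwartz f"
  obtains K where "K \<ge> 0" "\<And>t s. \<bar>t\<bar> \<le> R \<Longrightarrow> \<bar>airy_flow a b t f s\<bar> \<le> K / (1 + s\<^sup>2)"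
proof -
  obtain K0 where K0: "K0 \<ge> 0" "\<And>t s. \<bar>t\<bar> \<le> R \<Longrightarrow> \<bar>s ^ 0 * (deriv ^^ 0) (airy_flow a b t f) s\<bar> \<le> K0"
    using airy_flow_seminorm_bounded[OF assms] by blast
  obtain K2 where K2: "K2 \<ge> 0" "\<And>t s. \<bar>t\<bar> \<le> R \<Longrightarrow> \<bar>s ^ 2 * (deriv ^^ 0) (airy_flow a b t f) s\<bar> \<le> K2"
    using airy_flow_seminorm_bounded[OF assms] by blast
  have "\<bar>airy_flow a b t f s\<bar> \<le> (K0 + K2) / (1 + s\<^sup>2)" if "\<bar>t\<bar> \<le> R" for t s
  proof -
    have "\<bar>airy_flow a b t f s\<bar> * (1 + s\<^sup>2) \<le> K0 + K2"
      using K0(2)[OF that, of s] K2(2)[OF that, of s] by (simp add: abs_mult algebra_simps)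
    moreover have "1 + s\<^sup>2 > 0" by (simp add: add_pos_nonneg)
    ultimately show ?thesis by (simp add: pos_le_divide_eq)
  qed
  then show ?thesis using that[of "K0 + K2"] K0(1) K2(1) by simp
qed

text \<open>Energy argument: the time derivative of the squared norm is 2 (B u, u), and this
  vanishes since B is skew and commutes with the flow. At time 0 Fourier inversion identifies the
  flow with the identity.\<close>

lemma airy_flow_L2_isometry:
  assumes "schwartz f"
  shows "(LINT s|lborel. (airy_flow a b t f s)\<^sup>2) = (LINT s|lborel. (f s)\<^sup>2)"
proof -
  let ?u = "\<lambda>t. airy_flow a b t f" and ?v = "\<lambda>t. airy_flow a b t (airy_op a b f)"
  note s = schwartz_airy_flow[OF assms] schwartz_airy_flow[OF schwartz_airy_op[OF assms]]
  have "((\<lambda>t. LINT s|lborel. ?u t s * ?u t s) has_real_derivative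
      (LINT s|lborel. 2 * (?v t0 s * ?u t0 s))) (at t0)" for t0
  proof -
    obtain K where K: "K \<ge> 0" "\<And>t s. \<bar>t\<bar> \<le> \<bar>t0\<bar> + 1 \<Longrightarrow> \<bar>?v t s\<bar> \<le> K / (1 + s\<^sup>2)"
      using airy_flow_decay[OF schwartz_airy_op[OF assms]] by blast
    obtain L where L: "\<And>t s. \<bar>?u t s\<bar> \<le> L" using airy_flow_bounded[OF assms] by blast
    show ?thesis
    proof (rule has_real_derivative_integral[where e = 1 and g = "\<lambda>s. 2 * (K * L) * (1 / (1 + s\<^sup>2))"])
      show "integrable lborel (\<lambda>s. ?u t s * ?u t s)" for t
        using s(1) by (intro schwartz_integrable_mult)
      show "((\<lambda>t. ?u t s * ?u t s) has_real_derivative 2 * (?v t s * ?u t s)) (at t)" for t s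
        using airy_flow_has_deriv_time[OF assms, of a b s t] by (auto intro!: derivative_eq_intros)
      show "\<bar>2 * (?v t s * ?u t s)\<bar> \<le> 2 * (K * L) * (1 / (1 + s\<^sup>2))" if "\<bar>t - t0\<bar> < 1" for t s
      proof -
        have "\<bar>t\<bar> \<le> \<bar>t0\<bar> + 1" using that by linarith
        then have "\<bar>?v t s\<bar> * \<bar>?u t s\<bar> \<le> K / (1 + s\<^sup>2) * L"
          using K L by (intro mult_mono) auto
        then show ?thesis by (simp add: abs_mult)
      qed
      show "integrable lborel (\<lambda>s. 2 * (K * L) * (1 / (1 + s\<^sup>2)))"
        by (intro integrable_mult_right integrable_one_over_one_plus_square)
    qed simp
  qed
  \<comment> \<open>Skewness with equal arguments makes the integral its own negative.\<close>
  moreover have "(LINT s|lborel. 2 * (?v t0 s * ?u t0 s)) = 0" for t0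
    using airy_op_skew[OF s(1) s(1), of a b a b t0 a b t0]
    unfolding airy_op_airy_flow[OF assms] by (simp add: mult.commute)
  ultimately have "((\<lambda>t. LINT s|lborel. ?u t s * ?u t s) has_real_derivative 0) (at t)" for t
    by simp
  then have "(LINT s|lborel. ?u t s * ?u t s) = (LINT s|lborel. ?u 0 s * ?u 0 s)"
    by (intro DERIV_isconst_all allI)
  then show ?thesis
    unfolding airy_flow_0[OF assms] by (simp add: power2_eq_square)
qed


section \<open>Uniform boundedness for tempered distributions\<close>

text \<open>
  \<open>J\<close> is chosen so sparse that for some rows with \<open>m \<in> J\<close> the diagonal entry dominates: earlier columns are
  controlled by \<open>col\<close>, later ones by the tails in \<open>row\<close>.
\<close>

lemma gliding_hump:
  fixes x :: "nat \<Rightarrow> nat \<Rightarrow> real"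
  assumes row: "\<And>m. summable (\<lambda>n. \<bar>x m n\<bar>)"
    and col: "\<And>n. \<exists>B. \<forall>m. \<bar>x m n\<bar> \<le> B"
    and diag: "\<And>n. real n \<le> \<bar>x n n\<bar>"
  shows "\<exists>J. \<forall>C. \<exists>m. C < \<bar>\<Sum>n. if n \<in> J then x m n else 0\<bar>"
proof -
  from col obtain B where B: "\<And>m n. \<bar>x m n\<bar> \<le> B n" by metis
  have B0: "B n \<ge> 0" for n using B[of 0 n] by linarith
  \<comment> \<open>\<open>k\<close> will be the successor of \<open>N\<close> in the sparse set. In
    row k the sum of the \<open>B i\<close> pays for the earlier columns; of the margin 2, one unit
    pays for the tail of that row, the other is left over. The tail of row \<open>N\<close> itself
    is made small beyond \<open>k\<close>.\<close>
  have "\<exists>k. k > N \<and> real k \<ge> real N + 2 + (\<Sum>i\<le>N. B i) \<and> (\<Sum>n. \<bar>x N (n + k)\<bar>) \<le> 1" for N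
  proof -
    have "(\<lambda>k. \<Sum>n. \<bar>x N (n + k)\<bar>) \<longlonglongrightarrow> 0"
      by (rule suminf_exist_split2[OF row])
    then have "\<forall>\<^sub>F k in sequentially. (\<Sum>n. \<bar>x N (n + k)\<bar>) < 1"
      by (rule order_tendstoD) simp
    moreover have "\<forall>\<^sub>F k in sequentially. real k \<ge> real N + 2 + (\<Sum>i\<le>N. B i)"
      by (rule filterlim_real_sequentially[unfolded filterlim_at_top, rule_format])
    moreover have "\<forall>\<^sub>F k in sequentially. k > N" by (rule eventually_gt_at_top)
    ultimately have "\<forall>\<^sub>F k in sequentially. k > N \<and> real k \<ge> real N + 2 + (\<Sum>i\<le>N. B i)
        \<and> (\<Sum>n. \<bar>x N (n + k)\<bar>) \<le> 1"
      by eventually_elim simp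
    then show ?thesis by (rule eventually_happens'[OF sequentially_bot])
  qed
  then obtain g where g: "\<And>N. g N > N" "\<And>N. real (g N) \<ge> real N + 2 + (\<Sum>i\<le>N. B i)"
    "\<And>N. (\<Sum>n. \<bar>x N (n + g N)\<bar>) \<le> 1"
    by metis
  define r where "r j = (g ^^ j) 0" for j
  have rSuc: "r (Suc j) = g (r j)" for j by (simp add: r_def)
  have mono: "strict_mono r" by (rule strict_monoI_Suc) (simp add: rSuc g)
  let ?y = "\<lambda>m n. if n \<in> range r then x m n else 0"
  have large: "real (r j) + 1 \<le> \<bar>\<Sum>n. ?y (r (Suc j)) n\<bar>" for j
  proof -
    define m where "m = r (Suc j)"
    have gm: "g m = r (Suc (Suc j))" by (simp add: m_def rSuc)
    have abs_sum: "summable (\<lambda>n. \<bar>?y m n\<bar>)"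
      by (rule summable_comparison_test'[OF row[of m], of 0]) simp
    then have sum: "summable (?y m)" by (rule summable_rabs_cancel)
    have le: "\<bar>?y m n\<bar> \<le> \<bar>x m n\<bar>" for n by simp
    have "\<bar>\<Sum>n. ?y m (n + g m)\<bar> \<le> (\<Sum>n. \<bar>?y m (n + g m)\<bar>)"
      using abs_sum by (intro summable_rabs summable_ignore_initial_segment)
    also have "\<dots> \<le> (\<Sum>n. \<bar>x m (n + g m)\<bar>)"
      by (intro suminf_le le summable_ignore_initial_segment row abs_sum)
    finally have tail: "\<bar>\<Sum>n. ?y m (n + g m)\<bar> \<le> 1" using g(3)[of m] by linarith
    \<comment> \<open>Besides \<open>m\<close>, the selected columns below \<open>g m\<close> are r
      0, ..., r j, so only the column bounds up to \<open>r j\<close> enter.\<close>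
    have small: "n \<le> r j" if "n \<in> range r" "n < g m" "n \<noteq> m" for n
    proof -
      from that obtain i where i: "n = r i" by blast
      with that(2) gm mono have "i < Suc (Suc j)" by (simp add: strict_mono_less)
      moreover have "i \<noteq> Suc j" using that(3) i m_def by blast
      ultimately have "i \<le> j" by simp
      then show ?thesis using i mono by (simp add: strict_mono_less_eq)
    qed
    have "\<bar>\<Sum>n\<in>{..<g m} - {m}. ?y m n\<bar> \<le> (\<Sum>n\<in>{..<g m} - {m}. \<bar>?y m n\<bar>)"
      by (rule sum_abs)
    also have "\<dots> = (\<Sum>n\<in>({..<g m} - {m}) \<inter> {..r j}. \<bar>?y m n\<bar>)"
      using small by (intro sum.mono_neutral_right) auto
    also have "\<dots> \<le> (\<Sum>n\<in>({..<g m} - {m}) \<inter> {..r j}. B n)"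
      using B B0 by (intro sum_mono) auto
    also have "\<dots> \<le> (\<Sum>n\<le>r j. B n)"
      using B0 by (intro sum_mono2) auto
    finally have head: "\<bar>\<Sum>n\<in>{..<g m} - {m}. ?y m n\<bar> \<le> (\<Sum>n\<le>r j. B n)" .
    have "(\<Sum>n. ?y m n) = (\<Sum>n. ?y m (n + g m)) + (\<Sum>n<g m. ?y m n)"
      by (rule suminf_split_initial_segment[OF sum])
    also have "(\<Sum>n<g m. ?y m n) = ?y m m + (\<Sum>n\<in>{..<g m} - {m}. ?y m n)"
      using g(1)[of m] by (intro sum.remove) auto
    also have "?y m m = x m m" by (simp add: m_def)
    finally have "(\<Sum>n. ?y m n) = (\<Sum>n. ?y m (n + g m)) + (x m m + (\<Sum>n\<in>{..<g m} - {m}. ?y m n))" .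
    moreover have "real m \<ge> real (r j) + 2 + (\<Sum>n\<le>r j. B n)"
      unfolding m_def rSuc by (rule g)
    ultimately show ?thesis using tail head diag[of m] unfolding m_def by linarith
  qed
  have "\<exists>m. C < \<bar>\<Sum>n. ?y m n\<bar>" for C
  proof -
    obtain j :: nat where "C < real j" using reals_Archimedean2 by blast
    moreover have "real j \<le> real (r j)" using mono by (simp add: strict_mono_imp_increasing)
    ultimately show ?thesis using large[of j] by (intro exI[of _ "r (Suc j)"]) linarith
  qed
  then show ?thesis by blast
qed

text \<open>Bounded subsets in the sense of topological vector spaces: each defining seminorm is
  bounded on the set.\<close>

definition schwartz_bounded_family :: "(real \<Rightarrow> real) set \<Rightarrow> bool" where
  "schwartz_bounded_family X \<longleftrightarrow> (\<forall>f\<in>X. schwartz f) \<and>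
    (\<forall>j k. \<exists>M. \<forall>f\<in>X. \<forall>s. \<bar>s ^ j * (deriv ^^ k) f s\<bar> \<le> M)"

lemma schwartz_bounded_familyD:
  assumes "schwartz_bounded_family X"
  shows "f \<in> X \<Longrightarrow> schwartz f"
    and "\<exists>M\<ge>0. \<forall>f\<in>X. \<forall>s. \<bar>s ^ j * (deriv ^^ k) f s\<bar> \<le> M"
proof -
  show "f \<in> X \<Longrightarrow> schwartz f" using assms by (simp add: schwartz_bounded_family_def)
  obtain M where M: "\<forall>f\<in>X. \<forall>s. \<bar>s ^ j * (deriv ^^ k) f s\<bar> \<le> M"
    using assms unfolding schwartz_bounded_family_def by meson
  then have "\<forall>f\<in>X. \<forall>s. \<bar>s ^ j * (deriv ^^ k) f s\<bar> \<le> \<bar>M\<bar>" by (meson abs_ge_self order_trans)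
  then show "\<exists>M\<ge>0. \<forall>f\<in>X. \<forall>s. \<bar>s ^ j * (deriv ^^ k) f s\<bar> \<le> M" by (meson abs_ge_zero)
qed

lemma schwartz_bounded_family_subset:
  assumes "schwartz_bounded_family X" "Y \<subseteq> X"
  shows "schwartz_bounded_family Y"
  unfolding schwartz_bounded_family_def
proof (intro conjI allI ballI)
  show "schwartz f" if "f \<in> Y" for f
    using schwartz_bounded_familyD(1)[OF assms(1)] assms(2) that by blast
  show "\<exists>M. \<forall>f\<in>Y. \<forall>s. \<bar>s ^ j * (deriv ^^ k) f s\<bar> \<le> M" for j k
    using schwartz_bounded_familyD(2)[OF assms(1), of j k] assms(2) by (meson subsetD)
qed

lemma schwartz_bounded_family_deriv:
  assumes "schwartz_bounded_family X"
  shows "schwartz_bounded_family (deriv ` X)"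
proof -
  have "\<exists>M. \<forall>f\<in>X. \<forall>s. \<bar>s ^ j * (deriv ^^ k) (deriv f) s\<bar> \<le> M" for j k
    using schwartz_bounded_familyD(2)[OF assms, of j "Suc k"]
    by (auto simp: funpow_swap1)
  then show ?thesis
    using schwartz_bounded_familyD(1)[OF assms] schwartz_deriv
    unfolding schwartz_bounded_family_def by auto
qed

lemma schwartz_bounded_family_mult_id:
  assumes "schwartz_bounded_family X"
  shows "schwartz_bounded_family ((\<lambda>f s. s * f s) ` X)"
proof -
  have "\<exists>M. \<forall>f\<in>X. \<forall>s. \<bar>s ^ j * (deriv ^^ k) (\<lambda>s. s * f s) s\<bar> \<le> M" for j k
  proof -
    obtain M1 where M1: "\<forall>f\<in>X. \<forall>s. \<bar>s ^ Suc j * (deriv ^^ k) f s\<bar> \<le> M1"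
      using schwartz_bounded_familyD(2)[OF assms] by meson
    obtain M2 where M2: "\<forall>f\<in>X. \<forall>s. \<bar>s ^ j * (deriv ^^ (k - 1)) f s\<bar> \<le> M2"
      using schwartz_bounded_familyD(2)[OF assms] by meson
    have "\<bar>s ^ j * (deriv ^^ k) (\<lambda>s. s * f s) s\<bar> \<le> M1 + real k * M2" if "f \<in> X" for f s
    proof -
      have "s ^ j * (deriv ^^ k) (\<lambda>s. s * f s) s
          = s ^ Suc j * (deriv ^^ k) f s + real k * (s ^ j * (deriv ^^ (k - 1)) f s)"
        unfolding funpow_deriv_mult_id[OF schwartz_bounded_familyD(1)[OF assms that]]
        by (simp add: algebra_simps)
      also have "\<bar>\<dots>\<bar> \<le> M1 + real k * M2"
        using M1 M2 that by (intro order_trans[OF abs_triangle_ineq] add_mono)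
          (auto simp: abs_mult[of "real k"] intro!: mult_left_mono)
      finally show ?thesis .
    qed
    then show ?thesis by blast
  qed
  then show ?thesis
    using schwartz_bounded_familyD(1)[OF assms] schwartz_mult_id
    unfolding schwartz_bounded_family_def by auto
qed

section \<open>Series in the Schwartz space with geometric weights\<close>

text \<open>The weights (1/2)^n make the series converge for every bounded family \<beta>. The
  coefficients, bounded by 1 in the lemmas, serve three purposes: signs give absolute summability,
  an indicator selects a subset of terms, and zeros below an index give remainders.\<close>

definition geometric_series :: "(nat \<Rightarrow> real) \<Rightarrow> (nat \<Rightarrow> real \<Rightarrow> real) \<Rightarrow> real \<Rightarrow> real" where
  "geometric_series c \<beta> s = (\<Sum>n. c n * (1/2) ^ n * \<beta> n s)"

lemma summable_geometric_bound:
  assumes "\<And>n. \<bar>c n\<bar> \<le> 1" "\<And>n. \<bar>b n\<bar> \<le> (M::real)"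
  shows "summable (\<lambda>n. c n * (1/2) ^ n * b n)"
proof (rule summable_comparison_test')
  show "summable (\<lambda>n. M * (1/2) ^ n)" by (intro summable_mult summable_geometric) simp
  show "norm (c n * (1/2) ^ n * b n) \<le> M * (1/2) ^ n" for n
    using mult_mono[OF mult_mono[OF assms(1)[of n] order_refl[of "(1/2)^n"]] assms(2)[of n]]
    by (simp add: abs_mult mult.commute)
qed

lemma geometric_series_has_deriv:
  assumes c: "\<And>n. \<bar>c n\<bar> \<le> 1" and \<beta>: "schwartz_bounded_family (range \<beta>)"
  shows "(geometric_series c \<beta> has_real_derivative geometric_series c (\<lambda>n. deriv (\<beta> n)) s) (at s)"
proof -
  obtain M where M: "\<And>n s. \<bar>s ^ 0 * (deriv ^^ 0) (\<beta> n) s\<bar> \<le> M"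
    using schwartz_bounded_familyD(2)[OF \<beta>, of 0 0] by blast
  obtain M' where M': "\<And>n s. \<bar>s ^ 0 * (deriv ^^ 1) (\<beta> n) s\<bar> \<le> M'"
    using schwartz_bounded_familyD(2)[OF \<beta>, of 0 1] by blast
  have unif: "uniformly_convergent_on UNIV (\<lambda>N s. \<Sum>n<N. c n * (1/2) ^ n * deriv (\<beta> n) s)"
  proof (rule Weierstrass_m_test')
    show "summable (\<lambda>n. M' * (1/2) ^ n)" by (intro summable_mult summable_geometric) simp
    show "norm (c n * (1/2) ^ n * deriv (\<beta> n) s) \<le> M' * (1/2) ^ n" for n s
      using mult_mono[OF mult_mono[OF c[of n] order_refl[of "(1/2)^n"]] M'[of s n]]
      by (simp add: abs_mult mult.commute)
  qed
  have deriv: "((\<lambda>s. c n * (1/2) ^ n * \<beta> n s) has_real_derivative c n * (1/2) ^ n * deriv (\<beta> n) s) (at s within UNIV)" for n s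
    using schwartz_has_deriv[OF schwartz_bounded_familyD(1)[OF \<beta> rangeI[of \<beta> n]], of s]
    by (auto intro!: derivative_eq_intros)
  have "summable (\<lambda>n. c n * (1/2) ^ n * \<beta> n 0)"
    using c M by (intro summable_geometric_bound[where M = M]) auto
  then have "((\<lambda>s. \<Sum>n. c n * (1/2) ^ n * \<beta> n s) has_real_derivative
      (\<Sum>n. c n * (1/2) ^ n * deriv (\<beta> n) s)) (at s)"
    by (rule has_field_derivative_series'(2)[OF convex_UNIV deriv unif UNIV_I]) simp
  then show ?thesis unfolding geometric_series_def[abs_def] .
qed

lemma schwartz_geometric_series:
  assumes c: "\<And>n. \<bar>c n\<bar> \<le> 1" and \<beta>: "schwartz_bounded_family (range \<beta>)"
  shows "schwartz (geometric_series c \<beta>)"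
proof (rule schwartz_coinduct[where X = "{geometric_series c \<beta> | \<beta>. schwartz_bounded_family (range \<beta>)}"], goal_cases)
  case 1
  then show ?case using \<beta> by blast
next
  case (2 h)
  then obtain \<beta> where \<beta>: "schwartz_bounded_family (range \<beta>)" and h: "h = geometric_series c \<beta>" by blast
  have "schwartz_bounded_family (range (\<lambda>n. deriv (\<beta> n)))"
    using schwartz_bounded_family_deriv[OF \<beta>] by (simp add: image_image)
  moreover have "\<forall>s. (geometric_series c \<beta> has_real_derivative geometric_series c (\<lambda>n. deriv (\<beta> n)) s) (at s)"
    using geometric_series_has_deriv[OF c \<beta>] by simp
  ultimately show ?case unfolding h by blast
next
  case (3 h)
  then obtain \<beta> where \<beta>: "schwartz_bounded_family (range \<beta>)" and h: "h = geometric_series c \<beta>" by blast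
  obtain M where M: "\<And>n s. \<bar>s ^ 0 * (deriv ^^ 0) (\<beta> n) s\<bar> \<le> M"
    using schwartz_bounded_familyD(2)[OF \<beta>, of 0 0] by blast
  have "s * h s = geometric_series c (\<lambda>n s. s * \<beta> n s) s" for s
  proof -
    have "summable (\<lambda>n. c n * (1/2) ^ n * \<beta> n s)"
      using c M by (intro summable_geometric_bound[where M = M]) auto
    from suminf_mult[OF this, of s] show ?thesis
      unfolding h geometric_series_def by (simp add: mult.left_commute)
  qed
  then have "(\<lambda>s. s * h s) = geometric_series c (\<lambda>n s. s * \<beta> n s)" by (rule ext)
  moreover have "schwartz_bounded_family (range (\<lambda>n s. s * \<beta> n s))"
    using schwartz_bounded_family_mult_id[OF \<beta>] by (simp add: image_image)
  ultimately show ?case by blast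
next
  case (4 h)
  then obtain \<beta> where \<beta>: "schwartz_bounded_family (range \<beta>)" and h: "h = geometric_series c \<beta>" by blast
  obtain M where M: "\<And>n s. \<bar>s ^ 0 * (deriv ^^ 0) (\<beta> n) s\<bar> \<le> M"
    using schwartz_bounded_familyD(2)[OF \<beta>, of 0 0] by blast
  have "norm (h s) \<le> (\<Sum>n. M * (1/2) ^ n)" for s
    unfolding h geometric_series_def
  proof (rule norm_suminf_le)
    show "summable (\<lambda>n. M * (1/2) ^ n)" by (intro summable_mult summable_geometric) simp
    show "norm (c n * (1/2) ^ n * \<beta> n s) \<le> M * (1/2) ^ n" for n
      using mult_mono[OF mult_mono[OF c[of n] order_refl[of "(1/2)^n"]] M[of s n]]
      by (simp add: abs_mult mult.commute)
  qed
  then show ?case unfolding bounded_iff by blast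
qed

lemma funpow_deriv_geometric_series:
  assumes c: "\<And>n. \<bar>c n\<bar> \<le> 1" and \<beta>: "schwartz_bounded_family (range \<beta>)"
  shows "(deriv ^^ k) (geometric_series c \<beta>) = geometric_series c (\<lambda>n. (deriv ^^ k) (\<beta> n))"
proof (induction k)
  case (Suc k)
  have "schwartz_bounded_family (range (\<lambda>n. (deriv ^^ k) (\<beta> n)))"
  proof (induction k)
    case (Suc k)
    then show ?case using schwartz_bounded_family_deriv[OF Suc] by (simp add: image_image)
  qed (simp add: \<beta>)
  from deriv_eqI[OF geometric_series_has_deriv[OF c this]] Suc show ?case by simp
qed simp

lemma schwartz_seminorm_bound:
  assumes "\<And>s. \<bar>s ^ j * (deriv ^^ k) f s\<bar> \<le> K"
  shows "schwartz_seminorm j k f \<le> K" "schwartz_seminorm j k f \<ge> 0"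
proof -
  show "schwartz_seminorm j k f \<le> K"
    unfolding schwartz_seminorm_def using assms by (intro cSUP_least) auto
  have "bdd_above (range (\<lambda>s. \<bar>s ^ j * (deriv ^^ k) f s\<bar>))" using assms by (intro bdd_aboveI[of _ K]) auto
  then show "schwartz_seminorm j k f \<ge> 0"
    unfolding schwartz_seminorm_def by (intro cSUP_upper2[where x = 0]) auto
qed

lemma geometric_series_converges:
  assumes c: "\<And>n. \<bar>c n\<bar> \<le> 1" and \<beta>: "schwartz_bounded_family (range \<beta>)"
  shows "schwartz_converges (\<lambda>N s. \<Sum>n<N. c n * (1/2) ^ n * \<beta> n s) (geometric_series c \<beta>)"
  unfolding schwartz_converges_def
proof (intro allI)
  fix j k
  obtain M0 where M0: "\<And>n s. \<bar>s ^ 0 * (deriv ^^ 0) (\<beta> n) s\<bar> \<le> M0"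
    using schwartz_bounded_familyD(2)[OF \<beta>, of 0 0] by blast
  obtain M where M: "M \<ge> 0" "\<And>n s. \<bar>s ^ j * (deriv ^^ k) (\<beta> n) s\<bar> \<le> M"
    using schwartz_bounded_familyD(2)[OF \<beta>, of j k] by blast
  obtain Mk where Mk: "\<And>n s. \<bar>s ^ 0 * (deriv ^^ k) (\<beta> n) s\<bar> \<le> Mk"
    using schwartz_bounded_familyD(2)[OF \<beta>, of 0 k] by blast
  \<comment> \<open>The remainder after \<open>N\<close> terms is again a geometric series, with the
    coefficients below \<open>N\<close> set to 0, so the formula for its derivatives applies
    directly.\<close>
  define d where "d N n = (if n < N then 0 else - c n)" for N n :: nat
  have d: "\<bar>d N n\<bar> \<le> 1" for N n using c by (simp add: d_def)
  have diff: "(\<lambda>s. (\<Sum>n<N. c n * (1/2) ^ n * \<beta> n s) - geometric_series c \<beta> s) = geometric_series (d N) \<beta>" for N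
  proof
    fix s
    have sc: "summable (\<lambda>n. c n * (1/2) ^ n * \<beta> n s)"
      using c M0 by (intro summable_geometric_bound[where M = M0]) auto
    have sd: "summable (\<lambda>n. d N n * (1/2) ^ n * \<beta> n s)"
      using d M0 by (intro summable_geometric_bound[where M = M0]) auto
    show "(\<Sum>n<N. c n * (1/2) ^ n * \<beta> n s) - geometric_series c \<beta> s = geometric_series (d N) \<beta> s"
      unfolding geometric_series_def suminf_split_initial_segment[OF sc, of N]
        suminf_split_initial_segment[OF sd, of N]
      using summable_ignore_initial_segment[OF sc, of N]
      by (simp add: d_def suminf_minus)
  qed
  have bound: "\<bar>s ^ j * (deriv ^^ k) (geometric_series (d N) \<beta>) s\<bar> \<le> 2 * M * (1/2) ^ N" for N s
  proof -
    let ?b = "\<lambda>n. (deriv ^^ k) (\<beta> n) s"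
    have sd: "summable (\<lambda>n. d N n * (1/2) ^ n * ?b n)"
      using d Mk by (intro summable_geometric_bound[where M = Mk]) auto
    have "s ^ j * (deriv ^^ k) (geometric_series (d N) \<beta>) s = (\<Sum>n. s ^ j * (d N n * (1/2) ^ n * ?b n))"
      unfolding funpow_deriv_geometric_series[OF d \<beta>] geometric_series_def
      using sd by (rule suminf_mult[symmetric])
    also have "\<dots> = (\<Sum>n. s ^ j * (d N (n + N) * (1/2) ^ (n + N) * ?b (n + N)))"
      using suminf_split_initial_segment[OF summable_mult[OF sd, of "s ^ j"], of N] by (simp add: d_def)
    also have "norm \<dots> \<le> (\<Sum>n. M * (1/2) ^ N * (1/2) ^ n)"
    proof (rule norm_suminf_le)
      show "summable (\<lambda>n. M * (1/2::real) ^ N * (1/2) ^ n)" by (intro summable_mult summable_geometric) simp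
      show "norm (s ^ j * (d N (n + N) * (1/2) ^ (n + N) * ?b (n + N))) \<le> M * (1/2) ^ N * (1/2) ^ n" for n
        using mult_mono[OF mult_mono[OF d[of N "n + N"] order_refl[of "(1/2)^(n + N)"]] M(2)[of s "n + N"]]
        by (simp add: abs_mult power_add mult_ac)
    qed
    also have "\<dots> = 2 * M * (1/2) ^ N"
      by (subst suminf_mult) (simp_all add: suminf_geometric)
    finally show ?thesis by simp
  qed
  have "(\<lambda>N. schwartz_seminorm j k (geometric_series (d N) \<beta>)) \<longlonglongrightarrow> 0"
  proof (rule tendsto_sandwich[OF always_eventually always_eventually tendsto_const])
    show "\<forall>N. 0 \<le> schwartz_seminorm j k (geometric_series (d N) \<beta>)"
      using schwartz_seminorm_bound(2)[OF bound] by blast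
    show "\<forall>N. schwartz_seminorm j k (geometric_series (d N) \<beta>) \<le> 2 * M * (1/2) ^ N"
      using schwartz_seminorm_bound(1)[OF bound] by blast
    show "(\<lambda>N. 2 * M * (1/2) ^ N) \<longlonglongrightarrow> 0" by real_asymp
  qed
  then show "(\<lambda>N. schwartz_seminorm j k (\<lambda>s. (\<Sum>n<N. c n * (1/2) ^ n * \<beta> n s) - geometric_series c \<beta> s)) \<longlonglongrightarrow> 0"
    unfolding diff .
qed

section \<open>The Banach-Steinhaus theorem for tempered distributions\<close>

lemma tempered_lincomb:
  assumes "tempered_distribution T" "schwartz f" "schwartz g"
  shows "T (\<lambda>s. a * f s + b * g s) = a * T f + b * T g"
  using assms unfolding tempered_distribution_def by blast

lemma tempered_tendsto:
  assumes "tempered_distribution T" "\<And>n. schwartz (F n)" "schwartz f" "schwartz_converges F f"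
  shows "(\<lambda>n. T (F n)) \<longlonglongrightarrow> T f"
  using conjunct2[OF assms(1)[unfolded tempered_distribution_def]] assms(2-4) by simp

lemma tempered_geometric_series:
  assumes T: "tempered_distribution T"
    and c: "\<And>n. \<bar>c n\<bar> \<le> 1" and \<beta>: "schwartz_bounded_family (range \<beta>)"
  shows "(\<lambda>n. c n * (1/2) ^ n * T (\<beta> n)) sums T (geometric_series c \<beta>)"
proof -
  have s: "schwartz (\<beta> n)" for n using schwartz_bounded_familyD(1)[OF \<beta>] by blast
  have p: "schwartz (\<lambda>s. \<Sum>n<N. c n * (1/2) ^ n * \<beta> n s)" for N
    by (intro schwartz_sum schwartz_scale s)
  have "T (\<lambda>s. \<Sum>n<N. c n * (1/2) ^ n * \<beta> n s) = (\<Sum>n<N. c n * (1/2) ^ n * T (\<beta> n))" for N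
  proof (induction N)
    case 0
    show ?case using tempered_lincomb[OF T schwartz_zero schwartz_zero, of 0 0] by simp
  next
    case (Suc N)
    then show ?case using tempered_lincomb[OF T p[of N] s[of N], of 1 "c N * (1/2) ^ N"] by simp
  qed
  moreover have "(\<lambda>N. T (\<lambda>s. \<Sum>n<N. c n * (1/2) ^ n * \<beta> n s)) \<longlonglongrightarrow> T (geometric_series c \<beta>)"
    by (rule tempered_tendsto[OF T p schwartz_geometric_series[OF c \<beta>] geometric_series_converges[OF c \<beta>]])
  ultimately show ?thesis unfolding sums_def by simp
qed

text \<open>If the bound failed, there would be functionals in the family and functions in
  \<open>X\<close> with ever larger values; the gliding hump assembles these functions into a single
  Schwartz function on which the functionals are unbounded, against the pointwise
  hypothesis.\<close>

theorem tempered_uniform_boundedness: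
  assumes T: "\<And>T. T \<in> \<T> \<Longrightarrow> tempered_distribution T"
    and pointwise: "\<And>\<phi>. schwartz \<phi> \<Longrightarrow> \<exists>C. \<forall>T\<in>\<T>. \<bar>T \<phi>\<bar> \<le> C"
    and X: "schwartz_bounded_family X"
  shows "\<exists>C. \<forall>T\<in>\<T>. \<forall>f\<in>X. \<bar>T f\<bar> \<le> C"
proof (rule ccontr)
  assume neg: "\<not> ?thesis"
  \<comment> \<open>The factor 2^n compensates the weight of the n-th term of the series, so that
    the diagonal of the matrix \<open>?x\<close> below grows at least like n.\<close>
  have "\<exists>p. fst p \<in> \<T> \<and> snd p \<in> X \<and> real n * 2 ^ n \<le> \<bar>fst p (snd p)\<bar>" for n :: nat
  proof -
    obtain T f where "T \<in> \<T>" "f \<in> X" "\<not> \<bar>T f\<bar> \<le> real n * 2 ^ n"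
      using neg by blast
    then show ?thesis by (intro exI[of _ "(T, f)"]) simp
  qed
  then obtain p where p: "\<And>n. fst (p n) \<in> \<T>" "\<And>n. snd (p n) \<in> X"
    "\<And>n. real n * 2 ^ n \<le> \<bar>fst (p n) (snd (p n))\<bar>"
    by metis
  define S where "S n = fst (p n)" for n
  define \<beta> where "\<beta> n = snd (p n)" for n
  have S: "S n \<in> \<T>" and \<beta>: "\<beta> n \<in> X" and large: "real n * 2 ^ n \<le> \<bar>S n (\<beta> n)\<bar>" for n
    using p by (simp_all add: S_def \<beta>_def)
  have fam: "schwartz_bounded_family (range \<beta>)"
    by (rule schwartz_bounded_family_subset[OF X]) (use \<beta> in blast)
  have sums: "(\<lambda>n. c n * (1/2) ^ n * S m (\<beta> n)) sums S m (geometric_series c \<beta>)" if "\<And>n. \<bar>c n\<bar> \<le> 1" for c m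
    using tempered_geometric_series[OF T[OF S] that fam] .
  let ?x = "\<lambda>m n. (1/2) ^ n * S m (\<beta> n)"
  have row: "summable (\<lambda>n. \<bar>?x m n\<bar>)" for m
  proof -
    \<comment> \<open>With the signs of the values as coefficients, convergence of the series is
      absolute convergence of the row.\<close>
    have "summable (\<lambda>n. sgn (S m (\<beta> n)) * (1/2) ^ n * S m (\<beta> n))"
      using sums[of "\<lambda>n. sgn (S m (\<beta> n))" m] by (auto simp: sums_iff abs_sgn_eq)
    moreover have "sgn (S m (\<beta> n)) * (1/2) ^ n * S m (\<beta> n) = \<bar>?x m n\<bar>" for n
      by (simp add: abs_mult sgn_if)
    ultimately show ?thesis by simp
  qed
  have col: "\<exists>B. \<forall>m. \<bar>?x m n\<bar> \<le> B" for n
  proof -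
    obtain C where "\<forall>T\<in>\<T>. \<bar>T (\<beta> n)\<bar> \<le> C"
      using pointwise schwartz_bounded_familyD(1)[OF X \<beta>] by blast
    then have "\<bar>?x m n\<bar> \<le> (1/2) ^ n * C" for m
      using S by (auto simp: abs_mult intro!: mult_left_mono)
    then show ?thesis by blast
  qed
  have diag: "real n \<le> \<bar>?x n n\<bar>" for n
    using large[of n] by (simp add: abs_mult power_one_over field_simps)
  obtain J where J: "\<forall>C. \<exists>m. C < \<bar>\<Sum>n. if n \<in> J then ?x m n else 0\<bar>"
    using gliding_hump[OF row col diag] by (rule exE)
  define c where "c n = (if n \<in> J then 1 else 0 :: real)" for n
  have c: "\<bar>c n\<bar> \<le> 1" for n by (simp add: c_def)
  have "S m (geometric_series c \<beta>) = (\<Sum>n. if n \<in> J then ?x m n else 0)" for m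
    using sums_unique[OF sums[where c = c and m = m, OF c]] by (simp add: c_def if_distrib if_distribR cong: if_cong)
  moreover obtain C where "\<forall>T\<in>\<T>. \<bar>T (geometric_series c \<beta>)\<bar> \<le> C"
    using pointwise[OF schwartz_geometric_series[where c = c, OF c fam]] by blast
  ultimately show False using J S by (metis not_less)
qed


section \<open>The space of square-integrable functions\<close>

lemma L2_D:
  assumes "f \<in> L2"
  shows "f \<in> borel_measurable borel" "integrable lborel (\<lambda>s. (f s)\<^sup>2)"
  using assms by (auto simp: L2_def)

lemma L2_I: "f \<in> borel_measurable borel \<Longrightarrow> integrable lborel (\<lambda>s. (f s)\<^sup>2) \<Longrightarrow> f \<in> L2"
  by (auto simp: L2_def)

lemma L2_integrable_mult:
  assumes "f \<in> L2" "g \<in> L2"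
  shows "integrable lborel (\<lambda>s. f s * g s)"
proof (rule Bochner_Integration.integrable_bound)
  show "integrable lborel (\<lambda>s. (f s)\<^sup>2 + (g s)\<^sup>2)" using assms by (simp add: L2_D)
  show "(\<lambda>s. f s * g s) \<in> borel_measurable lborel"
    using assms[THEN L2_D(1)] by measurable
  show "AE s in lborel. norm (f s * g s) \<le> norm ((f s)\<^sup>2 + (g s)\<^sup>2)"
  proof (rule AE_I2)
    fix s
    have "2 * (\<bar>f s\<bar> * \<bar>g s\<bar>) \<le> (f s)\<^sup>2 + (g s)\<^sup>2"
      using sum_squares_bound[of "\<bar>f s\<bar>" "\<bar>g s\<bar>"] by simp
    moreover have "0 \<le> \<bar>f s\<bar> * \<bar>g s\<bar>" by simp
    ultimately show "norm (f s * g s) \<le> norm ((f s)\<^sup>2 + (g s)\<^sup>2)"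
      unfolding real_norm_def abs_mult by linarith
  qed
qed

lemma L2_square_lincomb:
  assumes "f \<in> L2" "g \<in> L2"
  shows "integrable lborel (\<lambda>s. (a * f s + b * g s)\<^sup>2)"
    and "(LINT s|lborel. (a * f s + b * g s)\<^sup>2) =
      a\<^sup>2 * (LINT s|lborel. (f s)\<^sup>2) + 2 * a * b * (LINT s|lborel. f s * g s) + b\<^sup>2 * (LINT s|lborel. (g s)\<^sup>2)"
proof -
  have eq: "(a * f s + b * g s)\<^sup>2 = a\<^sup>2 * (f s)\<^sup>2 + 2 * a * b * (f s * g s) + b\<^sup>2 * (g s)\<^sup>2" for s
    by (simp add: power2_eq_square algebra_simps)
  note int = L2_D(2)[OF assms(1)] L2_D(2)[OF assms(2)] L2_integrable_mult[OF assms]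
  show "integrable lborel (\<lambda>s. (a * f s + b * g s)\<^sup>2)"
    unfolding eq using int by simp
  show "(LINT s|lborel. (a * f s + b * g s)\<^sup>2) =
      a\<^sup>2 * (LINT s|lborel. (f s)\<^sup>2) + 2 * a * b * (LINT s|lborel. f s * g s) + b\<^sup>2 * (LINT s|lborel. (g s)\<^sup>2)"
    unfolding eq using int by simp
qed

lemma L2_lincomb:
  assumes "f \<in> L2" "g \<in> L2"
  shows "(\<lambda>s. a * f s + b * g s) \<in> L2"
proof (rule L2_I)
  have [measurable]: "f \<in> borel_measurable borel" "g \<in> borel_measurable borel"
    using assms by (auto intro: L2_D)
  show "(\<lambda>s. a * f s + b * g s) \<in> borel_measurable borel" by measurable
qed (rule L2_square_lincomb(1)[OF assms])

lemma schwartz_L2: "schwartz f \<Longrightarrow> f \<in> L2"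
  using schwartz_integrable_mult[of f f] schwartz_measurable[of f]
  by (auto intro: L2_I simp: power2_eq_square)

text \<open>Near t = 0 a quadratic term cannot compensate a linear one of the wrong sign. In the
  choice of t, the number 1 + \<bar>B\<bar> replaces \<open>B\<close> by a larger coefficient that
  is positive whatever the sign of \<open>B\<close>.\<close>

lemma linear_nonneg_imp_0:
  fixes A B :: real
  assumes "\<And>t. 0 \<le> 2 * t * A + t\<^sup>2 * B"
  shows "A = 0"
proof (rule ccontr)
  assume "A \<noteq> 0"
  have B: "B < 1 + \<bar>B\<bar>" by simp
  define t where "t = - A / (1 + \<bar>B\<bar>)"
  have "2 * t * A + t\<^sup>2 * B \<le> 2 * t * A + t\<^sup>2 * (1 + \<bar>B\<bar>)"
    using B by (intro add_left_mono mult_left_mono) auto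
  also have "\<dots> = - A\<^sup>2 / (1 + \<bar>B\<bar>)"
  proof -
    have "1 + \<bar>B\<bar> \<noteq> 0" by linarith
    then have "t * (1 + \<bar>B\<bar>) = - A" by (simp add: t_def)
    then have "t\<^sup>2 * (1 + \<bar>B\<bar>) = - (t * A)" by (simp add: power2_eq_square mult.assoc)
    then have "2 * t * A + t\<^sup>2 * (1 + \<bar>B\<bar>) = t * A" by simp
    then show ?thesis by (simp add: t_def power2_eq_square)
  qed
  also have "\<dots> < 0" using \<open>A \<noteq> 0\<close> by (simp add: divide_neg_pos add_pos_nonneg)
  finally show False using assms[of t] by simp
qed

lemma L2_Cauchy_Schwarz:
  assumes "f \<in> L2" "g \<in> L2"
  shows "\<bar>LINT s|lborel. f s * g s\<bar> \<le> L2_norm f * L2_norm g"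
proof -
  define A B I where "A = (LINT s|lborel. (f s)\<^sup>2)" and "B = (LINT s|lborel. (g s)\<^sup>2)"
    and "I = (LINT s|lborel. f s * g s)"
  have nonneg: "0 \<le> a\<^sup>2 * A + 2 * a * b * I + b\<^sup>2 * B" for a b
    unfolding A_def B_def I_def L2_square_lincomb(2)[OF assms, symmetric] by simp
  have AB: "A \<ge> 0" "B \<ge> 0" by (simp_all add: A_def B_def)
  have "I\<^sup>2 \<le> A * B"
  proof (cases "B = 0")
    case True
    have "I = 0"
      by (rule linear_nonneg_imp_0[of I A]) (use nonneg[of _ 1] True in \<open>simp add: algebra_simps\<close>)
    then show ?thesis using True by simp
  next
    case False
    \<comment> \<open>The minimizing direction of the quadratic form, cleared of denominators: a = B
      and b = -I.\<close>
    have "0 \<le> B * (A * B - I\<^sup>2)"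
      using nonneg[of B "- I"] by (simp add: power2_eq_square algebra_simps)
    then show ?thesis using False AB by (simp add: zero_le_mult_iff)
  qed
  then have "sqrt (I\<^sup>2) \<le> sqrt (A * B)" by (rule real_sqrt_le_mono)
  then show ?thesis by (simp add: L2_norm_def A_def B_def I_def real_sqrt_mult)
qed

lemma L2_norm_square: "(L2_norm f)\<^sup>2 = (LINT s|lborel. (f s)\<^sup>2)"
  by (simp add: L2_norm_def)

lemma L2_norm_nonneg: "L2_norm f \<ge> 0"
  by (simp add: L2_norm_def)

section \<open>Completeness of L2 and representation of bounded functionals\<close>

text \<open>The rate 4^(-n) for squared distances leaves room for a weight 2^n, under which the
  squared increments still have a finite sum of integrals. This gives convergence almost everywhere
  of the sequence itself, and Fatou's lemma hands the rate on to the limit.\<close>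

lemma L2_complete:
  assumes f: "\<And>n. f n \<in> L2"
    and cauchy: "\<And>m n. n \<le> m \<Longrightarrow> (LINT s|lborel. (f m s - f n s)\<^sup>2) \<le> (1/4) ^ n"
  obtains g where "g \<in> L2" "\<And>n. (LINT s|lborel. (f n s - g s)\<^sup>2) \<le> (1/4) ^ n"
proof -
  have [measurable]: "f n \<in> borel_measurable borel" for n using f by (rule L2_D)
  have int: "integrable lborel (\<lambda>s. (f m s - f n s)\<^sup>2)" for m n
    using L2_square_lincomb(1)[OF f[of m] f[of n], of 1 "-1"] by simp
  have nn: "(\<integral>\<^sup>+s. ennreal ((f m s - f n s)\<^sup>2) \<partial>lborel) \<le> ennreal ((1/4) ^ n)" if "n \<le> m" for m n
    using cauchy[OF that] by (subst nn_integral_eq_integral[OF int]) (auto intro: ennreal_leI)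
  let ?w = "\<lambda>n s. 2 ^ n * (f (Suc n) s - f n s)\<^sup>2"
  have "(\<integral>\<^sup>+s. (\<Sum>n. ennreal (?w n s)) \<partial>lborel) = (\<Sum>n. \<integral>\<^sup>+s. ennreal (?w n s) \<partial>lborel)"
    by (rule nn_integral_suminf) measurable
  also have "\<dots> \<le> (\<Sum>n. ennreal ((1/2) ^ n))"
  proof (intro suminf_le summableI)
    fix n
    have "(\<integral>\<^sup>+s. ennreal (?w n s) \<partial>lborel)
        = ennreal (2 ^ n) * (\<integral>\<^sup>+s. ennreal ((f (Suc n) s - f n s)\<^sup>2) \<partial>lborel)"
      by (subst nn_integral_cmult[symmetric]) (auto simp: ennreal_mult)
    also have "\<dots> \<le> ennreal (2 ^ n) * ennreal ((1/4) ^ n)"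
      by (intro mult_left_mono nn) auto
    also have "\<dots> = ennreal ((1/2) ^ n)"
      by (simp add: ennreal_mult[symmetric] power_mult_distrib[symmetric])
    finally show "(\<integral>\<^sup>+s. ennreal (?w n s) \<partial>lborel) \<le> ennreal ((1/2) ^ n)" .
  qed
  also have "\<dots> = ennreal (\<Sum>n. (1/2) ^ n)"
    by (intro suminf_ennreal2 summable_geometric) auto
  also have "\<dots> < \<infinity>" by simp
  finally have "AE s in lborel. (\<Sum>n. ennreal (?w n s)) \<noteq> \<infinity>"
    by (intro nn_integral_noteq_infinite) (auto simp: less_top)
  then have conv: "AE s in lborel. (\<lambda>n. f n s) \<longlonglongrightarrow> lim (\<lambda>n. f n s)"
  proof eventually_elim
    fix s assume "(\<Sum>n. ennreal (?w n s)) \<noteq> \<infinity>"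
    then have w: "summable (\<lambda>n. ?w n s)" by (intro summable_suminf_not_top) auto
    have "summable (\<lambda>n. f (Suc n) s - f n s)"
    proof (rule summable_comparison_test')
      show "summable (\<lambda>n. ?w n s + (1/2) ^ n)"
        by (intro summable_add w summable_geometric) simp
      show "norm (f (Suc n) s - f n s) \<le> ?w n s + (1/2) ^ n" for n
      proof -
        \<comment> \<open>The square encodes 2 x \<le> 2^n x^2 + 2^(-n), which turns weighted
          summability of the squares into absolute summability of the increments.\<close>
        have "0 \<le> (1/2) ^ n * (2 ^ n * \<bar>f (Suc n) s - f n s\<bar> - 1)\<^sup>2" by simp
        also have "\<dots> = ?w n s + (1/2) ^ n - 2 * \<bar>f (Suc n) s - f n s\<bar>"
          by (simp add: power2_eq_square field_simps power_one_over)
        finally show ?thesis by (simp add: abs_if split: if_splits)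
      qed
    qed
    then have "(\<lambda>n. \<Sum>i<n. f (Suc i) s - f i s) \<longlonglongrightarrow> (\<Sum>i. f (Suc i) s - f i s)"
      by (rule summable_LIMSEQ)
    from tendsto_add[OF this tendsto_const[of "f 0 s"]]
    have "(\<lambda>n. f n s) \<longlonglongrightarrow> (\<Sum>i. f (Suc i) s - f i s) + f 0 s"
      by (simp add: sum_lessThan_telescope[of "\<lambda>n. f n s"])
    then show "(\<lambda>n. f n s) \<longlonglongrightarrow> lim (\<lambda>n. f n s)"
      by (simp add: limI)
  qed
  \<comment> \<open>Where the sequence diverges \<open>lim\<close> is an unspecified value; this
    happens on a null set and does not affect the integrals.\<close>
  define g where "g s = lim (\<lambda>n. f n s)" for s
  have [measurable]: "g \<in> borel_measurable borel" unfolding g_def by measurable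
  have le: "(\<integral>\<^sup>+s. ennreal ((f n s - g s)\<^sup>2) \<partial>lborel) \<le> ennreal ((1/4) ^ n)" for n
  proof -
    have "(\<integral>\<^sup>+s. ennreal ((f n s - g s)\<^sup>2) \<partial>lborel)
        = (\<integral>\<^sup>+s. liminf (\<lambda>m. ennreal ((f m s - f n s)\<^sup>2)) \<partial>lborel)"
    proof (rule nn_integral_cong_AE)
      show "AE s in lborel. ennreal ((f n s - g s)\<^sup>2) = liminf (\<lambda>m. ennreal ((f m s - f n s)\<^sup>2))"
        using conv
      proof eventually_elim
        fix s assume "(\<lambda>n. f n s) \<longlonglongrightarrow> lim (\<lambda>n. f n s)"
        then have "(\<lambda>m. ennreal ((f m s - f n s)\<^sup>2)) \<longlonglongrightarrow> ennreal ((g s - f n s)\<^sup>2)"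
          unfolding g_def by (intro tendsto_intros)
        from lim_imp_Liminf[OF sequentially_bot this]
        show "ennreal ((f n s - g s)\<^sup>2) = liminf (\<lambda>m. ennreal ((f m s - f n s)\<^sup>2))"
          by (simp only: power2_commute[of "f n s" "g s"])
      qed
    qed
    also have "\<dots> \<le> liminf (\<lambda>m. \<integral>\<^sup>+s. ennreal ((f m s - f n s)\<^sup>2) \<partial>lborel)"
      by (rule nn_integral_liminf) measurable
    also have "\<dots> \<le> limsup (\<lambda>m. \<integral>\<^sup>+s. ennreal ((f m s - f n s)\<^sup>2) \<partial>lborel)"
      by (rule Liminf_le_Limsup) simp
    also have "\<dots> \<le> ennreal ((1/4) ^ n)"
      by (intro Limsup_bounded eventually_mono[OF eventually_ge_at_top[of n]] nn)
    finally show ?thesis .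
  qed
  have int_g: "integrable lborel (\<lambda>s. (f n s - g s)\<^sup>2)" for n
    using le[of n] by (intro integrableI_bounded) (auto simp: le_less_trans ennreal_less_top)
  have bound: "(LINT s|lborel. (f n s - g s)\<^sup>2) \<le> (1/4) ^ n" for n
    using le[of n] unfolding nn_integral_eq_integral[OF int_g AE_I2[OF zero_le_power2]]
    by (simp add: ennreal_le_iff)
  have "(\<lambda>s. f 0 s - g s) \<in> L2" using int_g by (intro L2_I) measurable
  from L2_lincomb[OF f[of 0] this, of 1 "-1"] have "g \<in> L2" by simp
  then show ?thesis using bound by (rule that)
qed

text \<open>Variational argument: the functional \<open>J\<close> is bounded below by -C^2 on
  Schwartz functions, a minimizing sequence is Cauchy by the parallelogram law, and the first
  variation at its \<open>L2\<close> limit is the representation. Since \<open>T\<close> is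
  controlled on Schwartz functions only, the sequence stays there and just its limit leaves.\<close>

theorem schwartz_Riesz_representation:
  assumes lin: "\<And>f g a b. schwartz f \<Longrightarrow> schwartz g \<Longrightarrow> T (\<lambda>s. a * f s + b * g s) = a * T f + b * T g"
    and bound: "\<And>f. schwartz f \<Longrightarrow> \<bar>T f\<bar> \<le> C * L2_norm f"
    and "C \<ge> 0"
  obtains f where "f \<in> L2" "represents f T" "L2_norm f \<le> C"
proof -
  let ?S = "Collect schwartz"
  define J where "J f = (LINT s|lborel. (f s)\<^sup>2) - 2 * T f" for f
  have J_ge: "- C\<^sup>2 \<le> J f" if "schwartz f" for f
  proof -
    have "0 \<le> (L2_norm f - C)\<^sup>2" by simp
    also have "\<dots> = (LINT s|lborel. (f s)\<^sup>2) - 2 * (C * L2_norm f) + C\<^sup>2"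
      by (simp add: power2_diff L2_norm_square)
    also have "\<dots> \<le> J f + C\<^sup>2" using bound[OF that] by (simp add: J_def)
    finally show ?thesis by simp
  qed
  define d where "d = (INF f\<in>?S. J f)"
  have bdd: "bdd_below (J ` ?S)" using J_ge by (intro bdd_belowI[of _ "- C\<^sup>2"]) auto
  have d_le: "d \<le> J f" if "schwartz f" for f
    unfolding d_def using bdd that by (intro cINF_lower) auto
  \<comment> \<open>Four times this slack is 4^(-n), the rate that \<open>L2_complete\<close> asks
    for.\<close>
  have "\<exists>f. schwartz f \<and> J f < d + (1/4) ^ n / 4" for n :: nat
  proof -
    have "(INF f\<in>?S. J f) < d + (1/4) ^ n / 4" by (simp add: d_def)
    moreover have "?S \<noteq> {}" using schwartz_zero by blast
    ultimately show ?thesis using bdd by (subst (asm) cINF_less_iff) auto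
  qed
  then obtain F where F: "\<And>n. schwartz (F n)" and JF: "\<And>n. J (F n) < d + (1/4) ^ n / 4"
    by metis
  have F2: "F n \<in> L2" for n using F by (rule schwartz_L2)
  have J_lincomb: "J (\<lambda>s. a * f s + b * g s) = a\<^sup>2 * (LINT s|lborel. (f s)\<^sup>2)
      + 2 * a * b * (LINT s|lborel. f s * g s) + b\<^sup>2 * (LINT s|lborel. (g s)\<^sup>2) - 2 * (a * T f + b * T g)"
    if "schwartz f" "schwartz g" for f g a b
    unfolding J_def using that by (simp add: lin L2_square_lincomb(2) schwartz_L2)
  have "(LINT s|lborel. (F m s - F n s)\<^sup>2) \<le> (1/4) ^ n" if "n \<le> m" for m n
  proof -
    \<comment> \<open>The midpoint of the parallelogram law: \<open>J G\<close> is at least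
      \<open>d\<close>, so two nearly minimizing functions must be close.\<close>
    define G where "G = (\<lambda>s. 1/2 * F m s + 1/2 * F n s)"
    have "schwartz G" unfolding G_def by (intro schwartz_lincomb F)
    have "(LINT s|lborel. (F m s - F n s)\<^sup>2) = (LINT s|lborel. (1 * F m s + (-1) * F n s)\<^sup>2)" by simp
    also have "\<dots> = 2 * J (F m) + 2 * J (F n) - 4 * J G"
      unfolding G_def L2_square_lincomb(2)[OF F2 F2] J_lincomb[OF F F]
      by (simp add: J_def power2_eq_square field_simps)
    also have "\<dots> \<le> 2 * (d + (1/4) ^ m / 4) + 2 * (d + (1/4) ^ n / 4) - 4 * d"
      using JF[of m] JF[of n] d_le[OF \<open>schwartz G\<close>]
      by (intro diff_mono add_mono mult_left_mono) auto
    also have "(1/4::real) ^ m \<le> (1/4) ^ n" using that by (intro power_decreasing) auto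
    finally show ?thesis by simp
  qed
  from L2_complete[OF F2 this] obtain f where f: "f \<in> L2"
    and lim: "\<And>n. (LINT s|lborel. (F n s - f s)\<^sup>2) \<le> (1/4) ^ n" by blast
  have diff: "(\<lambda>s. F n s - f s) \<in> L2" for n
    using L2_lincomb[OF F2[of n] f, of 1 "-1"] by simp
  have norm0: "(\<lambda>n. L2_norm (\<lambda>s. F n s - f s)) \<longlonglongrightarrow> 0"
  proof (rule tendsto_sandwich[OF always_eventually always_eventually tendsto_const])
    show "\<forall>n. 0 \<le> L2_norm (\<lambda>s. F n s - f s)" by (simp add: L2_norm_nonneg)
    show "\<forall>n. L2_norm (\<lambda>s. F n s - f s) \<le> (1/2) ^ n"
    proof
      fix n
      have "sqrt ((1/4) ^ n) = (1/2) ^ n"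
        by (rule real_sqrt_unique) (simp_all add: power2_eq_square power_mult_distrib[symmetric])
      then show "L2_norm (\<lambda>s. F n s - f s) \<le> (1/2) ^ n"
        unfolding L2_norm_def using real_sqrt_le_mono[OF lim[of n]] by simp
    qed
    show "(\<lambda>n. (1/2::real) ^ n) \<longlonglongrightarrow> 0" by (rule LIMSEQ_realpow_zero) auto
  qed
  have weak: "(\<lambda>n. LINT s|lborel. F n s * g s) \<longlonglongrightarrow> (LINT s|lborel. f s * g s)" if g: "g \<in> L2" for g
  proof -
    have "(\<lambda>n. LINT s|lborel. (F n s - f s) * g s) \<longlonglongrightarrow> 0"
    proof (rule Lim_null_comparison[OF always_eventually])
      show "\<forall>n. norm (LINT s|lborel. (F n s - f s) * g s) \<le> L2_norm (\<lambda>s. F n s - f s) * L2_norm g"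
        using L2_Cauchy_Schwarz[OF diff g] by simp
      show "(\<lambda>n. L2_norm (\<lambda>s. F n s - f s) * L2_norm g) \<longlonglongrightarrow> 0"
        using tendsto_mult_right[OF norm0, of "L2_norm g"] by simp
    qed
    moreover have "(LINT s|lborel. (F n s - f s) * g s) = (LINT s|lborel. F n s * g s) - (LINT s|lborel. f s * g s)" for n
      using L2_integrable_mult[OF F2[of n] g] L2_integrable_mult[OF f g] by (simp add: left_diff_distrib)
    ultimately show ?thesis by (simp add: LIM_zero_iff)
  qed
  have repr: "T \<phi> = (LINT s|lborel. f s * \<phi> s)" if \<phi>: "schwartz \<phi>" for \<phi>
  proof -
    define B where "B = (LINT s|lborel. (\<phi> s)\<^sup>2)"
    \<comment> \<open>First variation: \<open>J\<close> at F n + t \<phi> is at least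
      \<open>d\<close>, while \<open>J (F n)\<close> exceeds \<open>d\<close> by less than the
      slack, which disappears in the limit.\<close>
    have "0 \<le> 2 * t * ((LINT s|lborel. f s * \<phi> s) - T \<phi>) + t\<^sup>2 * B" for t
    proof (rule LIMSEQ_le_const)
      have "(\<lambda>n. 2 * t * ((LINT s|lborel. F n s * \<phi> s) - T \<phi>) + t\<^sup>2 * B + (1/4) ^ n / 4)
          \<longlonglongrightarrow> 2 * t * ((LINT s|lborel. f s * \<phi> s) - T \<phi>) + t\<^sup>2 * B + 0 / 4"
        by (intro tendsto_intros weak schwartz_L2 \<phi> LIMSEQ_realpow_zero) auto
      then show "(\<lambda>n. 2 * t * ((LINT s|lborel. F n s * \<phi> s) - T \<phi>) + t\<^sup>2 * B + (1/4) ^ n / 4)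
          \<longlonglongrightarrow> 2 * t * ((LINT s|lborel. f s * \<phi> s) - T \<phi>) + t\<^sup>2 * B" by simp
      have "0 \<le> 2 * t * ((LINT s|lborel. F n s * \<phi> s) - T \<phi>) + t\<^sup>2 * B + (1/4) ^ n / 4" for n
      proof -
        have "d \<le> J (\<lambda>s. 1 * F n s + t * \<phi> s)" by (intro d_le schwartz_lincomb F \<phi>)
        also have "\<dots> = J (F n) + 2 * t * ((LINT s|lborel. F n s * \<phi> s) - T \<phi>) + t\<^sup>2 * B"
          unfolding J_lincomb[OF F \<phi>] by (simp add: J_def B_def algebra_simps)
        finally show ?thesis using JF[of n] by linarith
      qed
      then show "\<exists>N. \<forall>n\<ge>N. 0 \<le> 2 * t * ((LINT s|lborel. F n s * \<phi> s) - T \<phi>) + t\<^sup>2 * B + (1/4) ^ n / 4"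
        by blast
    qed
    then have "(LINT s|lborel. f s * \<phi> s) - T \<phi> = 0" by (rule linear_nonneg_imp_0)
    then show ?thesis by simp
  qed
  \<comment> \<open>The bound on \<open>T\<close> is applied to \<open>F n\<close> and carried over
    to \<open>f\<close>. This takes convergence of the norms in addition to that of the pairings,
    and ends in a bound of the squared norm of \<open>f\<close> by C times its norm.\<close>
  have "(\<lambda>n. L2_norm (F n)) \<longlonglongrightarrow> L2_norm f"
  proof -
    have "(LINT s|lborel. (F n s)\<^sup>2) = (L2_norm (\<lambda>s. F n s - f s))\<^sup>2
        + 2 * (LINT s|lborel. F n s * f s) - (LINT s|lborel. (f s)\<^sup>2)" for n
      using L2_square_lincomb(2)[OF F2[of n] f, of 1 "-1"] by (simp add: L2_norm_square)
    moreover have "(\<lambda>n. (L2_norm (\<lambda>s. F n s - f s))\<^sup>2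
        + 2 * (LINT s|lborel. F n s * f s) - (LINT s|lborel. (f s)\<^sup>2))
      \<longlonglongrightarrow> 0\<^sup>2 + 2 * (LINT s|lborel. f s * f s) - (LINT s|lborel. (f s)\<^sup>2)"
      by (intro tendsto_intros norm0 weak f)
    ultimately have "(\<lambda>n. LINT s|lborel. (F n s)\<^sup>2) \<longlonglongrightarrow> (LINT s|lborel. (f s)\<^sup>2)"
      by (simp add: power2_eq_square)
    then show ?thesis unfolding L2_norm_def by (rule tendsto_real_sqrt)
  qed
  then have "(\<lambda>n. C * L2_norm (F n)) \<longlonglongrightarrow> C * L2_norm f" by (intro tendsto_mult tendsto_const)
  moreover have "(\<lambda>n. LINT s|lborel. F n s * f s) \<longlonglongrightarrow> (LINT s|lborel. f s * f s)"
    by (rule weak[OF f])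
  moreover have "(LINT s|lborel. F n s * f s) \<le> C * L2_norm (F n)" for n
    using bound[OF F[of n]] repr[OF F[of n]] by (simp add: mult.commute)
  ultimately have "(LINT s|lborel. f s * f s) \<le> C * L2_norm f"
    by (intro LIMSEQ_le) auto
  then have "L2_norm f * L2_norm f \<le> C * L2_norm f"
    using L2_norm_square[of f] by (simp add: power2_eq_square)
  then have "L2_norm f \<le> C"
    using L2_norm_nonneg[of f] \<open>C \<ge> 0\<close> by (cases "L2_norm f = 0") (auto simp: mult_le_cancel_right)
  moreover have "represents f T" using repr by (simp add: represents_def)
  ultimately show ?thesis using f that by blast
qed


section \<open>Weak solutions of the Airy evolution\<close>

lemma schwartz_seminorm_upper:
  assumes "schwartz f"
  shows "\<bar>s ^ j * (deriv ^^ k) f s\<bar> \<le> schwartz_seminorm j k f"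
proof -
  obtain K where "\<And>s. \<bar>s ^ j * (deriv ^^ k) f s\<bar> \<le> K" using schwartz_bound[OF assms] by blast
  then have "bdd_above (range (\<lambda>s. \<bar>s ^ j * (deriv ^^ k) f s\<bar>))" by (intro bdd_aboveI[of _ K]) auto
  then show ?thesis unfolding schwartz_seminorm_def by (rule cSUP_upper[OF UNIV_I])
qed

lemma lorentz_L2: "(\<lambda>s::real. 1 / (1 + s\<^sup>2)) \<in> L2"
proof (rule L2_I)
  show "integrable lborel (\<lambda>s::real. (1 / (1 + s\<^sup>2))\<^sup>2)"
  proof (rule integrable_lorentz_bound[where K = 1])
    fix s :: real
    have "1 \<le> 1 + s\<^sup>2" and "0 < 1 + s\<^sup>2" by (simp_all add: add_pos_nonneg)
    then have "1 / (1 + s\<^sup>2) * (1 / (1 + s\<^sup>2)) \<le> 1 * (1 / (1 + s\<^sup>2))"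
      by (intro mult_right_mono) (auto simp: divide_le_eq_1)
    then show "\<bar>(1 / (1 + s\<^sup>2))\<^sup>2\<bar> \<le> 1 / (1 + s\<^sup>2)" by (simp add: power2_eq_square)
  qed measurable
qed measurable

text \<open>The embedding of the Schwartz space into \<open>L2\<close> is continuous: the seminorms
  with weights 0 and 2 dominate f by a multiple of 1/(1 + s^2).\<close>

lemma schwartz_L2_norm_le:
  assumes "schwartz f"
  shows "L2_norm f \<le> (schwartz_seminorm 0 0 f + schwartz_seminorm 2 0 f) * L2_norm (\<lambda>s. 1 / (1 + s\<^sup>2))"
proof -
  define P where "P = schwartz_seminorm 0 0 f + schwartz_seminorm 2 0 f"
  have bound: "\<bar>f s\<bar> \<le> P * (1 / (1 + s\<^sup>2))" for s
  proof -
    have "\<bar>f s\<bar> * (1 + s\<^sup>2) \<le> P"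
      using schwartz_seminorm_upper[OF assms, of s 0 0] schwartz_seminorm_upper[OF assms, of s 2 0]
      by (simp add: P_def abs_mult algebra_simps)
    moreover have "1 + s\<^sup>2 > 0" by (simp add: add_pos_nonneg)
    ultimately show ?thesis by (simp add: pos_le_divide_eq)
  qed
  have "P \<ge> 0" using order_trans[OF abs_ge_zero bound[of 0]] by simp
  have "(LINT s|lborel. (f s)\<^sup>2) \<le> (LINT s|lborel. P\<^sup>2 * (1 / (1 + s\<^sup>2))\<^sup>2)"
  proof (rule integral_mono)
    show "integrable lborel (\<lambda>s. (f s)\<^sup>2)" using schwartz_L2[OF assms] by (rule L2_D)
    show "integrable lborel (\<lambda>s. P\<^sup>2 * (1 / (1 + s\<^sup>2))\<^sup>2)"
      using L2_D(2)[OF lorentz_L2] by (rule integrable_mult_right)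
    show "(f s)\<^sup>2 \<le> P\<^sup>2 * (1 / (1 + s\<^sup>2))\<^sup>2" for s
      using power_mono[OF bound[of s] abs_ge_zero, of 2] by (simp only: power2_abs power_mult_distrib)
  qed
  also have "\<dots> = P\<^sup>2 * (L2_norm (\<lambda>s. 1 / (1 + s\<^sup>2)))\<^sup>2" by (simp add: L2_norm_square)
  finally have "L2_norm f \<le> sqrt (P\<^sup>2 * (L2_norm (\<lambda>s. 1 / (1 + s\<^sup>2)))\<^sup>2)"
    unfolding L2_norm_def[of f] by (rule real_sqrt_le_mono)
  also have "\<dots> = P * L2_norm (\<lambda>s. 1 / (1 + s\<^sup>2))"
    using \<open>P \<ge> 0\<close> L2_norm_nonneg by (simp add: real_sqrt_mult)
  finally show ?thesis by (simp only: P_def)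
qed

section \<open>The dual flow on L2 data\<close>

lemma L2_norm_airy_flow: "schwartz f \<Longrightarrow> L2_norm (airy_flow a b t f) = L2_norm f"
  by (simp add: L2_norm_def airy_flow_L2_isometry)

lemma dual_airy_flow_bound:
  assumes "g \<in> L2" "schwartz f"
  shows "\<bar>LINT s|lborel. g s * airy_flow a b t f s\<bar> \<le> L2_norm g * L2_norm f"
  using L2_Cauchy_Schwarz[OF assms(1) schwartz_L2[OF schwartz_airy_flow[OF assms(2)]]]
  by (simp add: L2_norm_airy_flow[OF assms(2)])

text \<open>By the isometry, continuity reduces to \<open>L2\<close> convergence of the unevolved
  test functions, which Schwartz convergence provides.\<close>

lemma tempered_dual_airy_flow:
  assumes g: "g \<in> L2"
  shows "tempered_distribution (\<lambda>\<phi>. LINT s|lborel. g s * airy_flow a b t \<phi> s)" (is "tempered_distribution ?T")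
proof -
  have int: "integrable lborel (\<lambda>s. g s * airy_flow a b t \<phi> s)" if "schwartz \<phi>" for \<phi>
    by (intro L2_integrable_mult g schwartz_L2 schwartz_airy_flow that)
  have lin: "?T (\<lambda>s. c * \<phi> s + d * \<psi> s) = c * ?T \<phi> + d * ?T \<psi>" if "schwartz \<phi>" "schwartz \<psi>" for \<phi> \<psi> c d
  proof -
    have "?T (\<lambda>s. c * \<phi> s + d * \<psi> s)
        = (LINT s|lborel. c * (g s * airy_flow a b t \<phi> s) + d * (g s * airy_flow a b t \<psi> s))"
      unfolding airy_flow_lincomb[OF that] by (simp add: algebra_simps)
    also have "\<dots> = c * ?T \<phi> + d * ?T \<psi>" using int that by simp
    finally show ?thesis .
  qed
  have "(\<lambda>n. ?T (\<Phi> n)) \<longlonglongrightarrow> ?T \<phi>"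
    if \<Phi>: "\<And>n. schwartz (\<Phi> n)" and \<phi>: "schwartz \<phi>" and conv: "schwartz_converges \<Phi> \<phi>" for \<Phi> \<phi>
  proof -
    let ?p = "\<lambda>j n. schwartz_seminorm j 0 (\<lambda>s. \<Phi> n s - \<phi> s)"
    let ?N = "L2_norm (\<lambda>s. 1 / (1 + s\<^sup>2))"
    have "(\<lambda>n. ?T (\<Phi> n) - ?T \<phi>) \<longlonglongrightarrow> 0"
    proof (rule Lim_null_comparison[OF always_eventually])
      show "\<forall>n. norm (?T (\<Phi> n) - ?T \<phi>) \<le> L2_norm g * ((?p 0 n + ?p 2 n) * ?N)"
      proof
        fix n
        have s: "schwartz (\<lambda>s. \<Phi> n s - \<phi> s)" using \<Phi> \<phi> by (rule schwartz_diff)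
        have "?T (\<Phi> n) - ?T \<phi> = ?T (\<lambda>s. \<Phi> n s - \<phi> s)"
          using lin[OF \<Phi>[of n] \<phi>, of 1 "-1"] by simp
        then have "norm (?T (\<Phi> n) - ?T \<phi>) \<le> L2_norm g * L2_norm (\<lambda>s. \<Phi> n s - \<phi> s)"
          using dual_airy_flow_bound[OF g s] by simp
        also have "\<dots> \<le> L2_norm g * ((?p 0 n + ?p 2 n) * ?N)"
          by (intro mult_left_mono schwartz_L2_norm_le s L2_norm_nonneg)
        finally show "norm (?T (\<Phi> n) - ?T \<phi>) \<le> L2_norm g * ((?p 0 n + ?p 2 n) * ?N)" .
      qed
      have p: "?p j \<longlonglongrightarrow> 0" for j using conv by (simp add: schwartz_converges_def)
      have "(\<lambda>n. L2_norm g * ((?p 0 n + ?p 2 n) * ?N)) \<longlonglongrightarrow> L2_norm g * ((0 + 0) * ?N)"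
        by (intro tendsto_intros p)
      then show "(\<lambda>n. L2_norm g * ((?p 0 n + ?p 2 n) * ?N)) \<longlonglongrightarrow> 0" by simp
    qed
    then show ?thesis by (rule LIM_zero_cancel)
  qed
  then show ?thesis unfolding tempered_distribution_def using lin by blast
qed

text \<open>For bounded times the integrand's derivative is dominated by a multiple of
  \<open>\<bar>g s\<bar>\<close> / (1 + s^2), integrable as a product of two square-integrable
  functions.\<close>

lemma dual_airy_flow_has_deriv:
  assumes g: "g \<in> L2" and f: "schwartz f"
  shows "((\<lambda>t. LINT s|lborel. g s * airy_flow a b t f s) has_real_derivative
    (LINT s|lborel. g s * airy_flow a b t (airy_op a b f) s)) (at t)"
proof -
  obtain K where K: "K \<ge> 0"
    "\<And>r s. \<bar>r\<bar> \<le> \<bar>t\<bar> + 1 \<Longrightarrow> \<bar>airy_flow a b r (airy_op a b f) s\<bar> \<le> K / (1 + s\<^sup>2)"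
    using airy_flow_decay[OF schwartz_airy_op[OF f]] by blast
  show ?thesis
  proof (rule has_real_derivative_integral[where e = 1 and g = "\<lambda>s. K * \<bar>g s * (1 / (1 + s\<^sup>2))\<bar>"])
    show "integrable lborel (\<lambda>s. g s * airy_flow a b r f s)" for r
      by (intro L2_integrable_mult g schwartz_L2 schwartz_airy_flow f)
    show "((\<lambda>r. g s * airy_flow a b r f s) has_real_derivative g s * airy_flow a b r (airy_op a b f) s) (at r)" for r s
      by (intro DERIV_cmult airy_flow_has_deriv_time f)
    show "\<bar>g s * airy_flow a b r (airy_op a b f) s\<bar> \<le> K * \<bar>g s * (1 / (1 + s\<^sup>2))\<bar>" if "\<bar>r - t\<bar> < 1" for r s
    proof -
      have "\<bar>r\<bar> \<le> \<bar>t\<bar> + 1" using that by linarith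
      from mult_left_mono[OF K(2)[OF this, of s] abs_ge_zero, of "g s"] show ?thesis
        by (simp add: abs_mult mult.commute)
    qed
    show "integrable lborel (\<lambda>s. K * \<bar>g s * (1 / (1 + s\<^sup>2))\<bar>)"
      by (intro integrable_mult_right integrable_abs L2_integrable_mult g lorentz_L2)
  qed simp
qed

section \<open>Differentiating a tempered distribution along the flow\<close>

lemma derivative_bound:
  fixes g g' :: "real \<Rightarrow> real"
  assumes "\<And>x. (g has_real_derivative g' x) (at x)" and "\<And>x. \<bar>x\<bar> \<le> R \<Longrightarrow> \<bar>g' x\<bar> \<le> K"
    and "\<bar>r\<bar> \<le> R" "\<bar>t\<bar> \<le> R"
  shows "\<bar>g r - g t\<bar> \<le> K * \<bar>r - t\<bar>"
proof -
  have "norm (g r - g t) \<le> K * norm (r - t)"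
  proof (rule field_differentiable_bound[of "{-R..R}"])
    show "(g has_field_derivative g' z) (at z within {-R..R})" for z
      using assms(1) by (rule has_field_derivative_at_within)
  qed (use assms in auto)
  then show ?thesis by simp
qed

text \<open>The mean value inequality is used twice, for \<open>g'\<close> and then for
  \<open>g\<close> with its slope at t removed; this yields K in place of K/2. Working on the
  segment keeps all points within \<open>R\<close>.\<close>

lemma taylor_remainder_bound:
  fixes g g' g'' :: "real \<Rightarrow> real"
  assumes g: "\<And>x. (g has_real_derivative g' x) (at x)" and g': "\<And>x. (g' has_real_derivative g'' x) (at x)"
    and K: "\<And>x. \<bar>x\<bar> \<le> R \<Longrightarrow> \<bar>g'' x\<bar> \<le> K"
    and r: "\<bar>r\<bar> \<le> R" "\<bar>t\<bar> \<le> R"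
  shows "\<bar>g r - g t - (r - t) * g' t\<bar> \<le> K * (r - t)\<^sup>2"
proof -
  let ?S = "closed_segment r t"
  have S: "\<bar>z\<bar> \<le> R \<and> \<bar>z - t\<bar> \<le> \<bar>r - t\<bar>" if "z \<in> ?S" for z
    using that r by (auto simp: closed_segment_eq_real_ivl abs_le_iff split: if_splits)
  have "K \<ge> 0" using K[OF r(1)] by linarith
  have "norm ((\<lambda>x. g x - x * g' t) r - (\<lambda>x. g x - x * g' t) t) \<le> (K * \<bar>r - t\<bar>) * norm (r - t)"
  proof (rule field_differentiable_bound[of ?S])
    show "((\<lambda>x. g x - x * g' t) has_field_derivative g' z - g' t) (at z within ?S)" for z
      using has_field_derivative_at_within[OF g[of z], of ?S] by (auto intro!: derivative_eq_intros)
    show "norm (g' z - g' t) \<le> K * \<bar>r - t\<bar>" if "z \<in> ?S" for z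
    proof -
      have "\<bar>g' z - g' t\<bar> \<le> K * \<bar>z - t\<bar>"
        using derivative_bound[OF g' K] S[OF that] r by blast
      also have "\<dots> \<le> K * \<bar>r - t\<bar>" using S[OF that] \<open>K \<ge> 0\<close> by (intro mult_left_mono) auto
      finally show ?thesis by simp
    qed
  qed auto
  then show ?thesis by (simp add: power2_eq_square algebra_simps abs_mult[symmetric])
qed

lemma funpow_deriv_airy_op:
  assumes "schwartz f"
  shows "(deriv ^^ k) (airy_op a b f) = airy_op a b ((deriv ^^ k) f)"
proof -
  have "airy_op a b f = (\<lambda>s. a * (deriv ^^ 3) f s + b * (deriv ^^ 1) f s)"
    by (simp add: airy_op_def fun_eq_iff)
  then have "(deriv ^^ k) (airy_op a b f) = (\<lambda>s. a * (deriv ^^ (k + 3)) f s + b * (deriv ^^ (k + 1)) f s)"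
    using funpow_deriv_lincomb[OF schwartz_funpow_deriv[OF assms] schwartz_funpow_deriv[OF assms], of k a 3 b 1]
    by (simp only: funpow_add o_def)
  also have "\<dots> = airy_op a b ((deriv ^^ k) f)"
    unfolding airy_op_def[abs_def] add.commute[of k] funpow_add by simp
  finally show ?thesis .
qed

text \<open>The difference quotients of the flow converge in the Schwartz topology: in every
  seminorm Taylor's formula in time leaves an error of order |r - t|, with a constant from the
  second time derivative U_r B B f. Sequences suffice because temperedness is sequential
  continuity.\<close>

lemma tempered_airy_flow_has_deriv:
  assumes T: "tempered_distribution T" and f: "schwartz f"
  shows "((\<lambda>t. T (airy_flow a b t f)) has_real_derivative T (airy_flow a b t (airy_op a b f))) (at t)"
proof -
  let ?U = "airy_flow a b" and ?B = "airy_op a b"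
  have sU: "schwartz (?U r f)" "schwartz (?U r (?B f))" for r
    by (intro schwartz_airy_flow schwartz_airy_op f)+
  have "((\<lambda>r. (T (?U r f) - T (?U t f)) / (r - t)) \<longlongrightarrow> T (?U t (?B f))) (at t)"
    unfolding tendsto_at_iff_sequentially comp_def
  proof (intro allI impI)
    fix X :: "nat \<Rightarrow> real"
    assume "\<forall>i. X i \<in> UNIV - {t}" and Xt: "X \<longlonglongrightarrow> t"
    then have ne: "X n \<noteq> t" for n by auto
    \<comment> \<open>One \<open>R\<close> bounds t and the whole sequence, so that a single
      constant serves all n.\<close>
    obtain R where R: "\<And>n. \<bar>X n\<bar> \<le> R" "\<bar>t\<bar> \<le> R"
    proof -
      obtain R where "\<forall>n. \<bar>X n\<bar> \<le> R" using convergent_imp_Bseq[OF convergentI[OF Xt]] by (auto simp: Bseq_def)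
      then show ?thesis using that[of "max R \<bar>t\<bar>"] by (simp add: le_max_iff_disj)
    qed
    define F where "F n = (\<lambda>s. 1 / (X n - t) * ?U (X n) f s + (- 1 / (X n - t)) * ?U t f s)" for n
    have sF: "schwartz (F n)" for n unfolding F_def by (intro schwartz_lincomb sU)
    have "schwartz_converges F (?U t (?B f))"
      unfolding schwartz_converges_def
    proof (intro allI)
      fix j k
      let ?h = "(deriv ^^ k) f"
      note h = schwartz_funpow_deriv[OF f, of k]
      obtain K where K: "K \<ge> 0"
        "\<And>r s. \<bar>r\<bar> \<le> R \<Longrightarrow> \<bar>s ^ j * (deriv ^^ 0) (?U r (?B (?B ?h))) s\<bar> \<le> K"
        using airy_flow_seminorm_bounded[OF schwartz_airy_op[OF schwartz_airy_op[OF h]]] by blast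
      have bound: "\<bar>s ^ j * (deriv ^^ k) (\<lambda>s. F n s - ?U t (?B f) s) s\<bar> \<le> K * \<bar>X n - t\<bar>" for n s
      proof -
        have D: "(deriv ^^ k) (\<lambda>s. F n s - ?U t (?B f) s)
            = (\<lambda>s. 1 / (X n - t) * (?U (X n) ?h s) + (- 1 / (X n - t)) * ?U t ?h s - ?U t (?B ?h) s)"
          using funpow_deriv_lincomb[OF sF[of n] sU(2)[of t], of k 1 "-1"]
          unfolding F_def funpow_deriv_lincomb[OF sU(1) sU(1)] funpow_deriv_airy_flow[OF f]
            funpow_deriv_airy_flow[OF schwartz_airy_op[OF f]] funpow_deriv_airy_op[OF f] by simp
        have "\<bar>s ^ j * ?U (X n) ?h s - s ^ j * ?U t ?h s - (X n - t) * (s ^ j * ?U t (?B ?h) s)\<bar> \<le> K * (X n - t)\<^sup>2"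
        proof (rule taylor_remainder_bound[where R = R])
          show "((\<lambda>r. s ^ j * ?U r ?h s) has_real_derivative s ^ j * ?U r (?B ?h) s) (at r)" for r
            by (intro DERIV_cmult airy_flow_has_deriv_time h)
          show "((\<lambda>r. s ^ j * ?U r (?B ?h) s) has_real_derivative s ^ j * ?U r (?B (?B ?h)) s) (at r)" for r
            by (intro DERIV_cmult airy_flow_has_deriv_time schwartz_airy_op h)
        qed (use K R in auto)
        also have "s ^ j * ?U (X n) ?h s - s ^ j * ?U t ?h s - (X n - t) * (s ^ j * ?U t (?B ?h) s)
            = (X n - t) * (s ^ j * (deriv ^^ k) (\<lambda>s. F n s - ?U t (?B f) s) s)"
        proof -
          have "p * u - p * v - d * (p * w) = d * (p * (1 / d * u + (- 1 / d) * v - w))"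
            if "d \<noteq> 0" for p u v w d :: real
          proof -
            have "d * (1 / d * u + (- 1 / d) * v - w) = u - v - d * w"
              using that by (simp add: right_diff_distrib)
            then show ?thesis by (metis (no_types) mult.left_commute right_diff_distrib)
          qed
          from this[of "X n - t"] show ?thesis unfolding D using ne[of n] by simp
        qed
        finally have "\<bar>X n - t\<bar> * \<bar>s ^ j * (deriv ^^ k) (\<lambda>s. F n s - ?U t (?B f) s) s\<bar>
            \<le> \<bar>X n - t\<bar> * (K * \<bar>X n - t\<bar>)"
          by (simp only: abs_mult[symmetric] power2_eq_square) (simp add: abs_mult mult_ac)
        then show ?thesis using ne[of n] by (simp add: mult_le_cancel_left)
      qed
      show "(\<lambda>n. schwartz_seminorm j k (\<lambda>s. F n s - ?U t (?B f) s)) \<longlonglongrightarrow> 0"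
      proof (rule tendsto_sandwich[OF always_eventually always_eventually tendsto_const])
        show "\<forall>n. 0 \<le> schwartz_seminorm j k (\<lambda>s. F n s - ?U t (?B f) s)"
          using schwartz_seminorm_bound(2)[OF bound] by blast
        show "\<forall>n. schwartz_seminorm j k (\<lambda>s. F n s - ?U t (?B f) s) \<le> K * \<bar>X n - t\<bar>"
          using schwartz_seminorm_bound(1)[OF bound] by blast
        have "(\<lambda>n. K * \<bar>X n - t\<bar>) \<longlonglongrightarrow> K * \<bar>t - t\<bar>" by (intro tendsto_intros Xt)
        then show "(\<lambda>n. K * \<bar>X n - t\<bar>) \<longlonglongrightarrow> 0" by simp
      qed
    qed
    then have "(\<lambda>n. T (F n)) \<longlonglongrightarrow> T (?U t (?B f))"
      by (rule tempered_tendsto[OF T sF sU(2)])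
    moreover have "T (F n) = (T (?U (X n) f) - T (?U t f)) / (X n - t)" for n
      unfolding F_def tempered_lincomb[OF T sU(1) sU(1)] by (simp add: diff_divide_distrib)
    ultimately show "(\<lambda>n. (T (?U (X n) f) - T (?U t f)) / (X n - t)) \<longlonglongrightarrow> T (?U t (?B f))" by simp
  qed
  then show ?thesis by (simp add: has_field_derivative_iff)
qed

lemma schwartz_bounded_family_airy_flow:
  assumes "schwartz f"
  shows "schwartz_bounded_family {airy_flow a b t f | t. \<bar>t\<bar> \<le> R}"
  unfolding schwartz_bounded_family_def
proof (intro conjI ballI allI)
  show "schwartz h" if "h \<in> {airy_flow a b t f | t. \<bar>t\<bar> \<le> R}" for h
    using that schwartz_airy_flow[OF assms] by blast
  show "\<exists>M. \<forall>h\<in>{airy_flow a b t f | t. \<bar>t\<bar> \<le> R}. \<forall>s. \<bar>s ^ j * (deriv ^^ k) h s\<bar> \<le> M" for j k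
  proof -
    obtain K where "\<And>t s. \<bar>t\<bar> \<le> R \<Longrightarrow> \<bar>s ^ j * (deriv ^^ k) (airy_flow a b t f) s\<bar> \<le> K"
      using airy_flow_seminorm_bounded[OF assms] by blast
    then show ?thesis by blast
  qed
qed

lemma has_real_derivative_0_if_quadratic:
  fixes E :: "real \<Rightarrow> real"
  assumes "\<forall>\<^sub>F x in nhds r. \<bar>E x\<bar> \<le> C * (x - r)\<^sup>2"
  shows "(E has_real_derivative 0) (at r)"
proof -
  have "\<bar>E r\<bar> \<le> C * (r - r)\<^sup>2" using assms by (rule eventually_nhds_x_imp_x)
  then have Er: "E r = 0" by simp
  have "((\<lambda>x. (E x - E r) / (x - r)) \<longlongrightarrow> 0) (at r)"
  proof (rule Lim_null_comparison)
    have "\<forall>\<^sub>F x in at r. \<bar>E x\<bar> \<le> C * (x - r)\<^sup>2" "\<forall>\<^sub>F x in at r. x \<noteq> r"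
      using assms by (auto simp: eventually_at_filter elim: eventually_mono)
    then show "\<forall>\<^sub>F x in at r. norm ((E x - E r) / (x - r)) \<le> C * \<bar>x - r\<bar>"
    proof eventually_elim
      case (elim x)
      then have "\<bar>x - r\<bar> > 0" by simp
      moreover have "\<bar>E x\<bar> \<le> C * \<bar>x - r\<bar> * \<bar>x - r\<bar>" using elim(1) by (simp add: power2_eq_square mult.assoc)
      ultimately show ?case by (simp add: Er abs_divide pos_divide_le_eq)
    qed
    have "((\<lambda>x. C * \<bar>x - r\<bar>) \<longlongrightarrow> C * \<bar>r - r\<bar>) (at r)" by (intro tendsto_intros)
    then show "((\<lambda>x. C * \<bar>x - r\<bar>) \<longlongrightarrow> 0) (at r)" by simp
  qed
  then show ?thesis by (simp add: has_field_derivative_iff)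
qed


text \<open>The function \<open>H\<close> below interpolates between the two sides: r = t gives the
  left one, r = 0 the right one.\<close>

theorem weak_airy_evolution_unique:
  fixes w :: "real \<Rightarrow> (real \<Rightarrow> real) \<Rightarrow> real"
  assumes tempered: "\<And>t. t \<ge> 0 \<Longrightarrow> tempered_distribution (w t)"
    and deriv: "\<And>t \<phi>. t > 0 \<Longrightarrow> schwartz \<phi> \<Longrightarrow>
      ((\<lambda>r. w r \<phi>) has_real_derivative w t (airy_op a b \<phi>)) (at t)"
    and initial: "\<And>\<phi>. schwartz \<phi> \<Longrightarrow> ((\<lambda>t. w t \<phi>) \<longlongrightarrow> w 0 \<phi>) (at_right 0)"
    and "t > 0" and f: "schwartz f"
  shows "w t f = w 0 (airy_flow a b t f)"
proof -
  let ?U = "airy_flow a b" and ?B = "airy_op a b"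
  \<comment> \<open>One unit beyond \<open>t\<close> makes t an interior point, so that
    \<open>H\<close> is differentiable, hence continuous, there too.\<close>
  define R where "R = t + 1"
  have cont: "continuous_on {0..R} (\<lambda>r. w r \<phi>)" if "schwartz \<phi>" for \<phi>
    unfolding continuous_on_def
  proof
    fix r assume r: "r \<in> {0..R}"
    show "((\<lambda>r. w r \<phi>) \<longlongrightarrow> w r \<phi>) (at r within {0..R})"
    proof (cases "r = 0")
      case True
      have "at 0 within {0..R} \<le> at_right 0"
        unfolding at_within_def by (intro inf_mono order_refl) (auto simp: principal_le_iff)
      then show ?thesis using tendsto_mono[OF _ initial[OF that]] True by simp
    next
      case False
      with r have "isCont (\<lambda>r. w r \<phi>) r" using DERIV_isCont[OF deriv[OF _ that, of r]] by simp
      then show ?thesis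
        using continuous_at_imp_continuous_at_within by (auto simp: continuous_within)
    qed
  qed
  \<comment> \<open>Continuity in r bounds each single test function on the compact interval; as the
    orbit is a bounded family, uniform boundedness gives one constant for both parameters.\<close>
  have bounded: "\<exists>C. \<forall>r s. r \<in> {0..R} \<longrightarrow> \<bar>s\<bar> \<le> R \<longrightarrow> \<bar>w r (?U s h)\<bar> \<le> C" if h: "schwartz h" for h
  proof -
    have "\<exists>C. \<forall>T\<in>w ` {0..R}. \<forall>g\<in>{?U s h | s. \<bar>s\<bar> \<le> R}. \<bar>T g\<bar> \<le> C"
    proof (rule tempered_uniform_boundedness)
      show "tempered_distribution T" if "T \<in> w ` {0..R}" for T
        using that tempered by auto
      show "\<exists>C. \<forall>T\<in>w ` {0..R}. \<bar>T \<phi>\<bar> \<le> C" if "schwartz \<phi>" for \<phi>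
      proof -
        have "bounded ((\<lambda>r. w r \<phi>) ` {0..R})"
          by (intro compact_imp_bounded compact_continuous_image cont that) simp
        then show ?thesis unfolding bounded_iff by auto
      qed
    qed (rule schwartz_bounded_family_airy_flow[OF h])
    then obtain C where C: "\<forall>T\<in>w ` {0..R}. \<forall>g\<in>{?U s h | s. \<bar>s\<bar> \<le> R}. \<bar>T g\<bar> \<le> C" ..
    have "\<bar>w r (?U s h)\<bar> \<le> C" if "r \<in> {0..R}" "\<bar>s\<bar> \<le> R" for r s
      using bspec[OF bspec[OF C imageI[OF that(1)]], of "?U s h"] that(2) by blast
    then show ?thesis by (intro exI[of _ C]) simp
  qed
  note Bf = schwartz_airy_op[OF f] and BBf = schwartz_airy_op[OF schwartz_airy_op[OF f]]
  obtain C1 where C1: "\<And>r s. r \<in> {0..R} \<Longrightarrow> \<bar>s\<bar> \<le> R \<Longrightarrow> \<bar>w r (?U s (?B f))\<bar> \<le> C1"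
    using bounded[OF Bf] by blast
  obtain C2 where C2: "\<And>r s. r \<in> {0..R} \<Longrightarrow> \<bar>s\<bar> \<le> R \<Longrightarrow> \<bar>w r (?U s (?B (?B f)))\<bar> \<le> C2"
    using bounded[OF BBf] by blast
  have flow_deriv: "((\<lambda>s. w r (?U s h)) has_real_derivative w r (?U s (?B h))) (at s)"
    if "r \<ge> 0" "schwartz h" for r s h
    using tempered_airy_flow_has_deriv[OF tempered[OF that(1)] that(2)] .
  define H where "H r = w r (?U (t - r) f)" for r
  have H_deriv: "(H has_real_derivative 0) (at r)" if r: "0 < r" "r < R" for r
  proof -
    define \<psi> where "\<psi> = ?U (t - r) f"
    have \<psi>: "schwartz \<psi>" and B\<psi>: "?B \<psi> = ?U (t - r) (?B f)"
      unfolding \<psi>_def using schwartz_airy_flow[OF f] airy_op_airy_flow[OF f] by auto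
    \<comment> \<open>The second-order error of expanding the moving test function about q = r with
      the distribution \<open>w q\<close> held fixed. What remains of \<open>H\<close> pairs
      \<open>w q\<close> with the fixed functions \<psi> and B \<psi>, and its derivative at r is w
      r (B \<psi>) - w r (B \<psi>) = 0.\<close>
    define E where "E q = H q - w q \<psi> + (q - r) * w q (?B \<psi>)" for q
    have E: "\<bar>E q\<bar> \<le> C2 * (q - r)\<^sup>2" if q: "q \<in> {0<..<R}" for q
    proof -
      have "\<bar>w q (?U (t - q) f) - w q (?U (t - r) f) - ((t - q) - (t - r)) * w q (?U (t - r) (?B f))\<bar>
          \<le> C2 * ((t - q) - (t - r))\<^sup>2"
      proof (rule taylor_remainder_bound[where R = R])
        show "((\<lambda>s. w q (?U s f)) has_real_derivative w q (?U s (?B f))) (at s)" for s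
          using q f by (intro flow_deriv) auto
        show "((\<lambda>s. w q (?U s (?B f))) has_real_derivative w q (?U s (?B (?B f)))) (at s)" for s
          using q Bf by (intro flow_deriv) auto
        show "\<bar>w q (?U s (?B (?B f)))\<bar> \<le> C2" if "\<bar>s\<bar> \<le> R" for s
          using q that by (intro C2) auto
        show "\<bar>t - q\<bar> \<le> R" "\<bar>t - r\<bar> \<le> R" using q r \<open>t > 0\<close> by (auto simp: R_def)
      qed
      then show ?thesis
        unfolding E_def H_def B\<psi> unfolding \<psi>_def by (simp add: algebra_simps power2_commute)
    qed
    have "(E has_real_derivative 0) (at r)"
    proof (rule has_real_derivative_0_if_quadratic)
      have "\<forall>\<^sub>F q in nhds r. q \<in> {0<..<R}" using r by (intro eventually_nhds_in_open) auto
      then show "\<forall>\<^sub>F q in nhds r. \<bar>E q\<bar> \<le> C2 * (q - r)\<^sup>2" by (rule eventually_mono) (rule E)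
    qed
    moreover have "((\<lambda>q. w q \<psi> - (q - r) * w q (?B \<psi>)) has_real_derivative 0) (at r)"
      using deriv[OF r(1) \<psi>] deriv[OF r(1) schwartz_airy_op[OF \<psi>, of a b]]
      by (auto intro!: derivative_eq_intros)
    ultimately have "((\<lambda>q. E q + (w q \<psi> - (q - r) * w q (?B \<psi>))) has_real_derivative 0 + 0) (at r)"
      by (rule DERIV_add)
    then show ?thesis by (simp add: E_def)
  qed
  have "continuous_on {0..t} H"
    unfolding continuous_on_def
  proof
    fix r assume r: "r \<in> {0..t}"
    show "(H \<longlongrightarrow> H r) (at r within {0..t})"
    proof (cases "r = 0")
      case False
      with r have "isCont H r" by (intro DERIV_isCont[OF H_deriv]) (auto simp: R_def)
      then show ?thesis
        using continuous_at_imp_continuous_at_within by (auto simp: continuous_within)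
    next
      case True
      \<comment> \<open>At 0 there is no derivative in r to rely on. The test function is frozen at
        its value for q = 0, which by \<open>C1\<close> changes \<open>H\<close> by an amount of
        order q.\<close>
      have "((\<lambda>q. H q - w q (?U t f)) \<longlongrightarrow> 0) (at 0 within {0..t})"
      proof (rule Lim_null_comparison)
        have "norm (H q - w q (?U t f)) \<le> C1 * \<bar>q\<bar>" if q: "q \<in> {0..t}" for q
        proof -
          have "\<bar>w q (?U (t - q) f) - w q (?U t f)\<bar> \<le> C1 * \<bar>(t - q) - t\<bar>"
          proof (rule derivative_bound[where R = R])
            show "((\<lambda>s. w q (?U s f)) has_real_derivative w q (?U s (?B f))) (at s)" for s
              using q f by (intro flow_deriv) auto
            show "\<bar>w q (?U s (?B f))\<bar> \<le> C1" if "\<bar>s\<bar> \<le> R" for s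
              using q that by (intro C1) (auto simp: R_def)
          qed (use q in \<open>auto simp: R_def\<close>)
          then show ?thesis by (simp add: H_def)
        qed
        then show "\<forall>\<^sub>F q in at 0 within {0..t}. norm (H q - w q (?U t f)) \<le> C1 * \<bar>q\<bar>"
          by (simp add: eventually_at_filter)
        have "((\<lambda>q. C1 * \<bar>q\<bar>) \<longlongrightarrow> C1 * \<bar>0\<bar>) (at 0 within {0..t})" by (intro tendsto_intros)
        then show "((\<lambda>q. C1 * \<bar>q\<bar>) \<longlongrightarrow> 0) (at 0 within {0..t})" by simp
      qed
      moreover have "((\<lambda>q. w q (?U t f)) \<longlongrightarrow> w 0 (?U t f)) (at 0 within {0..t})"
      proof -
        have "continuous_on {0..t} (\<lambda>q. w q (?U t f))"
          by (rule continuous_on_subset[OF cont[OF schwartz_airy_flow[OF f]]]) (simp add: R_def)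
        then show ?thesis using \<open>t > 0\<close> by (simp add: continuous_on_def)
      qed
      ultimately have "((\<lambda>q. (H q - w q (?U t f)) + w q (?U t f)) \<longlongrightarrow> 0 + w 0 (?U t f)) (at 0 within {0..t})"
        by (rule tendsto_add)
      then show ?thesis using True by (simp add: H_def[abs_def])
    qed
  qed
  moreover have "(H has_real_derivative 0) (at r)" if "0 < r" "r < t" for r
    using that by (intro H_deriv) (auto simp: R_def)
  ultimately have "H t = H 0" using \<open>t > 0\<close> by (intro DERIV_isconst_end) auto
  then show ?thesis by (simp add: H_def airy_flow_0[OF f])
qed


section \<open>Linearization at a constant and stability\<close>

lemma stationary_solution_const:
  assumes "c > 0"
  shows "stationary_solution (\<lambda>s. c)"
proof -
  have D: "(deriv ^^ k) (\<lambda>s::real. d) = (\<lambda>s. if k = 0 then d else 0)" for k and d :: real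
    by (induction k) auto
  have "smooth (\<lambda>s. c)" by (simp add: smooth_def D)
  moreover have "torsion_rhs (\<lambda>s. c) s = 0" for s by (simp add: torsion_rhs_def D)
  ultimately show ?thesis using assms by (simp add: stationary_solution_def)
qed

lemma powr_compose_has_deriv:
  fixes f :: "real \<Rightarrow> real"
  assumes "(f has_real_derivative f') (at s)" "f s > 0"
  shows "((\<lambda>s. f s powr p) has_real_derivative p * f s powr (p - 1) * f') (at s)"
  using DERIV_fun_powr[OF assms, of p] by simp

text \<open>The constant drops out under every derivative, so a factor \<epsilon> can be pulled out;
  the remaining bracket at \<epsilon> = 0 is the linearization.\<close>

lemma torsion_rhs_perturbation:
  assumes u: "schwartz u" and pos: "\<And>x. c + \<epsilon> * u x > 0"
  shows "torsion_rhs (\<lambda>x. c + \<epsilon> * u x) s = \<epsilon> *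
    (- 1/2 * (c + \<epsilon> * u s) powr (-3/2) * deriv u s
     - 3/2 * (c + \<epsilon> * u s) powr (1/2) * deriv u s
     - 1/2 * (c + \<epsilon> * u s) powr (-3/2) * (deriv ^^ 3) u s
     + 9/4 * \<epsilon> * (c + \<epsilon> * u s) powr (-5/2) * deriv u s * (deriv ^^ 2) u s
     - 15/8 * \<epsilon>\<^sup>2 * (c + \<epsilon> * u s) powr (-7/2) * (deriv u s) ^ 3)"
proof -
  let ?f = "\<lambda>x. c + \<epsilon> * u x"
  have u1: "(u has_real_derivative deriv u x) (at x)" for x
    using schwartz_has_deriv[OF u] .
  have u2: "(deriv u has_real_derivative (deriv ^^ 2) u x) (at x)" for x
    using schwartz_has_deriv_funpow[OF u, of 1 x] by (simp add: numeral_2_eq_2)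
  have u3: "((deriv ^^ 2) u has_real_derivative (deriv ^^ 3) u x) (at x)" for x
    using schwartz_has_deriv_funpow[OF u, of 2 x] by (simp add: numeral_3_eq_3 numeral_2_eq_2)
  have f1: "(?f has_real_derivative \<epsilon> * deriv u x) (at x)" for x
    using u1[of x] by (auto intro!: derivative_eq_intros)
  have pw: "((\<lambda>x. ?f x powr p) has_real_derivative p * ?f x powr (p - 1) * (\<epsilon> * deriv u x)) (at x)" for p x
    using f1 pos by (rule powr_compose_has_deriv)
  define g1 where "g1 x = - 1/2 * \<epsilon> * (?f x powr (-3/2) * deriv u x)" for x
  define g2 where "g2 x = - 1/2 * \<epsilon> * (?f x powr (-3/2) * (deriv ^^ 2) u x)
    + 3/4 * \<epsilon>\<^sup>2 * (?f x powr (-5/2) * (deriv u x)\<^sup>2)" for x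
  \<comment> \<open>9/4 = 3/4 + 3/2 collects the two contributions of u' u'', and 15/8 is 3/4 times
    5/2.\<close>
  define g3 where "g3 x = - 1/2 * \<epsilon> * ?f x powr (-3/2) * (deriv ^^ 3) u x
     + 9/4 * \<epsilon>\<^sup>2 * ?f x powr (-5/2) * deriv u x * (deriv ^^ 2) u x
     - 15/8 * \<epsilon> ^ 3 * ?f x powr (-7/2) * (deriv u x) ^ 3" for x
  have "((\<lambda>x. ?f x powr (-1/2)) has_real_derivative g1 x) (at x)" for x
    using pw[of "-1/2" x] by (simp add: g1_def mult_ac)
  then have d1: "deriv (\<lambda>x. ?f x powr (-1/2)) = g1" by (rule deriv_eqI)
  have "(g1 has_real_derivative g2 x) (at x)" for x
  proof -
    have "(g1 has_real_derivative - 1/2 * \<epsilon> * ((- 3/2 * ?f x powr (-3/2 - 1) * (\<epsilon> * deriv u x)) * deriv u x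
        + (deriv ^^ 2) u x * ?f x powr (-3/2))) (at x)"
      unfolding g1_def[abs_def] by (intro DERIV_cmult DERIV_mult pw u2)
    then show ?thesis by (rule DERIV_cong) (simp add: g2_def power2_eq_square algebra_simps)
  qed
  then have d2: "deriv g1 = g2" by (rule deriv_eqI)
  have g3: "(g2 has_real_derivative g3 x) (at x)" for x
  proof -
    have sq: "((\<lambda>x. (deriv u x)\<^sup>2) has_real_derivative 2 * deriv u x * (deriv ^^ 2) u x) (at x)"
      using u2[of x] by (auto intro!: derivative_eq_intros)
    have "(g2 has_real_derivative - 1/2 * \<epsilon> * ((- 3/2 * ?f x powr (-3/2 - 1) * (\<epsilon> * deriv u x)) * (deriv ^^ 2) u x
        + (deriv ^^ 3) u x * ?f x powr (-3/2))
      + 3/4 * \<epsilon>\<^sup>2 * ((- 5/2 * ?f x powr (-5/2 - 1) * (\<epsilon> * deriv u x)) * (deriv u x)\<^sup>2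
        + 2 * deriv u x * (deriv ^^ 2) u x * ?f x powr (-5/2))) (at x)"
      unfolding g2_def[abs_def] by (intro DERIV_add DERIV_cmult DERIV_mult pw u3 sq)
    then show ?thesis
      by (rule DERIV_cong) (simp add: g3_def power2_eq_square power3_eq_cube algebra_simps)
  qed
  have "(deriv ^^ 2) (\<lambda>x. ?f x powr (-1/2)) = g2"
    by (simp only: numeral_2_eq_2 funpow.simps o_apply id_apply d1 d2)
  then have "torsion_rhs ?f s = deriv (\<lambda>s. ?f s powr (-1/2) - ?f s powr (3/2) + g2 s) s"
    by (simp add: torsion_rhs_def)
  also have "\<dots> = - 1/2 * ?f s powr (-1/2 - 1) * (\<epsilon> * deriv u s)
      - 3/2 * ?f s powr (3/2 - 1) * (\<epsilon> * deriv u s) + g3 s"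
    by (intro DERIV_imp_deriv DERIV_add DERIV_diff pw g3)
  also have "\<dots> = \<epsilon> *
    (- 1/2 * ?f s powr (-3/2) * deriv u s
     - 3/2 * ?f s powr (1/2) * deriv u s
     - 1/2 * ?f s powr (-3/2) * (deriv ^^ 3) u s
     + 9/4 * \<epsilon> * ?f s powr (-5/2) * deriv u s * (deriv ^^ 2) u s
     - 15/8 * \<epsilon>\<^sup>2 * ?f s powr (-7/2) * (deriv u s) ^ 3)"
    by (simp add: g3_def power2_eq_square power3_eq_cube algebra_simps)
  finally show ?thesis .
qed

text \<open>By Caratheodory's criterion the derivative of \<epsilon> Q(\<epsilon>) at 0 is
  \<open>Q 0\<close> once \<open>Q\<close> is continuous there. The terms nonlinear in the
  derivatives of u carry a further \<epsilon> and vanish.\<close>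

lemma linearization_eq_airy_op:
  assumes "c > 0" and u: "schwartz u"
  shows "linearization c u s = - airy_op (c powr (-3/2) / 2) (c powr (-3/2) / 2 + 3/2 * c powr (1/2)) u s"
proof -
  obtain K where K: "K \<ge> 0" "\<And>x. \<bar>u x\<bar> \<le> K" using schwartz_bounded[OF u] by blast
  define Q where "Q \<epsilon> = - 1/2 * (c + \<epsilon> * u s) powr (-3/2) * deriv u s
     - 3/2 * (c + \<epsilon> * u s) powr (1/2) * deriv u s
     - 1/2 * (c + \<epsilon> * u s) powr (-3/2) * (deriv ^^ 3) u s
     + 9/4 * \<epsilon> * (c + \<epsilon> * u s) powr (-5/2) * deriv u s * (deriv ^^ 2) u s
     - 15/8 * \<epsilon>\<^sup>2 * (c + \<epsilon> * u s) powr (-7/2) * (deriv u s) ^ 3" for \<epsilon>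
  \<comment> \<open>In this range the perturbed torsion is positive on the whole line; the 1 in K +
    1 covers K = 0.\<close>
  have "\<forall>\<^sub>F \<epsilon> in nhds 0. \<epsilon> \<in> {- (c / (K + 1))<..<c / (K + 1)}"
    using \<open>c > 0\<close> K(1) by (intro eventually_nhds_in_open) auto
  then have "\<forall>\<^sub>F \<epsilon> in nhds 0. torsion_rhs (\<lambda>x. c + \<epsilon> * u x) s = \<epsilon> * Q \<epsilon>"
  proof (rule eventually_mono)
    fix \<epsilon> assume "\<epsilon> \<in> {- (c / (K + 1))<..<c / (K + 1)}"
    then have "\<bar>\<epsilon>\<bar> < c / (K + 1)" by auto
    then have \<epsilon>: "\<bar>\<epsilon>\<bar> * (K + 1) < c" using K(1) by (simp add: pos_less_divide_eq)
    have "c + \<epsilon> * u x > 0" for x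
    proof -
      have "\<bar>\<epsilon> * u x\<bar> \<le> \<bar>\<epsilon>\<bar> * (K + 1)"
        unfolding abs_mult using K(2)[of x] by (intro mult_left_mono) auto
      then show ?thesis using \<epsilon> by linarith
    qed
    then show "torsion_rhs (\<lambda>x. c + \<epsilon> * u x) s = \<epsilon> * Q \<epsilon>"
      unfolding Q_def by (rule torsion_rhs_perturbation[OF u])
  qed
  then have "linearization c u s = deriv (\<lambda>\<epsilon>. \<epsilon> * Q \<epsilon>) 0"
    unfolding linearization_def by (rule deriv_cong_ev) simp
  also have "\<dots> = Q 0"
  proof (rule DERIV_imp_deriv)
    have "isCont Q 0"
      unfolding Q_def[abs_def] using \<open>c > 0\<close> by (intro continuous_intros) auto
    then show "((\<lambda>\<epsilon>. \<epsilon> * Q \<epsilon>) has_real_derivative Q 0) (at 0)"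
      unfolding CARAT_DERIV by (intro exI[of _ Q]) simp
  qed
  also have "\<dots> = - airy_op (c powr (-3/2) / 2) (c powr (-3/2) / 2 + 3/2 * c powr (1/2)) u s"
    by (simp add: Q_def airy_op_def algebra_simps)
  finally show ?thesis .
qed

section \<open>The transposed equation and its solutions\<close>

lemma AE_zero_imp_zero:
  fixes h :: "real \<Rightarrow> real"
  assumes "AE s in lborel. h s = 0" and cont: "\<And>s. isCont h s"
  shows "h s = 0"
proof (rule ccontr)
  assume "h s \<noteq> 0"
  have [measurable]: "h \<in> borel_measurable borel"
    by (intro borel_measurable_continuous_onI continuous_at_imp_continuous_on) (simp add: cont)
  have "{s. h s \<noteq> 0} \<in> null_sets lborel"
    using assms(1) by (subst AE_iff_null_sets) auto
  then have "negligible {s. h s \<noteq> 0}"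
    by (simp add: negligible_iff_null_sets null_sets_completionI)
  moreover have "open {s. h s \<noteq> 0}"
    by (intro open_Collect_neq continuous_at_imp_continuous_on continuous_on_const) (simp add: cont)
  ultimately show False using open_not_negligible[of "{s. h s \<noteq> 0}"] \<open>h s \<noteq> 0\<close> by blast
qed

text \<open>The difference of the two functions is itself an admissible test function, so its
  \<open>L2\<close> norm is zero.\<close>

lemma schwartz_eqI:
  assumes "schwartz f" "schwartz g"
    and eq: "\<And>u. schwartz u \<Longrightarrow> (LINT s|lborel. u s * f s) = (LINT s|lborel. u s * g s)"
  shows "f = g"
proof
  fix s
  let ?h = "\<lambda>s. f s - g s"
  have h: "schwartz ?h" using assms(1,2) by (rule schwartz_diff)
  have "(LINT s|lborel. (?h s)\<^sup>2) = (LINT s|lborel. ?h s * f s) - (LINT s|lborel. ?h s * g s)"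
    using schwartz_integrable_mult[OF h assms(1)] schwartz_integrable_mult[OF h assms(2)]
    by (simp add: power2_eq_square right_diff_distrib[symmetric] Bochner_Integration.integral_diff[symmetric])
  then have "(LINT s|lborel. (?h s)\<^sup>2) = 0" using eq[OF h] by simp
  then have "AE s in lborel. ?h s = 0"
    using integral_nonneg_eq_0_iff_AE[OF L2_D(2)[OF schwartz_L2[OF h]]] by simp
  then have "?h s = 0" by (rule AE_zero_imp_zero) (rule schwartz_isCont[OF h])
  then show "f s = g s" by simp
qed

text \<open>Existence and uniqueness of the transposed test function turn the existential in
  \<open>weak_solution\<close> into an explicit equation. The minus sign of the linearization
  cancels that of skewness.\<close>

lemma transposed_test_linearization_iff:
  fixes c :: real
  defines "a \<equiv> c powr (-3/2) / 2" and "b \<equiv> c powr (-3/2) / 2 + 3/2 * c powr (1/2)"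
  assumes "c > 0" and \<phi>: "schwartz \<phi>"
  shows "transposed_test (linearization c) \<phi> \<psi> \<longleftrightarrow> \<psi> = airy_op a b \<phi>"
proof -
  have adjoint: "(LINT s|lborel. linearization c u s * \<phi> s) = (LINT s|lborel. u s * airy_op a b \<phi> s)"
    if "schwartz u" for u
    unfolding linearization_eq_airy_op[OF \<open>c > 0\<close> that] b_def[symmetric]
    unfolding a_def[symmetric]
    using airy_op_skew[OF that \<phi>, of a b] by simp
  show ?thesis
  proof
    assume "transposed_test (linearization c) \<phi> \<psi>"
    then show "\<psi> = airy_op a b \<phi>"
      using adjoint by (intro schwartz_eqI) (auto simp: transposed_test_def schwartz_airy_op[OF \<phi>])
  next
    assume "\<psi> = airy_op a b \<phi>"
    then show "transposed_test (linearization c) \<phi> \<psi>"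
      using adjoint by (simp add: transposed_test_def schwartz_airy_op[OF \<phi>])
  qed
qed

lemma weak_solution_exists:
  fixes c :: real
  defines "a \<equiv> c powr (-3/2) / 2" and "b \<equiv> c powr (-3/2) / 2 + 3/2 * c powr (1/2)"
  assumes "c > 0" and w0: "w\<^sub>0 \<in> L2"
  shows "weak_solution c w\<^sub>0 (\<lambda>t \<phi>. LINT s|lborel. w\<^sub>0 s * airy_flow a b t \<phi> s)"
  unfolding weak_solution_def
proof (intro conjI allI impI)
  show "tempered_distribution (\<lambda>\<phi>. LINT s|lborel. w\<^sub>0 s * airy_flow a b t \<phi> s)" for t
    using w0 by (rule tempered_dual_airy_flow)
  show "represents w\<^sub>0 (\<lambda>\<phi>. LINT s|lborel. w\<^sub>0 s * airy_flow a b 0 \<phi> s)"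
    by (simp add: represents_def airy_flow_0)
next
  fix \<phi> assume \<phi>: "schwartz \<phi>"
  have deriv: "((\<lambda>r. LINT s|lborel. w\<^sub>0 s * airy_flow a b r \<phi> s) has_real_derivative
      (LINT s|lborel. w\<^sub>0 s * airy_flow a b t (airy_op a b \<phi>) s)) (at t)" for t
    using w0 \<phi> by (rule dual_airy_flow_has_deriv)
  show "\<exists>\<psi>. transposed_test (linearization c) \<phi> \<psi> \<and>
      ((\<lambda>r. LINT s|lborel. w\<^sub>0 s * airy_flow a b r \<phi> s) has_real_derivative
        (LINT s|lborel. w\<^sub>0 s * airy_flow a b t \<psi> s)) (at t)" for t
    using deriv transposed_test_linearization_iff[OF \<open>c > 0\<close> \<phi>]
    unfolding a_def b_def by blast
  \<comment> \<open>The formula is differentiable in r on the whole real line, so the limit from the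
    right at 0 is inherited from two-sided continuity.\<close>
  have "((\<lambda>r. LINT s|lborel. w\<^sub>0 s * airy_flow a b r \<phi> s) \<longlongrightarrow>
      (LINT s|lborel. w\<^sub>0 s * airy_flow a b 0 \<phi> s)) (at 0)"
    using DERIV_isCont[OF deriv[of 0]] by (simp add: isCont_def)
  then show "((\<lambda>r. LINT s|lborel. w\<^sub>0 s * airy_flow a b r \<phi> s) \<longlongrightarrow>
      (LINT s|lborel. w\<^sub>0 s * \<phi> s)) (at_right 0)"
    unfolding airy_flow_0[OF \<phi>] by (rule tendsto_mono[OF at_le[OF subset_UNIV]])
qed

lemma weak_solution_unique:
  fixes c :: real
  defines "a \<equiv> c powr (-3/2) / 2" and "b \<equiv> c powr (-3/2) / 2 + 3/2 * c powr (1/2)"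
  assumes "c > 0" and w: "weak_solution c w\<^sub>0 w" and "t \<ge> 0" and f: "schwartz f"
  shows "w t f = (LINT s|lborel. w\<^sub>0 s * airy_flow a b t f s)"
proof -
  have tempered: "\<And>t. t \<ge> 0 \<Longrightarrow> tempered_distribution (w t)"
    and eq: "\<And>t \<phi>. t > 0 \<Longrightarrow> schwartz \<phi> \<Longrightarrow> \<exists>\<psi>. transposed_test (linearization c) \<phi> \<psi> \<and>
      ((\<lambda>r. w r \<phi>) has_real_derivative w t \<psi>) (at t)"
    and repr: "represents w\<^sub>0 (w 0)"
    and lim: "\<And>\<phi>. schwartz \<phi> \<Longrightarrow> ((\<lambda>t. w t \<phi>) \<longlongrightarrow> (LINT s|lborel. w\<^sub>0 s * \<phi> s)) (at_right 0)"
    using w unfolding weak_solution_def by auto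
  have init: "w 0 \<phi> = (LINT s|lborel. w\<^sub>0 s * \<phi> s)" if "schwartz \<phi>" for \<phi>
    using repr that by (simp add: represents_def)
  have deriv: "((\<lambda>r. w r \<phi>) has_real_derivative w t (airy_op a b \<phi>)) (at t)"
    if "t > 0" "schwartz \<phi>" for t \<phi>
    using eq[OF that] transposed_test_linearization_iff[OF \<open>c > 0\<close> that(2)]
    unfolding a_def b_def by auto
  have "w t f = w 0 (airy_flow a b t f)"
  \<comment> \<open>The evolution theorem is about positive times; at time 0 the flow is the
    identity.\<close>
  proof (cases "t = 0")
    case True
    then show ?thesis by (simp add: airy_flow_0[OF f])
  next
    case False
    then show ?thesis
      using \<open>t \<ge> 0\<close> tempered deriv lim init f by (intro weak_airy_evolution_unique) auto
  qed
  then show ?thesis by (simp add: init schwartz_airy_flow[OF f])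
qed

theorem theorem3p4:
  fixes \<tau>\<^sub>0 :: real
  assumes "\<tau>\<^sub>0 > 0"
  shows "stationary_solution (\<lambda>s. \<tau>\<^sub>0) \<and> L2_linearly_stable \<tau>\<^sub>0"
proof
  show "stationary_solution (\<lambda>s. \<tau>\<^sub>0)" using assms by (rule stationary_solution_const)
  have "\<exists>f\<in>L2. represents f (w t) \<and> L2_norm f \<le> L2_norm w\<^sub>0"
    if w0: "w\<^sub>0 \<in> L2" and w: "weak_solution \<tau>\<^sub>0 w\<^sub>0 w" and t: "t \<ge> 0" for w\<^sub>0 w t
  proof -
    have "tempered_distribution (w t)" using w t by (simp add: weak_solution_def)
    note lin = tempered_lincomb[OF this]
    have "\<bar>w t f\<bar> \<le> L2_norm w\<^sub>0 * L2_norm f" if "schwartz f" for f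
      unfolding weak_solution_unique[OF assms w t that] using w0 that by (rule dual_airy_flow_bound)
    \<comment> \<open>Stability asks for a function in \<open>L2\<close>, whereas \<open>w t\<close>
      is given only as a distribution; its bound on Schwartz functions produces that
      function.\<close>
    from schwartz_Riesz_representation[OF lin this L2_norm_nonneg] show ?thesis by blast
  qed
  then show "L2_linearly_stable \<tau>\<^sub>0"
    unfolding L2_linearly_stable_def
    using weak_solution_exists[OF assms] by (meson le_less_trans)
qed

end
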